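(* Let $G$ be a discrete group generated by reflections in hyperbolic space $\mathbb{H}^n$ or Euclidean space $\mathbb{E}^n$, and let $H\subset G$ be a finite index subgroup generated by reflections. Suppose that the fundamental chamber of $G$ is a finite volume polytope with exactly $k$ facets. Then the fundamental chamber of $H$ has at least $k$ facets.
   Context: For a discrete group $\Gamma$ generated by reflections in $\mathbb{H}^n$ or $\mathbb{E}^n$, a fundamental chamber of $\Gamma$ is the closure of a connected component of the complement of the union of the mirrors (fixed hyperplanes) of all reflections belonging to $\Gamma$; all fundamental chambers of $\Gamma$ are congruent. Facets are faces of codimension one. *)

theory Defs
  imports
    "HOL-Analysis.Analysis"
    "HOL-Algebra.Bij"
    "HOL-Algebra.Coset"
    "HOL-Algebra.Generated_Groups"
begin

text \<open>
  Both geometries live on a subset of a Euclidean space of dimension \<open>n\<close>: Euclidean space on the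
  whole of it, hyperbolic space on the open unit ball (the projective Beltrami--Klein model).  In
  this model geodesic segments are straight segments and hyperplanes are the nonempty traces of
  affine hyperplanes, so that convexity, half-spaces, faces, facets and dimension of a subset of
  hyperbolic space are the affine notions of the library.
\<close>

datatype geometry = Euclidean | Hyperbolic

primrec points :: "geometry \<Rightarrow> 'a::euclidean_space set" where
  "points Euclidean = UNIV"
| "points Hyperbolic = ball 0 1"

text \<open>
  In the hyperboloid model the point \<open>x\<close> of the ball corresponds to \<open>(x, 1) / sqrt (1 - x \<bullet> x)\<close>, and
  the distance is \<open>arcosh\<close> of minus the Lorentzian product; this gives the second equation.
  It is only meaningful for \<open>x\<close> and \<open>y\<close> in the open unit ball.
\<close>

primrec gdist :: "geometry \<Rightarrow> 'a::euclidean_space \<Rightarrow> 'a \<Rightarrow> real" where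
  "gdist Euclidean x y = dist x y"
| "gdist Hyperbolic x y = arcosh ((1 - x \<bullet> y) / (sqrt (1 - x \<bullet> x) * sqrt (1 - y \<bullet> y)))"

text \<open>
  The determinant of the Riemannian metric tensor of the Klein model at \<open>x\<close> is
  \<open>1 / (1 - x \<bullet> x) ^ (n + 1)\<close>, where \<open>n\<close> is the dimension.
\<close>

primrec volume :: "geometry \<Rightarrow> 'a::euclidean_space measure" where
  "volume Euclidean = lborel"
| "volume Hyperbolic = density lborel
     (\<lambda>x. indicator (ball 0 1) x * ennreal ((1 - x \<bullet> x) powr (- (real DIM('a) + 1) / 2)))"

definition hyperplanes :: "geometry \<Rightarrow> 'a::euclidean_space set set" where
  "hyperplanes X = {points X \<inter> {x. a \<bullet> x = b} | a b. a \<noteq> 0 \<and> points X \<inter> {x. a \<bullet> x = b} \<noteq> {}}"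

text \<open>
  Isometries are represented, as in the library's group of bijections, by functions that are
  \<open>undefined\<close> outside \<open>points X\<close>.
\<close>

definition isometries :: "geometry \<Rightarrow> ('a::euclidean_space \<Rightarrow> 'a) set" where
  "isometries X =
     {f \<in> Bij (points X). \<forall>x\<in>points X. \<forall>y\<in>points X. gdist X (f x) (f y) = gdist X x y}"

definition mirror :: "geometry \<Rightarrow> ('a::euclidean_space \<Rightarrow> 'a) \<Rightarrow> 'a set" where
  "mirror X s = {x \<in> points X. s x = x}"

definition reflections :: "geometry \<Rightarrow> ('a::euclidean_space \<Rightarrow> 'a) set" where
  "reflections X = {s \<in> isometries X. mirror X s \<in> hyperplanes X}"

definition generated_by_reflections :: "geometry \<Rightarrow> ('a::euclidean_space \<Rightarrow> 'a) set \<Rightarrow> bool" where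
  "generated_by_reflections X G \<longleftrightarrow> (\<exists>R \<subseteq> reflections X. G = generate (BijGroup (points X)) R)"

text \<open>
  Discreteness is that of a subset of the isometry group.  The topology on functions is that of
  pointwise convergence, which on a group of isometries coincides with the compact-open topology.
\<close>

definition discrete_reflection_group :: "geometry \<Rightarrow> ('a::euclidean_space \<Rightarrow> 'a) set \<Rightarrow> bool" where
  "discrete_reflection_group X G \<longleftrightarrow> generated_by_reflections X G \<and> discrete G"

definition group_of :: "geometry \<Rightarrow> ('a::euclidean_space \<Rightarrow> 'a) set \<Rightarrow> ('a \<Rightarrow> 'a) monoid" where
  "group_of X G = (BijGroup (points X)) \<lparr>carrier := G\<rparr>"

text \<open>
  The closure is taken in \<open>points X\<close>: a hyperbolic chamber does not contain its ideal points, which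
  lie on the unit sphere.
\<close>

definition fundamental_chambers ::
    "geometry \<Rightarrow> ('a::euclidean_space \<Rightarrow> 'a) set \<Rightarrow> 'a set set" where
  "fundamental_chambers X G =
     (\<lambda>U. points X \<inter> closure U) `
       components (points X - (\<Union>s\<in>G \<inter> reflections X. mirror X s))"

text \<open>
  A polytope here is a finite intersection of half-spaces of the geometry, possibly unbounded.
\<close>

definition polytope_in :: "geometry \<Rightarrow> 'a::euclidean_space set \<Rightarrow> bool" where
  "polytope_in X C \<longleftrightarrow> (\<exists>P. polyhedron P \<and> C = points X \<inter> P)"

definition finite_volume_polytope :: "geometry \<Rightarrow> 'a::euclidean_space set \<Rightarrow> bool" where
  "finite_volume_polytope X C \<longleftrightarrow> polytope_in X C \<and> emeasure (volume X) C < \<infinity>"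

definition facets :: "'a::euclidean_space set \<Rightarrow> 'a set set" where
  "facets C = {F. F facet_of C}"

end

theory Submission
  imports Defs
begin

text \<open>
  Both geometries are written as sections of the cone over \<open>points X\<close> in \<open>'a \<times> real\<close>, on whose
  dual \<open>M\<close> every isometry acts linearly; a mirror is the zero set of a root in \<open>M\<close>.  A cocycle
  \<open>c : G \<rightarrow> M\<close> maps each reflection to a multiple of its root.  Since \<open>G\<close> satisfies the exchange
  condition, arbitrary multiples may be prescribed at the reflections in the \<open>k\<close> walls of \<open>C\<close>, so
  the cocycles of \<open>G\<close> form a space of dimension \<open>k\<close>, whereas those of \<open>H\<close> form one of dimension at
  most the number of facets of \<open>D\<close>.  It remains to see that restriction to \<open>H\<close> is injective.  A
  cocycle vanishing on \<open>H\<close> takes finitely many values, so the vector \<open>c s\<close> of a reflection has a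
  finite orbit.  The translates of \<open>c s\<close> that are largest and smallest at an interior point of \<open>C\<close>
  lie in the cone over \<open>C\<close> and in its negative, and for finite volume this forces \<open>c s = 0\<close>.
\<close>

section \<open>Cocycles of groups with the exchange condition\<close>

text \<open>Facets of \<open>D\<close> cannot be matched with facets of \<open>C\<close>: a
  reflection in a wall of \<open>C\<close> may have no conjugate in \<open>H\<close>. In the
  infinite dihedral group generated by \<open>s\<close> and \<open>t\<close>, the subgroup generated
  by \<open>s\<close> and \<open>tst\<close> contains no conjugate of \<open>t\<close>. Dimensions
  replace the matching, because a cocycle is determined by its values on generating reflections and
  each such value lies on a line.

  Existence of cocycles is the delicate direction. Prescribed values must respect the relations
  between two walls, and these matter only for pairs with a chamber beyond both. On such a pair the
  values form a coboundary, because the two roots are independent modulo the radical of the form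
  \<open>\<alpha> \<bullet> sharp X \<beta>\<close>. Parallel walls of a Euclidean chamber are
  dependent in this sense, but no chamber lies beyond both of them.

  Constant functionals are invariant in the Euclidean case, so a finite orbit can force only the
  linear part of a functional to vanish; this suffices since the linear part of a root is nonzero.
  In the hyperbolic case a finite orbit gives a sign only, and it is applied to a vector and to its
  negative.\<close>

text \<open>
  \<open>D s w\<close> says that the chamber \<open>w\<close> lies on the negative side of the mirror of \<open>s\<close>; the last
  assumption is Tits' criterion.
\<close>

locale half_space_system = group G for G (structure) +
  fixes S :: "'a set" and D :: "'a \<Rightarrow> 'a \<Rightarrow> bool"
  assumes S_carrier: "S \<subseteq> carrier G"
    and S_square: "s \<in> S \<Longrightarrow> s \<otimes> s = \<one>"
    and D_one: "s \<in> S \<Longrightarrow> \<not> D s \<one>"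
    and D_flip: "s \<in> S \<Longrightarrow> w \<in> generate G S \<Longrightarrow> D s (s \<otimes> w) \<longleftrightarrow> \<not> D s w"
    and D_cross: "s \<in> S \<Longrightarrow> t \<in> S \<Longrightarrow> w \<in> generate G S \<Longrightarrow> \<not> D s w \<Longrightarrow> D s (w \<otimes> t)
      \<Longrightarrow> s \<otimes> w = w \<otimes> t"
begin

definition wd :: "'a list \<Rightarrow> 'a" where
  "wd u = foldr (\<otimes>) u \<one>"

lemma wd_Nil [simp]: "wd [] = \<one>"
  and wd_Cons [simp]: "wd (x # u) = x \<otimes> wd u"
  by (simp_all add: wd_def)

lemma gen_carrier: "w \<in> generate G S \<Longrightarrow> w \<in> carrier G"
  using generate_in_carrier[OF S_carrier] .

lemma S_gen: "s \<in> S \<Longrightarrow> s \<in> generate G S"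
  by (rule generate.incl)

lemma S_inv: "s \<in> S \<Longrightarrow> inv s = s"
  using S_square S_carrier by (metis inv_equality subsetD)

lemma S_cancel: "s \<in> S \<Longrightarrow> w \<in> carrier G \<Longrightarrow> s \<otimes> (s \<otimes> w) = w"
  using S_square S_carrier by (metis l_one m_assoc subsetD)

lemma wd_gen: "u \<in> lists S \<Longrightarrow> wd u \<in> generate G S"
  by (induction u) (auto intro: generate.one generate.eng generate.incl)

lemma wd_carrier: "u \<in> lists S \<Longrightarrow> wd u \<in> carrier G"
  using wd_gen gen_carrier by blast

lemma wd_append: "u \<in> lists S \<Longrightarrow> v \<in> lists S \<Longrightarrow> wd (u @ v) = wd u \<otimes> wd v"
proof (induction u)
  case Nil then show ?case using wd_carrier by simp
next
  case (Cons x u)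
  then have "x \<in> carrier G" "wd u \<in> carrier G" "wd v \<in> carrier G"
    using S_carrier wd_carrier by auto
  then show ?case using Cons by (simp add: m_assoc)
qed

lemma ex_word: "w \<in> generate G T \<Longrightarrow> T \<subseteq> S \<Longrightarrow> \<exists>u\<in>lists T. wd u = w"
proof (induction rule: generate.induct)
  case one then show ?case by (intro bexI[of _ "[]"]) auto
next
  case (incl h) then show ?case using S_carrier by (intro bexI[of _ "[h]"]) auto
next
  case (inv h)
  then have "h \<in> S" "h \<in> carrier G" using S_carrier by auto
  then have "wd [h] = inv h" using S_inv[of h] by simp
  then show ?case using inv by (intro bexI[of _ "[h]"]) auto
next
  case (eng h1 h2)
  then obtain u v where "u \<in> lists T" "wd u = h1" "v \<in> lists T" "wd v = h2" by auto
  moreover then have "u \<in> lists S" "v \<in> lists S" using eng.prems by auto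
  ultimately show ?case by (intro bexI[of _ "u @ v"]) (auto simp: wd_append)
qed

text \<open>The prefixes of \<open>u\<close> start on the positive side of the mirror of
  \<open>s\<close> and end on the negative side. At the letter where the side changes,
  \<open>D_cross\<close> carries \<open>s\<close> through the prefix and cancels that
  letter.\<close>

lemma exchange:
  assumes "u \<in> lists S" "s \<in> S" "D s (wd u)"
  shows "\<exists>a x b. u = a @ x # b \<and> s \<otimes> wd u = wd (a @ b)"
  using assms(1,3)
proof (induction u rule: rev_induct)
  case Nil then show ?case using D_one assms(2) by simp
next
  case (snoc x u)
  then have u: "u \<in> lists S" "x \<in> S" by auto
  have c: "s \<in> carrier G" "wd u \<in> carrier G" "x \<in> carrier G"
    using S_carrier wd_carrier u assms(2) by auto
  have e: "wd (u @ [x]) = wd u \<otimes> x" using u c by (simp add: wd_append)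
  show ?case
  proof (cases "D s (wd u)")
    case True
    then obtain a y b where 1: "u = a @ y # b" "s \<otimes> wd u = wd (a @ b)"
      using snoc u by blast
    have "a @ b \<in> lists S" using 1 u by auto
    then have "s \<otimes> wd (u @ [x]) = wd ((a @ b) @ [x])"
      using e c u 1 by (subst wd_append) (auto simp: m_assoc[symmetric])
    then show ?thesis using 1 by (intro exI[of _ a] exI[of _ y] exI[of _ "b @ [x]"]) auto
  next
    case False
    then have "s \<otimes> wd u = wd u \<otimes> x"
      using D_cross[OF assms(2) u(2) wd_gen[OF u(1)]] snoc e by auto
    then have "s \<otimes> wd (u @ [x]) = wd u"
      using e c S_cancel u S_square by (simp add: m_assoc[symmetric]) (simp add: m_assoc)
    then show ?thesis by (intro exI[of _ u] exI[of _ x] exI[of _ "[]"]) auto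
  qed
qed

section \<open>Word length, and the side of a mirror read off from it\<close>

definition len :: "'a \<Rightarrow> nat" where
  "len w = (LEAST n. \<exists>u\<in>lists S. length u = n \<and> wd u = w)"

lemma len_le: "u \<in> lists S \<Longrightarrow> len (wd u) \<le> length u"
  unfolding len_def by (rule Least_le) auto

lemma ex_reduced: "w \<in> generate G S \<Longrightarrow> \<exists>u\<in>lists S. length u = len w \<and> wd u = w"
  unfolding len_def by (rule LeastI_ex) (use ex_word[of w S] in auto)

lemma len_mult_le: "s \<in> S \<Longrightarrow> w \<in> generate G S \<Longrightarrow> len (s \<otimes> w) \<le> Suc (len w)"
proof -
  assume a: "s \<in> S" "w \<in> generate G S"
  obtain u where "u \<in> lists S" "length u = len w" "wd u = w" using ex_reduced a by blast
  then show ?thesis using len_le[of "s # u"] a by simp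
qed

lemma gen_mult: "s \<in> S \<Longrightarrow> w \<in> generate G S \<Longrightarrow> s \<otimes> w \<in> generate G S"
  by (rule generate.eng[OF S_gen])

lemma len_descent:
  assumes "s \<in> S" "w \<in> generate G S" "D s w"
  shows "len w = Suc (len (s \<otimes> w))"
proof -
  obtain u where u: "u \<in> lists S" "length u = len w" "wd u = w" using ex_reduced assms by blast
  then obtain a x b where 1: "u = a @ x # b" "s \<otimes> w = wd (a @ b)"
    using exchange assms by blast
  then have "len (s \<otimes> w) \<le> length (a @ b)" using u by (metis Cons_in_lists_iff append_in_lists_conv len_le)
  moreover have "len w \<le> Suc (len (s \<otimes> w))"
    using len_mult_le[OF assms(1) gen_mult[OF assms(1,2)]] S_cancel assms gen_carrier by simp
  ultimately show ?thesis using u 1 by simp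
qed

lemma len_ascent:
  assumes "s \<in> S" "w \<in> generate G S" "\<not> D s w"
  shows "len (s \<otimes> w) = Suc (len w)"
proof -
  have "D s (s \<otimes> w)" using D_flip assms by blast
  then show ?thesis using len_descent[OF assms(1) gen_mult[OF assms(1,2)]] S_cancel assms gen_carrier by simp
qed

lemma D_iff_len: "s \<in> S \<Longrightarrow> w \<in> generate G S \<Longrightarrow> D s w \<longleftrightarrow> len (s \<otimes> w) < len w"
  using len_descent len_ascent by fastforce

text \<open>Descending inside the coset by elements of \<open>T\<close> can stop only at its
  shortest element. This is what terminates the induction in \<open>cw_reduced_eq\<close>.\<close>

lemma shortest_in_coset:
  assumes "T \<subseteq> S" "w0 \<in> generate G S" "d \<in> generate G T"
    and min: "\<And>e. e \<in> generate G T \<Longrightarrow> len w0 \<le> len (e \<otimes> w0)"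
    and nd: "\<And>s. s \<in> T \<Longrightarrow> \<not> D s (d \<otimes> w0)"
  shows "d = \<one>"
proof -
  define P where "P n \<longleftrightarrow> (\<exists>z\<in>lists T. length z = n \<and> wd z = d)" for n
  have "\<exists>n. P n" using ex_word[OF assms(3,1)] unfolding P_def by auto
  then have "P (LEAST n. P n)" by (rule LeastI_ex)
  then obtain z where z: "z \<in> lists T" "length z = (LEAST n. P n)" "wd z = d" unfolding P_def by auto
  have short: "length z \<le> length y" if "y \<in> lists T" "wd y = d" for y
    using that z(2) Least_le[of P "length y"] unfolding P_def by auto
  obtain e0 where e0: "e0 \<in> lists S" "length e0 = len w0" "wd e0 = w0" using ex_reduced assms(2) by blast
  show ?thesis
  proof (cases z)
    case (Cons s y)
    have s: "s \<in> T" "y \<in> lists T" "s \<in> S" "y \<in> lists S" using z Cons assms(1) by auto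
    have c: "s \<in> carrier G" "wd y \<in> carrier G" "w0 \<in> carrier G"
      using s S_carrier wd_carrier assms gen_carrier by auto
    have ye: "wd (y @ e0) = wd y \<otimes> w0" "wd (y @ e0) \<in> generate G S"
      using s e0 wd_append[of y e0] wd_gen[of "y @ e0"] by auto
    have "d = s \<otimes> wd y" using z Cons by auto
    then have "d \<otimes> w0 = s \<otimes> wd (y @ e0)" using c ye by (simp add: m_assoc)
    then have "D s (wd (y @ e0))" using nd[OF s(1)] D_flip[OF s(3) ye(2)] by metis
    then obtain a x b where 1: "y @ e0 = a @ x # b" "s \<otimes> wd (y @ e0) = wd (a @ b)"
      using exchange[of "y @ e0" s] s e0 by auto
    show ?thesis
    \<comment> \<open>The exchange deletes a letter either from \<open>y\<close>, which gives a word
      for \<open>d\<close> shorter than \<open>z\<close>, or from \<open>e0\<close>, which gives an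
      element of the coset shorter than \<open>w0\<close>.\<close>
    proof (cases "length a < length y")
      case True
      define b' where "b' = drop (Suc (length a)) y"
      have yb: "y = a @ x # b'" "b = b' @ e0"
      proof -
        have "take (length y) (y @ e0) = take (length y) (a @ x # b)" using 1 by simp
        then have *: "y = a @ x # take (length y - Suc (length a)) b"
          using True by (simp add: take_Cons')
        show **: "y = a @ x # b'"
          using * unfolding b'_def by (metis append_Cons append_Nil append_assoc append_eq_conv_conj length_append_singleton)
        show "b = b' @ e0" using 1 by (subst (asm) **) simp
      qed
      have l: "a @ b' \<in> lists T" "a @ b' \<in> lists S" using s(2,4) yb by auto
      have "s \<otimes> wd (y @ e0) = wd ((a @ b') @ e0)" using 1(2) yb(2) by simp
      also have "\<dots> = wd (a @ b') \<otimes> w0" using wd_append[OF l(2) e0(1)] e0(3) by simp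
      finally have "s \<otimes> wd y \<otimes> w0 = wd (a @ b') \<otimes> w0" using ye(1) c by (simp add: m_assoc)
      then have "s \<otimes> wd y = wd (a @ b')" using c l wd_carrier by simp
      then have "length z \<le> length (a @ b')" using short[OF l(1)] z Cons by simp
      then show ?thesis using yb Cons by simp
    next
      case False
      define a' where "a' = drop (length y) a"
      have "take (length y) (y @ e0) = take (length y) (a @ x # b)" using 1 by simp
      then have "y = take (length y) a" using False by simp
      then have ya: "a = y @ a'" unfolding a'_def by (metis append_take_drop_id)
      then have e0': "e0 = a' @ x # b" using 1 by simp
      then have l: "a' @ b \<in> lists S" using e0 by auto
      have "s \<otimes> wd (y @ e0) = wd (y @ (a' @ b))" using 1(2) ya by simp
      then have "s \<otimes> (wd y \<otimes> w0) = wd y \<otimes> wd (a' @ b)"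
        using ye(1) wd_append[OF s(4) l] by simp
      then have "wd (a' @ b) = inv (wd y) \<otimes> (s \<otimes> (wd y \<otimes> w0))"
        using c l wd_carrier by (simp add: inv_solve_left)
      also have "\<dots> = (inv (wd y) \<otimes> s \<otimes> wd y) \<otimes> w0" using c by (simp add: m_assoc)
      finally have eq: "wd (a' @ b) = (inv (wd y) \<otimes> s \<otimes> wd y) \<otimes> w0" .
      have Tc: "T \<subseteq> carrier G" using assms(1) S_carrier by blast
      have sg: "subgroup (generate G T) G" by (rule generate_is_subgroup[OF Tc])
      have wy: "wd y \<in> generate G T" using s(2)
        by (induction y) (auto intro: generate.one generate.eng generate.incl)
      have "inv (wd y) \<otimes> s \<otimes> wd y \<in> generate G T"
        using wy s sg by (intro subgroup.m_closed[OF sg] subgroup.m_inv_closed[OF sg]) (auto intro: generate.incl)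
      then have "len w0 \<le> len (wd (a' @ b))" using min eq by simp
      also have "\<dots> \<le> length (a' @ b)" using len_le l by blast
      finally show ?thesis using e0 e0' by simp
    qed
  qed (use z in auto)
qed

lemma ex_shortest_in_coset:
  assumes "T \<subseteq> S" "w \<in> generate G S"
  obtains d w0 where "d \<in> generate G T" "w0 \<in> generate G S" "w = d \<otimes> w0"
    "\<And>e. e \<in> generate G T \<Longrightarrow> len w0 \<le> len (e \<otimes> w0)"
proof -
  have Tc: "T \<subseteq> carrier G" using assms(1) S_carrier by blast
  have sg: "subgroup (generate G T) G" by (rule generate_is_subgroup[OF Tc])
  have TS: "generate G T \<subseteq> generate G S" using assms(1) mono_generate by blast
  have sgS: "subgroup (generate G S) G" by (rule generate_is_subgroup[OF S_carrier])
  obtain d where d: "d \<in> generate G T" "\<forall>y. y \<in> generate G T \<longrightarrow> len (d \<otimes> w) \<le> len (y \<otimes> w)"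
    using ex_has_least_nat[of "\<lambda>x. x \<in> generate G T" \<one> "\<lambda>x. len (x \<otimes> w)"] generate.one by blast
  have c: "d \<in> carrier G" "w \<in> carrier G" using d TS gen_carrier assms by auto
  show ?thesis
  proof
    show "inv d \<in> generate G T" using d sg by (simp add: subgroup.m_inv_closed)
    show "d \<otimes> w \<in> generate G S" using d TS assms sgS by (meson subgroup.m_closed subsetD)
    show "w = inv d \<otimes> (d \<otimes> w)" using c by (simp add: m_assoc[symmetric])
    fix e assume e: "e \<in> generate G T"
    then have "e \<otimes> d \<in> generate G T" using d sg by (simp add: subgroup.m_closed)
    moreover have "e \<otimes> (d \<otimes> w) = (e \<otimes> d) \<otimes> w" using e c TS gen_carrier by (simp add: m_assoc subset_iff)
    ultimately show "len (d \<otimes> w) \<le> len (e \<otimes> (d \<otimes> w))" using d by simp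
  qed
qed

end

text \<open>\<open>v_refl\<close> is the cocycle identity for \<open>s \<otimes> s = \<one>\<close>.
  \<open>v_pair\<close> makes \<open>v\<close> a coboundary on \<open>s\<close> and
  \<open>t\<close>, hence compatible with every relation between them. It is required only for pairs
  with a common negative chamber \<open>w\<close>, since only then can reduced words of one element
  start with \<open>s\<close> and with \<open>t\<close>.\<close>

locale half_space_module = half_space_system +
  fixes act :: "'a \<Rightarrow> 'm::real_vector \<Rightarrow> 'm" and v :: "'a \<Rightarrow> 'm"
  assumes act_add: "g \<in> generate G S \<Longrightarrow> act g (x + y) = act g x + act g y"
    and act_mult: "g \<in> generate G S \<Longrightarrow> h \<in> generate G S \<Longrightarrow> act (g \<otimes> h) x = act g (act h x)"
    and act_one: "act \<one> x = x"
    and v_refl: "s \<in> S \<Longrightarrow> v s + act s (v s) = 0"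
    and v_pair: "\<lbrakk>s \<in> S; t \<in> S; s \<noteq> t; w \<in> generate G S; D s w; D t w\<rbrakk>
      \<Longrightarrow> \<exists>f. v s = f - act s f \<and> v t = f - act t f"
begin

lemma act_diff: "g \<in> generate G S \<Longrightarrow> act g (x - y) = act g x - act g y"
  using act_add[of g "x - y" y] by (simp add: eq_diff_eq)

lemma act_zero: "g \<in> generate G S \<Longrightarrow> act g 0 = 0"
  using act_diff[of g 0 0] by simp

lemma act_S: "s \<in> S \<Longrightarrow> act s (act s x) = x"
  using act_mult[of s s x] S_gen S_square act_one by simp

text \<open>The value that the cocycle identity forces on the product of a word; a priori it depends
  on the word.\<close>

fun cw :: "'a list \<Rightarrow> 'm" where
  "cw [] = 0"
| "cw (s # u) = v s + act s (cw u)"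

text \<open>
  Two reduced words of \<open>w\<close> starting with \<open>s \<noteq> t\<close> are compared through the shortest element of
  the coset of \<open>w\<close> modulo the subgroup generated by \<open>s\<close> and \<open>t\<close>, on which the cocycle is a
  coboundary.
\<close>

lemma cw_reduced_eq:
  "\<lbrakk>a \<in> lists S; b \<in> lists S; wd a = wd b; length a = len (wd a); length b = len (wd a)\<rbrakk>
    \<Longrightarrow> cw a = cw b"
proof (induction "length a" arbitrary: a b rule: less_induct)
  case less
  show ?case
  proof (cases a)
    case Nil then show ?thesis using less by simp
  next
    case (Cons s u)
    then obtain t u' where b: "b = t # u'" using less by (metis length_0_conv neq_Nil_conv)
    define w where "w = wd a"
    have st: "s \<in> S" "t \<in> S" "u \<in> lists S" "u' \<in> lists S" using less.prems Cons b by auto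
    have w: "w \<in> generate G S" using less.prems wd_gen w_def by auto
    have uw: "wd u = s \<otimes> w" "wd u' = t \<otimes> w"
    proof -
      have "w = s \<otimes> wd u" "w = t \<otimes> wd u'" using less.prems Cons b unfolding w_def by auto
      then show "wd u = s \<otimes> w" "wd u' = t \<otimes> w"
        using S_cancel[OF st(1) wd_carrier[OF st(3)]] S_cancel[OF st(2) wd_carrier[OF st(4)]] by auto
    qed
    have la: "len w = Suc (length u)" "len w = Suc (length u')"
      using less.prems(4,5) Cons b w_def by simp_all
    have lt: "len (s \<otimes> w) < len w" "len (t \<otimes> w) < len w"
      using len_le[OF st(3)] len_le[OF st(4)] uw la by simp_all
    then have ds: "D s w" "D t w" using D_iff_len st w by auto
    have red: "length u = len (wd u)" "length u' = len (wd u')"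
      using len_descent[OF st(1) w ds(1)] len_descent[OF st(2) w ds(2)] uw la by simp_all
    have IH: "cw x = cw y" if "x \<in> lists S" "y \<in> lists S" "wd x = wd y" "length x = len (wd x)"
        "length y = len (wd y)" "length x < len w" for x y
      using less.hyps[of x y] that less.prems w_def by simp
    show ?thesis
    proof (cases "s = t")
      case True
      then have "cw u = cw u'" using IH[of u u'] st uw red lt by simp
      then show ?thesis using Cons b True by simp
    next
      case False
      obtain f where f: "v s = f - act s f" "v t = f - act t f" using v_pair[OF st(1,2) False w ds] by blast
      let ?T = "{s, t}"
      have TS: "?T \<subseteq> S" using st by auto
      have gT: "generate G ?T \<subseteq> generate G S" using TS mono_generate by blast
      obtain d w0 where d: "d \<in> generate G ?T" "w0 \<in> generate G S" "w = d \<otimes> w0"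
        "\<And>e. e \<in> generate G ?T \<Longrightarrow> len w0 \<le> len (e \<otimes> w0)" by (rule ex_shortest_in_coset[OF TS w]) blast
      obtain e0 where e0: "e0 \<in> lists S" "length e0 = len w0" "wd e0 = w0" using ex_reduced d by blast
      \<comment> \<open>For a letter \<open>r\<close> in \<open>?T\<close>,
        \<open>v r = f - act r f\<close> turns the recursion of \<open>cw\<close> into
        \<open>act r\<close> on values shifted by \<open>f\<close>. The shifted value at
        \<open>d' \<otimes> w0\<close> is therefore transported from \<open>w0\<close>, whichever
        letters are read.\<close>
      have down: "cw x - f = act d' (cw e0 - f)"
        if "d' \<in> generate G ?T" "x \<in> lists S" "wd x = d' \<otimes> w0" "length x = len (wd x)" "len (wd x) < len w"
        for x d'
        using that
      proof (induction "length x" arbitrary: x d' rule: less_induct)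
        case (less x d')
        show ?case
        proof (cases "\<exists>r\<in>?T. D r (wd x)")
          case True
          then obtain r where r: "r \<in> ?T" "D r (wd x)" by blast
          then have rS: "r \<in> S" and fr: "v r = f - act r f" using TS f by auto
          have wx: "wd x \<in> generate G S" using less wd_gen by blast
          obtain y where y: "y \<in> lists S" "length y = len (r \<otimes> wd x)" "wd y = r \<otimes> wd x"
            using ex_reduced[OF gen_mult[OF rS wx]] by blast
          have ly: "len (wd x) = Suc (len (wd y))" using len_descent[OF rS wx r(2)] y by simp
          have c: "r \<in> carrier G" "d' \<in> carrier G" "w0 \<in> carrier G"
            using rS S_carrier less gT d gen_carrier by auto
          have rd: "r \<otimes> d' \<in> generate G ?T" using r less by (auto intro: generate.eng generate.incl)
          have "cw y - f = act (r \<otimes> d') (cw e0 - f)"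
            using y ly less c rd by (intro less.hyps) (auto simp: m_assoc)
          then have *: "cw y - f = act r (act d' (cw e0 - f))"
            using act_mult S_gen[OF rS] less gT by auto
          have "cw x = cw (r # y)"
            using less y ly rS S_cancel wx gen_carrier by (intro IH) auto
          then have "cw x - f = act r (cw y - f)" using fr act_diff S_gen[OF rS] by simp
          then show ?thesis using * act_S rS by simp
        next
          case False
          then have "d' = \<one>" using shortest_in_coset[OF TS d(2) less(2) d(4)] less by auto
          then have "wd x = w0" using less d gen_carrier by simp
          then have "cw x = cw e0" using less e0 by (intro IH) auto
          then show ?thesis using \<open>d' = \<one>\<close> act_one by simp
        qed
      qed
      \<comment> \<open>The last letter is treated separately: the induction hypothesis compares
        words shorter than \<open>w\<close> only, so it cannot be used at \<open>w\<close>
        itself.\<close>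
      have top: "cw (r # y) - f = act d (cw e0 - f)"
        if "r \<in> ?T" "y \<in> lists S" "wd y = r \<otimes> w" "length y = len (wd y)" "len (r \<otimes> w) < len w" for r y
      proof -
        have rS: "r \<in> S" and fr: "v r = f - act r f" using TS f that by auto
        have c: "r \<in> carrier G" "d \<in> carrier G" "w0 \<in> carrier G"
          using rS S_carrier gT d gen_carrier by auto
        have rd: "r \<otimes> d \<in> generate G ?T" using that(1) d by (auto intro: generate.eng generate.incl)
        have "cw y - f = act (r \<otimes> d) (cw e0 - f)"
          using that rd c d(3) by (intro down) (auto simp: m_assoc)
        then have "cw y - f = act r (act d (cw e0 - f))"
          using act_mult S_gen[OF rS] d gT by auto
        moreover have "cw (r # y) - f = act r (cw y - f)" using fr act_diff S_gen[OF rS] by simp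
        ultimately show ?thesis using act_S rS by simp
      qed
      have "cw (s # u) - f = act d (cw e0 - f)" "cw (t # u') - f = act d (cw e0 - f)"
        using top[OF _ st(3) uw(1) red(1) lt(1)] top[OF _ st(4) uw(2) red(2) lt(2)] by simp_all
      then show ?thesis using Cons b by (metis diff_add_cancel)
    qed
  qed
qed

text \<open>The cocycle is \<open>cw\<close> of a chosen reduced word. For one generator the
  identity is immediate if the length goes up; if it goes down, the case of
  \<open>s \<otimes> w\<close> is transformed by \<open>act s\<close> and \<open>v_refl\<close>.
  Arbitrary words follow by induction.\<close>

theorem cocycle_exists:
  "\<exists>c. (\<forall>g\<in>generate G S. \<forall>h\<in>generate G S. c (g \<otimes> h) = c g + act g (c h)) \<and> (\<forall>s\<in>S. c s = v s)"
proof -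
  define c where "c w = cw (SOME u. u \<in> lists S \<and> length u = len w \<and> wd u = w)" for w
  have c: "c (wd u) = cw u" if "u \<in> lists S" "length u = len (wd u)" for u
  proof -
    let ?u = "SOME x. x \<in> lists S \<and> length x = len (wd u) \<and> wd x = wd u"
    have "?u \<in> lists S \<and> length ?u = len (wd u) \<and> wd ?u = wd u"
      by (rule someI[of _ u]) (use that in auto)
    then show ?thesis using that unfolding c_def by (intro cw_reduced_eq) auto
  qed
  have up: "c (s \<otimes> w) = v s + act s (c w)" if sw: "s \<in> S" "w \<in> generate G S" "\<not> D s w" for s w
  proof -
    obtain u where u: "u \<in> lists S" "length u = len w" "wd u = w" using ex_reduced[OF sw(2)] by blast
    then have "c (wd (s # u)) = cw (s # u)" using len_ascent sw by (intro c) auto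
    then show ?thesis using u c[of u] by simp
  qed
  have step: "c (s \<otimes> w) = v s + act s (c w)" if "s \<in> S" "w \<in> generate G S" for s w
  proof (cases "D s w")
    case True
    then have "c (s \<otimes> (s \<otimes> w)) = v s + act s (c (s \<otimes> w))"
      using that D_flip by (intro up gen_mult) auto
    then have "c w = v s + act s (c (s \<otimes> w))" using S_cancel that gen_carrier by simp
    then have "act s (c w) = act s (v s) + c (s \<otimes> w)"
      using act_add S_gen that act_S by simp
    then show ?thesis using v_refl[OF that(1)] by (metis add.assoc add.left_neutral)
  qed (use up that in auto)
  have one: "c \<one> = 0" using c[of "[]"] len_le[of "[]"] by simp
  have word: "c (wd u \<otimes> h) = cw u + act (wd u) (c h)" if "u \<in> lists S" "h \<in> generate G S" for u h
    using that(1)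
  proof (induction u)
    case Nil then show ?case using that act_one gen_carrier by simp
  next
    case (Cons s u)
    then have s: "s \<in> S" "s \<in> carrier G" "wd u \<in> carrier G" "h \<in> carrier G" "wd u \<in> generate G S"
      using S_carrier wd_carrier wd_gen that gen_carrier by auto
    have "c (wd (s # u) \<otimes> h) = c (s \<otimes> (wd u \<otimes> h))" using s by (simp add: m_assoc)
    also have "\<dots> = v s + act s (c (wd u \<otimes> h))" using s that by (intro step) (auto intro: generate.eng)
    finally show ?case using Cons s act_add act_mult S_gen by (simp add: add.assoc)
  qed
  show ?thesis
  proof (intro exI[of _ c] conjI ballI)
    fix g h assume gh: "g \<in> generate G S" "h \<in> generate G S"
    obtain u where u: "u \<in> lists S" "wd u = g" using ex_word[OF gh(1)] by auto
    have "c g = cw u" using word[OF u(1) generate.one] u one act_zero gh gen_carrier by simp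
    then show "c (g \<otimes> h) = c g + act g (c h)" using word[OF u(1) gh(2)] u by simp
  next
    fix s assume s: "s \<in> S"
    then show "c s = v s" using step[OF s generate.one] one act_zero S_gen S_carrier by auto
  qed
qed

end

section \<open>A common linear model\<close>

text \<open>
  \<open>kap\<close> is minus the curvature: \<open>hat\<close> maps onto the sheet \<open>t\<^sup>2 = 1 + kap X * (z \<bullet> z)\<close>, \<open>t > 0\<close>, of the
  points \<open>(z, t)\<close>, which is the hyperboloid or the affine hyperplane \<open>t = 1\<close>.
\<close>

primrec kap :: "geometry \<Rightarrow> real" where
  "kap Euclidean = 0"
| "kap Hyperbolic = 1"

definition om :: "geometry \<Rightarrow> 'a::euclidean_space \<Rightarrow> real" where
  "om X x = 1 / sqrt (1 - kap X * (x \<bullet> x))"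

definition hat :: "geometry \<Rightarrow> 'a::euclidean_space \<Rightarrow> 'a \<times> real" where
  "hat X x = om X x *\<^sub>R (x, 1)"

text \<open>\<open>\<alpha> \<bullet> sharp X \<beta>\<close> is a symmetric bilinear form on
  functionals: the Lorentzian form in the hyperbolic case, and in the Euclidean case the degenerate
  form that sees linear parts only.\<close>

definition sharp :: "geometry \<Rightarrow> 'a::euclidean_space \<times> real \<Rightarrow> 'a \<times> real" where
  "sharp X \<alpha> = (fst \<alpha>, - (kap X * snd \<alpha>))"

lemma points_iff: "x \<in> points X \<longleftrightarrow> kap X * (x \<bullet> x) < 1"
proof (cases X)
  case Hyperbolic
  have "norm x < 1 \<longleftrightarrow> x \<bullet> x < 1"
    by (simp add: norm_eq_sqrt_inner)
  then show ?thesis using Hyperbolic by simp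
qed simp

lemma open_points: "open (points X)" by (cases X) auto
lemma convex_points: "convex (points X)" by (cases X) auto

lemma om_pos: "x \<in> points X \<Longrightarrow> 0 < om X x"
  by (simp add: om_def points_iff)

lemma om_square: "x \<in> points X \<Longrightarrow> (om X x)\<^sup>2 * (1 - kap X * (x \<bullet> x)) = 1"
  by (auto simp: om_def points_iff power_divide)

lemma inner_hat: "\<alpha> \<bullet> hat X x = om X x * (\<alpha> \<bullet> (x, 1))"
  unfolding hat_def by (rule inner_scaleR_right)

lemma inner_lift: "\<alpha> \<bullet> (x, 1::real) = fst \<alpha> \<bullet> x + snd \<alpha>"
  by (simp add: inner_prod_def)

lemma inner_hat_sign:
  assumes "x \<in> points X"
  shows "\<alpha> \<bullet> hat X x < 0 \<longleftrightarrow> \<alpha> \<bullet> (x, 1) < 0"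
    and "\<alpha> \<bullet> hat X x > 0 \<longleftrightarrow> \<alpha> \<bullet> (x, 1) > 0"
    and "\<alpha> \<bullet> hat X x = 0 \<longleftrightarrow> \<alpha> \<bullet> (x, 1) = 0"
    and "\<alpha> \<bullet> hat X x \<ge> 0 \<longleftrightarrow> \<alpha> \<bullet> (x, 1) \<ge> 0"
  using om_pos[OF assms] by (auto simp: inner_hat zero_less_mult_iff mult_less_0_iff zero_le_mult_iff)

lemma hat_inj:
  assumes "hat X x = hat X y" "x \<in> points X" "y \<in> points X"
  shows "x = y"
  using assms om_pos[of x X] om_pos[of y X] by (auto simp: hat_def)

lemma inner_sharp_commute: "\<alpha> \<bullet> sharp X \<beta> = \<beta> \<bullet> sharp X \<alpha>"
  by (simp add: sharp_def inner_prod_def inner_commute)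

lemma affine_zero:
  fixes \<alpha> :: "'a::euclidean_space \<times> real"
  assumes "open W" "x0 \<in> W" "\<And>x. x \<in> W \<Longrightarrow> \<alpha> \<bullet> (x, 1) = 0"
  shows "\<alpha> = 0"
proof -
  obtain e where e: "e > 0" "ball x0 e \<subseteq> W" using assms open_contains_ball by blast
  have a: "fst \<alpha> = 0"
  proof (rule ccontr)
    assume n: "fst \<alpha> \<noteq> 0"
    define x where "x = x0 + (e / (2 * norm (fst \<alpha>))) *\<^sub>R fst \<alpha>"
    have "dist x0 x < e" using n e by (simp add: x_def dist_norm)
    then have "\<alpha> \<bullet> (x, 1) = 0" using e assms by (auto simp: subset_eq)
    moreover have "\<alpha> \<bullet> (x0, 1) = 0" using assms by auto
    moreover have "\<alpha> \<bullet> (x, 1) = \<alpha> \<bullet> (x0, 1) + (e / (2 * norm (fst \<alpha>))) * (fst \<alpha> \<bullet> fst \<alpha>)"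
      by (simp only: inner_lift x_def inner_add_right inner_scaleR_right)
    ultimately have "(e / (2 * norm (fst \<alpha>))) * (fst \<alpha> \<bullet> fst \<alpha>) = 0" by linarith
    then show False using n e by simp
  qed
  then show ?thesis using assms(3)[OF assms(2)] by (simp add: inner_lift prod_eq_iff)
qed

lemma functional_eqI:
  fixes \<alpha> \<beta> :: "'a::euclidean_space \<times> real"
  assumes "\<And>x. x \<in> points X \<Longrightarrow> \<alpha> \<bullet> hat X x = \<beta> \<bullet> hat X x"
  shows "\<alpha> = \<beta>"
proof -
  have "(\<alpha> - \<beta>) \<bullet> (x, 1) = 0" if "x \<in> points X" for x
    using assms[OF that] inner_hat_sign(3)[OF that, of "\<alpha> - \<beta>"] by (simp add: inner_diff_left)
  moreover have "0 \<in> points X" by (simp add: points_iff)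
  ultimately have "\<alpha> - \<beta> = 0" by (intro affine_zero[OF open_points]) auto
  then show ?thesis by simp
qed

text \<open>The part of \<open>fst \<gamma>\<close> orthogonal to \<open>fst \<alpha>\<close> is a
  direction inside the hyperplane, and \<gamma> would change along it. Only an open piece
  \<open>W\<close> is used, so the lemma serves in the ball and near a single point too.\<close>

lemma functional_vanishing_on_hyperplane:
  fixes \<alpha> \<gamma> :: "'a::euclidean_space \<times> real"
  assumes "fst \<alpha> \<noteq> 0" "open W" "p \<in> W" "\<alpha> \<bullet> (p, 1) = 0"
    and van: "\<And>x. x \<in> W \<Longrightarrow> \<alpha> \<bullet> (x, 1) = 0 \<Longrightarrow> \<gamma> \<bullet> (x, 1) = 0"
  obtains l where "\<gamma> = l *\<^sub>R \<alpha>"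
proof -
  define l where "l = (fst \<gamma> \<bullet> fst \<alpha>) / (fst \<alpha> \<bullet> fst \<alpha>)"
  define d where "d = fst \<gamma> - l *\<^sub>R fst \<alpha>"
  have ad: "fst \<alpha> \<bullet> d = 0"
    using assms(1) by (simp add: d_def l_def inner_diff_right inner_commute)
  obtain e where e: "e > 0" "ball p e \<subseteq> W" using assms open_contains_ball by blast
  have gp: "\<gamma> \<bullet> (p, 1) = 0" using van assms by auto
  have d0: "d = 0"
  proof (rule ccontr)
    assume n: "d \<noteq> 0"
    define x where "x = p + (e / (2 * norm d)) *\<^sub>R d"
    have "dist p x < e" using n e by (simp add: x_def dist_norm)
    moreover have "\<alpha> \<bullet> (x, 1) = 0"
      using assms(4) ad by (simp add: inner_lift x_def inner_add_right)
    ultimately have "\<gamma> \<bullet> (x, 1) = 0" using e van by (auto simp: subset_eq)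
    moreover have "\<gamma> \<bullet> (x, 1) = \<gamma> \<bullet> (p, 1) + (e / (2 * norm d)) * (fst \<gamma> \<bullet> d)"
      by (simp only: inner_lift x_def inner_add_right inner_scaleR_right)
    ultimately have "(e / (2 * norm d)) * (fst \<gamma> \<bullet> d) = 0" using gp by linarith
    then have "fst \<gamma> \<bullet> d = 0" using n e by simp
    then have "d \<bullet> d = 0" using ad unfolding d_def by (simp add: inner_diff_left)
    then show False using n by simp
  qed
  then have "fst \<gamma> = l *\<^sub>R fst \<alpha>" by (simp add: d_def)
  moreover have "snd \<gamma> = l * snd \<alpha>"
    using gp assms(4) calculation by (simp add: inner_lift eq_neg_iff_add_eq_0[symmetric])
  ultimately show ?thesis using that by (auto simp: prod_eq_iff)
qed

text \<open>In Lorentzian terms, a hyperplane that meets the open ball has a spacelike normal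
  vector. This legitimates division by the norm of a root.\<close>

lemma root_norm_pos:
  fixes \<alpha> :: "'a::euclidean_space \<times> real"
  assumes "fst \<alpha> \<noteq> 0" "p \<in> points X" "\<alpha> \<bullet> (p, 1) = 0"
  shows "0 < \<alpha> \<bullet> sharp X \<alpha>"
proof (cases X)
  case Euclidean
  then show ?thesis using assms by (simp add: sharp_def inner_prod_def)
next
  case Hyperbolic
  then have p: "norm p < 1" using assms by simp
  have "\<bar>snd \<alpha>\<bar> = \<bar>fst \<alpha> \<bullet> p\<bar>" using assms(3) by (simp add: inner_lift)
  also have "\<dots> \<le> norm (fst \<alpha>) * norm p" by (rule Cauchy_Schwarz_ineq2)
  also have "\<dots> < norm (fst \<alpha>)" using p assms(1) by simp
  finally have "(snd \<alpha>)\<^sup>2 < (norm (fst \<alpha>))\<^sup>2" by (metis abs_norm_cancel abs_le_square_iff not_le)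
  then have "(snd \<alpha>)\<^sup>2 < fst \<alpha> \<bullet> fst \<alpha>" by (simp only: power2_norm_eq_inner)
  then show ?thesis using Hyperbolic
    by (simp add: sharp_def inner_prod_def power2_eq_square)
qed

lemma isometries_bij: "g \<in> isometries X \<Longrightarrow> bij_betw g (points X) (points X)"
  by (simp add: isometries_def Bij_def)

lemma isometries_points: "g \<in> isometries X \<Longrightarrow> x \<in> points X \<Longrightarrow> g x \<in> points X"
  using isometries_bij bij_betwE by blast

text \<open>An isometry preserves the Lorentzian product of the lifted points. Recovering the
  product from the distance needs \<open>cosh (arcosh x) = x\<close>, valid for
  \<open>x \<ge> 1\<close>; the reversed Cauchy-Schwarz inequality \<open>ge1\<close> supplies this
  bound.\<close>

lemma hyperbolic_isometry_cosh:
  fixes x y :: "'a::euclidean_space"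
  assumes "g \<in> isometries Hyperbolic" "norm x < 1" "norm y < 1"
  shows "om Hyperbolic (g x) * om Hyperbolic (g y) * (1 - g x \<bullet> g y)
    = om Hyperbolic x * om Hyperbolic y * (1 - x \<bullet> y)"
proof -
  have ge1: "(1 - u \<bullet> v) / (sqrt (1 - u \<bullet> u) * sqrt (1 - v \<bullet> v)) \<ge> 1"
    if "norm u < 1" "norm v < 1" for u v :: 'a
  proof -
    have u: "u \<bullet> u < 1" "v \<bullet> v < 1" using that by (simp_all add: norm_eq_sqrt_inner)
    have "u \<bullet> v \<le> norm u * norm v" by (rule norm_cauchy_schwarz)
    also have "\<dots> < 1 * 1" using that by (intro mult_strict_mono') auto
    finally have uv: "u \<bullet> v < 1" by simp
    have cs: "(u \<bullet> v) \<le> norm u * norm v" by (rule norm_cauchy_schwarz)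
    have "(1 - u \<bullet> u) * (1 - v \<bullet> v) = (1 - norm u ^ 2) * (1 - norm v ^ 2)"
      by (simp add: power2_norm_eq_inner)
    also have "\<dots> = (1 - norm u * norm v)\<^sup>2 - (norm u - norm v)\<^sup>2"
      by (simp add: power2_eq_square algebra_simps)
    also have "\<dots> \<le> (1 - norm u * norm v)\<^sup>2" by simp
    also have "\<dots> \<le> (1 - u \<bullet> v)\<^sup>2"
      using cs \<open>norm u * norm v < 1 * 1\<close> by (intro power_mono) auto
    finally have "sqrt ((1 - u \<bullet> u) * (1 - v \<bullet> v)) \<le> 1 - u \<bullet> v"
      using uv by (intro real_le_lsqrt) auto
    then show ?thesis using u by (simp add: real_sqrt_mult)
  qed
  have p: "x \<in> points Hyperbolic" "y \<in> points Hyperbolic" using assms by auto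
  then have gp: "norm (g x) < 1" "norm (g y) < 1" using isometries_points[OF assms(1)] by fastforce+
  have "gdist Hyperbolic (g x) (g y) = gdist Hyperbolic x y"
    using assms(1) p unfolding isometries_def by blast
  then have "cosh (gdist Hyperbolic (g x) (g y)) = cosh (gdist Hyperbolic x y)" by simp
  then show ?thesis
    using ge1[OF gp] ge1[OF assms(2,3)] by (simp add: cosh_arcosh_real om_def)
qed

text \<open>In the Euclidean case the product with a fixed vector is a difference of squared
  distances to two points, which \<open>g\<close> preserves. In the hyperbolic case the functional
  \<open>(- y, 1)\<close> is, up to scale, the Lorentzian product with the lift of \<open>y\<close>;
  it is pulled back to the one of the preimage of \<open>y\<close>, and such functionals
  span.\<close>

lemma isometry_functional:
  fixes \<alpha> :: "'a::euclidean_space \<times> real"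
  assumes g: "g \<in> isometries X"
  shows "\<exists>\<beta>. \<forall>x\<in>points X. \<beta> \<bullet> hat X x = \<alpha> \<bullet> hat X (g x)"
proof (cases X)
  case Euclidean
  have d: "dist (g x) (g y) = dist x y" for x y
    using g Euclidean by (auto simp: isometries_def)
  have bij: "bij g" using isometries_bij[OF g] Euclidean by simp
  obtain c z where gc: "g c = fst \<alpha>" "g z = 0" using bij by (metis bij_pointE)
  have h: "fst \<alpha> \<bullet> g x = (fst \<alpha> \<bullet> fst \<alpha> - (dist (g x) (g c))\<^sup>2 + (dist (g x) (g z))\<^sup>2) / 2" for x
    unfolding gc dist_norm power2_norm_eq_inner by (simp add: algebra_simps inner_commute)
  have "fst \<alpha> \<bullet> g x = (c - z) \<bullet> x + (fst \<alpha> \<bullet> fst \<alpha> - c \<bullet> c + z \<bullet> z) / 2" for x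
    using h[of x] unfolding d unfolding dist_norm power2_norm_eq_inner
    by (simp add: inner_diff_left inner_diff_right inner_commute field_simps)
  then show ?thesis using Euclidean
    by (intro exI[of _ "(c - z, (fst \<alpha> \<bullet> fst \<alpha> - c \<bullet> c + z \<bullet> z) / 2 + snd \<alpha>)"])
      (simp add: inner_hat om_def inner_lift)
next
  case Hyperbolic
  define P where "P \<alpha> \<longleftrightarrow> (\<exists>\<beta>. \<forall>x\<in>points X. \<beta> \<bullet> hat X x = \<alpha> \<bullet> hat X (g x))" for \<alpha> :: "'a \<times> real"
  have P_add: "P (\<alpha> + \<beta>)" if "P \<alpha>" "P \<beta>" for \<alpha> \<beta>
    using that unfolding P_def by (metis inner_add_left)
  have P_scale: "P (r *\<^sub>R \<alpha>)" if "P \<alpha>" for \<alpha> r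
    using that unfolding P_def by (metis inner_scaleR_left)
  have P_point: "P (- y, 1)" if y: "norm y < 1" for y
  proof -
    have "y \<in> g ` points X" using isometries_bij[OF g] y Hyperbolic by (simp add: bij_betw_def)
    then obtain z where z: "norm z < 1" "g z = y" using Hyperbolic by auto
    have "P (om X y *\<^sub>R (- y, 1))" unfolding P_def
    proof (intro exI ballI)
      fix x :: 'a assume "x \<in> points X"
      then show "(om X z *\<^sub>R (- z, 1)) \<bullet> hat X x = (om X y *\<^sub>R (- y, 1)) \<bullet> hat X (g x)"
        using hyperbolic_isometry_cosh[of g x z] g z Hyperbolic
        unfolding inner_hat inner_scaleR_left inner_lift
        by (simp add: inner_commute algebra_simps)
    qed
    then have "P ((1 / om X y) *\<^sub>R (om X y *\<^sub>R (- y, 1)))" by (rule P_scale)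
    then show ?thesis using om_pos[of y X] y Hyperbolic by simp
  qed
  have P1: "P (0, 1)" using P_point[of 0] by simp
  have Py: "P (y, 0)" if "norm y < 1" for y
  proof -
    have "P ((- (- y), 1) + (-1) *\<^sub>R (0, 1))" using P_point[of "- y"] that P1 by (intro P_add P_scale) auto
    then show ?thesis by simp
  qed
  have "P (y, 0)" for y :: 'a
  proof -
    have "norm ((1 / (norm y + 1)) *\<^sub>R y) < 1" by (simp add: divide_simps) (smt (verit) norm_ge_zero)
    then have "P ((norm y + 1) *\<^sub>R ((1 / (norm y + 1)) *\<^sub>R y, 0))" by (intro P_scale Py)
    moreover have "norm y + 1 \<noteq> 0" by (smt (verit) norm_ge_zero)
    ultimately show ?thesis by simp
  qed
  then have "P ((fst \<alpha>, 0) + snd \<alpha> *\<^sub>R (0, 1))" using P1 by (intro P_add P_scale)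
  then show ?thesis unfolding P_def by simp
qed

text \<open>Points of the mirror are fixed, hence equally related to \<open>x\<close> and
  \<open>s x\<close>; so the difference of the two lifts is a multiple of
  \<open>sharp X \<alpha>\<close>. That both lifts lie on the same sheet (in the Euclidean case, the
  constant term) gives a quadratic equation for the multiple, and \<open>s x \<noteq> x\<close>
  excludes the root zero.\<close>

lemma reflection_formula:
  fixes \<alpha> :: "'a::euclidean_space \<times> real"
  assumes s: "s \<in> isometries X" and a: "fst \<alpha> \<noteq> 0"
    and m: "mirror X s = {x \<in> points X. \<alpha> \<bullet> (x, 1) = 0}" and "mirror X s \<noteq> {}"
    and x: "x \<in> points X"
  shows "hat X (s x) = hat X x - (2 * (\<alpha> \<bullet> hat X x) / (\<alpha> \<bullet> sharp X \<alpha>)) *\<^sub>R sharp X \<alpha>"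
proof (cases "s x = x")
  case True
  then have "x \<in> mirror X s" using x by (simp add: mirror_def)
  then have "\<alpha> \<bullet> hat X x = 0" using m by (simp add: inner_hat)
  then show ?thesis using True by simp
next
  case False
  obtain p where p: "p \<in> points X" "\<alpha> \<bullet> (p, 1) = 0" using assms(3,4) by auto
  have Q: "0 < \<alpha> \<bullet> sharp X \<alpha>" by (rule root_norm_pos[OF a p])
  have sx: "s x \<in> points X" using isometries_points s x by blast
  have fix_m: "s y = y" if "y \<in> points X" "\<alpha> \<bullet> (y, 1) = 0" for y
    using that m by (auto simp: mirror_def)
  show ?thesis
  proof (cases X)
    case Euclidean
    define y where "y = s x"
    \<comment> \<open>The zero set of this functional is the perpendicular bisector of
      \<open>x\<close> and \<open>y\<close>.\<close>
    have "(2 *\<^sub>R (y - x), x \<bullet> x - y \<bullet> y) \<bullet> (q, 1) = 0" if "\<alpha> \<bullet> (q, 1) = 0" for q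
    proof -
      have "dist (s x) (s q) = dist x q" using s Euclidean by (auto simp: isometries_def)
      then have "(dist y q)\<^sup>2 = (dist x q)\<^sup>2" using fix_m[of q] that Euclidean y_def by simp
      then show ?thesis unfolding dist_norm power2_norm_eq_inner
        by (simp add: algebra_simps inner_commute)
    qed
    then obtain l where "(2 *\<^sub>R (y - x), x \<bullet> x - y \<bullet> y) = l *\<^sub>R \<alpha>"
      using functional_vanishing_on_hyperplane[OF a open_UNIV UNIV_I p(2)] by metis
    then have l: "2 *\<^sub>R (y - x) = l *\<^sub>R fst \<alpha>" "x \<bullet> x - y \<bullet> y = l * snd \<alpha>" by (auto simp: prod_eq_iff)
    have y: "y = x + (l / 2) *\<^sub>R fst \<alpha>"
    proof -
      have "(1/2) *\<^sub>R (2 *\<^sub>R (y - x)) = (1/2) *\<^sub>R (l *\<^sub>R fst \<alpha>)" using l by simp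
      then show ?thesis by (simp add: algebra_simps)
    qed
    have "l \<noteq> 0" using y False y_def by auto
    moreover have "- (l * (x \<bullet> fst \<alpha>)) - (l / 2)\<^sup>2 * (fst \<alpha> \<bullet> fst \<alpha>) = l * snd \<alpha>"
      using l(2) unfolding y by (simp add: algebra_simps inner_commute power2_eq_square)
    moreover then have "l * (- (x \<bullet> fst \<alpha>) - (l / 4) * (fst \<alpha> \<bullet> fst \<alpha>) - snd \<alpha>) = 0"
      by (simp add: power2_eq_square algebra_simps)
    ultimately have "- (x \<bullet> fst \<alpha>) - (l / 4) * (fst \<alpha> \<bullet> fst \<alpha>) = snd \<alpha>" by simp
    then have "l / 2 = - (2 * (\<alpha> \<bullet> (x, 1)) / (fst \<alpha> \<bullet> fst \<alpha>))"
      using a by (simp add: inner_lift inner_commute field_simps)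
    then have "y = x + (- (2 * (\<alpha> \<bullet> (x, 1)) / (fst \<alpha> \<bullet> fst \<alpha>))) *\<^sub>R fst \<alpha>"
      using y by (simp only:)
    then show ?thesis using Euclidean unfolding y_def
      by (simp add: hat_def om_def sharp_def inner_prod_def)
  next
    case Hyperbolic
    define y u v where "y = s x" and "u = om X x" and "v = om X y"
    have yp: "y \<in> points X" using sx y_def by simp
    have nx: "norm x < 1" "norm y < 1" using x yp Hyperbolic by auto
    have "(v *\<^sub>R y - u *\<^sub>R x, u - v) \<bullet> (q, 1) = 0" if "q \<in> points X" "\<alpha> \<bullet> (q, 1) = 0" for q
    proof -
      have q: "norm q < 1" "0 < om X q" using that Hyperbolic om_pos[OF that(1)] by auto
      have "v * om X q * (1 - y \<bullet> q) = u * om X q * (1 - x \<bullet> q)"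
        using hyperbolic_isometry_cosh[of s x q] s nx q fix_m[OF that] Hyperbolic y_def u_def v_def by simp
      then have "v * (1 - y \<bullet> q) = u * (1 - x \<bullet> q)" using q by simp
      then show ?thesis by (simp add: algebra_simps)
    qed
    then obtain l where "(v *\<^sub>R y - u *\<^sub>R x, u - v) = l *\<^sub>R \<alpha>"
      using functional_vanishing_on_hyperplane[OF a open_points p] by metis
    then have l: "v *\<^sub>R y = u *\<^sub>R x + l *\<^sub>R fst \<alpha>" "v = u - l * snd \<alpha>" by (auto simp: prod_eq_iff algebra_simps)
    have up: "u > 0" "v > 0" using om_pos x yp u_def v_def by auto
    have l0: "l \<noteq> 0"
    proof
      assume "l = 0"
      then have "u *\<^sub>R y = u *\<^sub>R x" using l by simp
      then show False using up False y_def by simp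
    qed
    have "u\<^sup>2 - (u *\<^sub>R x) \<bullet> (u *\<^sub>R x) = 1" "v\<^sup>2 - (v *\<^sub>R y) \<bullet> (v *\<^sub>R y) = 1"
      using om_square[OF x] om_square[OF yp] Hyperbolic unfolding u_def v_def
      by (simp_all add: algebra_simps power2_eq_square)
    then have "(u - l * snd \<alpha>)\<^sup>2 - (u *\<^sub>R x + l *\<^sub>R fst \<alpha>) \<bullet> (u *\<^sub>R x + l *\<^sub>R fst \<alpha>)
        = u\<^sup>2 - (u *\<^sub>R x) \<bullet> (u *\<^sub>R x)"
      unfolding l(1) by (simp only: l(2))
    then have "- 2 * l * u * snd \<alpha> + l\<^sup>2 * (snd \<alpha>)\<^sup>2 - 2 * l * u * (fst \<alpha> \<bullet> x) - l\<^sup>2 * (fst \<alpha> \<bullet> fst \<alpha>) = 0"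
      by (simp add: algebra_simps power2_eq_square inner_commute)
    then have "l * (l * (fst \<alpha> \<bullet> fst \<alpha> - (snd \<alpha>)\<^sup>2) + 2 * u * (\<alpha> \<bullet> (x, 1))) = 0"
      by (simp add: inner_lift algebra_simps power2_eq_square)
    then have "l * (fst \<alpha> \<bullet> fst \<alpha> - (snd \<alpha>)\<^sup>2) + 2 * u * (\<alpha> \<bullet> (x, 1)) = 0" using l0 by simp
    then have "l * (\<alpha> \<bullet> sharp X \<alpha>) = - 2 * (\<alpha> \<bullet> hat X x)"
      using Hyperbolic unfolding inner_hat u_def[symmetric]
      by (simp add: sharp_def inner_prod_def power2_eq_square algebra_simps)
    then have lq: "l = - (2 * (\<alpha> \<bullet> hat X x) / (\<alpha> \<bullet> sharp X \<alpha>))"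
      using Q by (simp add: field_simps)
    have "hat X y = hat X x + l *\<^sub>R sharp X \<alpha>"
      using l Hyperbolic unfolding hat_def u_def[symmetric] v_def[symmetric]
      by (simp add: sharp_def prod_eq_iff)
    then show ?thesis using lq y_def by simp
  qed
qed

section \<open>Reflections and mirrors\<close>

abbreviation BG :: "geometry \<Rightarrow> ('a::euclidean_space \<Rightarrow> 'a) monoid" where
  "BG X \<equiv> BijGroup (points X)"

abbreviation ev :: "'a::euclidean_space \<times> real \<Rightarrow> 'a \<Rightarrow> real" where
  "ev \<alpha> x \<equiv> \<alpha> \<bullet> (x, 1)"

lemma group_BG: "group (BG X)" by (rule group_BijGroup)

lemma BG_carrier: "f \<in> carrier (BG X) \<longleftrightarrow> f \<in> extensional (points X) \<and> bij_betw f (points X) (points X)"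
  by (simp add: BijGroup_def Bij_def)

lemma BG_points: "f \<in> carrier (BG X) \<Longrightarrow> x \<in> points X \<Longrightarrow> f x \<in> points X"
  using BG_carrier bij_betwE by blast

lemma BG_mult: "f \<in> carrier (BG X) \<Longrightarrow> g \<in> carrier (BG X) \<Longrightarrow> x \<in> points X
    \<Longrightarrow> (f \<otimes>\<^bsub>BG X\<^esub> g) x = f (g x)"
  by (simp add: BijGroup_def compose_def)

lemma BG_one: "x \<in> points X \<Longrightarrow> \<one>\<^bsub>BG X\<^esub> x = x"
  by (simp add: BijGroup_def)

lemma BG_inv:
  fixes f :: "'a::euclidean_space \<Rightarrow> 'a"
  assumes "f \<in> carrier (BG X)" "x \<in> points X"
  shows "(inv\<^bsub>BG X\<^esub> f) (f x) = x" and "f ((inv\<^bsub>BG X\<^esub> f) x) = x"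
proof -
  interpret group "BG X :: ('a \<Rightarrow> 'a) monoid" by (rule group_BG)
  have i: "inv\<^bsub>BG X\<^esub> f \<in> carrier (BG X)" using assms by simp
  show "(inv\<^bsub>BG X\<^esub> f) (f x) = x"
  proof -
    have "(inv\<^bsub>BG X\<^esub> f \<otimes>\<^bsub>BG X\<^esub> f) x = x" using assms by (simp only: l_inv BG_one)
    then show ?thesis by (simp only: BG_mult[OF i assms])
  qed
  show "f ((inv\<^bsub>BG X\<^esub> f) x) = x"
  proof -
    have "(f \<otimes>\<^bsub>BG X\<^esub> inv\<^bsub>BG X\<^esub> f) x = x" using assms by (simp only: r_inv BG_one)
    then show ?thesis by (simp only: BG_mult[OF assms(1) i assms(2)])
  qed
qed

lemma BG_eqI:
  assumes "f \<in> carrier (BG X)" "g \<in> carrier (BG X)" "\<And>x. x \<in> points X \<Longrightarrow> f x = g x"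
  shows "f = g"
  using assms by (auto simp: BG_carrier intro: extensionalityI)

lemma isometries_carrier: "isometries X \<subseteq> carrier (BG X)"
  by (auto simp: isometries_def BijGroup_def)

lemma isometries_iff: "f \<in> isometries X \<longleftrightarrow> f \<in> carrier (BG X) \<and>
    (\<forall>x\<in>points X. \<forall>y\<in>points X. gdist X (f x) (f y) = gdist X x y)"
  by (auto simp: isometries_def BijGroup_def)

lemma subgroup_isometries: "subgroup (isometries X) (BG X :: ('a::euclidean_space \<Rightarrow> 'a) monoid)"
proof -
  interpret group "BG X :: ('a \<Rightarrow> 'a) monoid" by (rule group_BG)
  show ?thesis
  proof (rule subgroupI)
    have "(\<one>\<^bsub>BG X\<^esub> :: 'a \<Rightarrow> 'a) \<in> isometries X" by (simp add: isometries_iff BG_one)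
    then show "(isometries X :: ('a \<Rightarrow> 'a) set) \<noteq> {}" by blast
    fix a :: "'a \<Rightarrow> 'a" assume a: "a \<in> isometries X"
    have i: "inv\<^bsub>BG X\<^esub> a \<in> carrier (BG X)" using a isometries_carrier by blast
    have "gdist X ((inv\<^bsub>BG X\<^esub> a) x) ((inv\<^bsub>BG X\<^esub> a) y) = gdist X x y"
      if "x \<in> points X" "y \<in> points X" for x y
    proof -
      have "gdist X (a ((inv\<^bsub>BG X\<^esub> a) x)) (a ((inv\<^bsub>BG X\<^esub> a) y)) = gdist X ((inv\<^bsub>BG X\<^esub> a) x) ((inv\<^bsub>BG X\<^esub> a) y)"
        using a that BG_points[OF i] unfolding isometries_iff by blast
      then show ?thesis using BG_inv(2)[of a X] a that unfolding isometries_iff by simp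
    qed
    then show "inv\<^bsub>BG X\<^esub> a \<in> isometries X" using i isometries_iff by blast
  next
    fix a b :: "'a \<Rightarrow> 'a" assume "a \<in> isometries X" "b \<in> isometries X"
    then show "a \<otimes>\<^bsub>BG X\<^esub> b \<in> isometries X"
      by (simp add: isometries_iff BG_mult BG_points)
  qed (use isometries_carrier in blast)
qed

lemma reflections_isometries: "reflections X \<subseteq> isometries X"
  by (auto simp: reflections_def)

lemma reflections_carrier: "reflections X \<subseteq> carrier (BG X)"
  using reflections_isometries isometries_carrier by blast

lemma reflection_root:
  fixes s :: "'a::euclidean_space \<Rightarrow> 'a"
  assumes "s \<in> reflections X"
  obtains \<alpha> where "fst \<alpha> \<noteq> 0" "mirror X s = {x \<in> points X. ev \<alpha> x = 0}" "mirror X s \<noteq> {}"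
proof -
  obtain a b where "mirror X s = points X \<inter> {x. a \<bullet> x = b}" "a \<noteq> 0" "mirror X s \<noteq> {}"
    using assms by (auto simp: reflections_def hyperplanes_def)
  then show ?thesis using that[of "(a, - b)"] by (auto simp: inner_lift)
qed

lemma root_reflection:
  fixes s :: "'a::euclidean_space \<Rightarrow> 'a"
  assumes "s \<in> isometries X" "fst \<alpha> \<noteq> 0" "mirror X s = {x \<in> points X. ev \<alpha> x = 0}" "mirror X s \<noteq> {}"
  shows "s \<in> reflections X"
proof -
  have m: "mirror X s = points X \<inter> {x. fst \<alpha> \<bullet> x = - snd \<alpha>}"
    unfolding assms(3) by (auto simp: inner_lift eq_neg_iff_add_eq_0)
  have "mirror X s \<in> hyperplanes X" unfolding hyperplanes_def
    by (rule CollectI, intro exI[of _ "fst \<alpha>"] exI[of _ "- snd \<alpha>"]) (use assms(2,4) m in metis)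
  then show ?thesis using assms(1) unfolding reflections_def by blast
qed

lemma reflection_eqI:
  fixes s t :: "'a::euclidean_space \<Rightarrow> 'a"
  assumes "s \<in> reflections X" "t \<in> reflections X" "mirror X s = mirror X t"
  shows "s = t"
proof (rule BG_eqI)
  obtain \<alpha> where a: "fst \<alpha> \<noteq> 0" "mirror X s = {x \<in> points X. ev \<alpha> x = 0}" "mirror X s \<noteq> {}"
    using reflection_root[OF assms(1)] .
  have i: "s \<in> isometries X" "t \<in> isometries X" using assms reflections_isometries by auto
  show "s \<in> carrier (BG X)" "t \<in> carrier (BG X)" using i isometries_carrier by auto
  fix x :: 'a assume x: "x \<in> points X"
  have "hat X (s x) = hat X (t x)"
    using reflection_formula[OF i(1) a x] reflection_formula[OF i(2) a(1) _ _ x] a assms(3) by simp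
  then show "s x = t x" using hat_inj isometries_points i x by blast
qed

lemma functional_reflection:
  fixes s :: "'a::euclidean_space \<Rightarrow> 'a"
  assumes "s \<in> isometries X" "fst \<alpha> \<noteq> 0" "mirror X s = {x \<in> points X. ev \<alpha> x = 0}" "mirror X s \<noteq> {}"
    and x: "x \<in> points X"
  shows "\<beta> \<bullet> hat X (s x) = (\<beta> - (2 * (\<beta> \<bullet> sharp X \<alpha>) / (\<alpha> \<bullet> sharp X \<alpha>)) *\<^sub>R \<alpha>) \<bullet> hat X x"
  unfolding reflection_formula[OF assms]
  by (simp add: inner_diff_left inner_diff_right)

lemma root_reflected:
  fixes s :: "'a::euclidean_space \<Rightarrow> 'a"
  assumes "s \<in> isometries X" "fst \<alpha> \<noteq> 0" "mirror X s = {x \<in> points X. ev \<alpha> x = 0}" "mirror X s \<noteq> {}"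
    and x: "x \<in> points X"
  shows "\<alpha> \<bullet> hat X (s x) = - (\<alpha> \<bullet> hat X x)"
proof -
  obtain p where "p \<in> points X" "ev \<alpha> p = 0" using assms by auto
  then have "\<alpha> \<bullet> sharp X \<alpha> > 0" using root_norm_pos assms by blast
  then show ?thesis using functional_reflection[OF assms, of \<alpha>] by (simp add: inner_diff_left)
qed

lemma reflection_square:
  fixes s :: "'a::euclidean_space \<Rightarrow> 'a"
  assumes "s \<in> reflections X"
  shows "s \<otimes>\<^bsub>BG X\<^esub> s = \<one>\<^bsub>BG X\<^esub>"
proof (rule BG_eqI)
  interpret group "BG X :: ('a \<Rightarrow> 'a) monoid" by (rule group_BG)
  obtain \<alpha> where a: "fst \<alpha> \<noteq> 0" "mirror X s = {x \<in> points X. ev \<alpha> x = 0}" "mirror X s \<noteq> {}"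
    using reflection_root[OF assms(1)] .
  have i: "s \<in> isometries X" using assms reflections_isometries by auto
  then have c: "s \<in> carrier (BG X)" using isometries_carrier by auto
  then show "s \<otimes>\<^bsub>BG X\<^esub> s \<in> carrier (BG X)"
    "(\<one>\<^bsub>BG X\<^esub> :: 'a \<Rightarrow> 'a) \<in> carrier (BG X)" by auto
  fix x :: 'a assume x: "x \<in> points X"
  note sx = isometries_points[OF i x]
  have "hat X (s (s x)) = hat X x"
    unfolding reflection_formula[OF i a sx] unfolding root_reflected[OF i a x]
    unfolding reflection_formula[OF i a x] by simp
  then have "s (s x) = x" using hat_inj isometries_points i x by blast
  then show "(s \<otimes>\<^bsub>BG X\<^esub> s) x = \<one>\<^bsub>BG X\<^esub> x" using c x by (simp add: BG_mult BG_one)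
qed

lemma reflection_conjugate:
  fixes g t :: "'a::euclidean_space \<Rightarrow> 'a"
  assumes g: "g \<in> isometries X" and t: "t \<in> reflections X"
  defines "r \<equiv> inv\<^bsub>BG X\<^esub> g \<otimes>\<^bsub>BG X\<^esub> t \<otimes>\<^bsub>BG X\<^esub> g"
  shows "r \<in> reflections X" and "mirror X r = {x \<in> points X. g x \<in> mirror X t}"
proof -
  interpret group "BG X :: ('a \<Rightarrow> 'a) monoid" by (rule group_BG)
  have c: "g \<in> carrier (BG X)" "t \<in> carrier (BG X)" using g t isometries_carrier reflections_carrier by auto
  have ti: "t \<in> isometries X" using t reflections_isometries by blast
  have r: "r x = (inv\<^bsub>BG X\<^esub> g) (t (g x))" if "x \<in> points X" for x
    using that c unfolding r_def by (simp add: BG_mult BG_points)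
  have ri: "r \<in> isometries X" unfolding r_def using subgroup_isometries g ti
    by (intro subgroup.m_closed[OF subgroup_isometries] subgroup.m_inv_closed[OF subgroup_isometries])
  show m: "mirror X r = {x \<in> points X. g x \<in> mirror X t}"
  proof -
    have "r x = x \<longleftrightarrow> t (g x) = g x" if "x \<in> points X" for x
      using that r BG_inv[OF c(1)] BG_points c by metis
    then show ?thesis using BG_points[OF c(1)] by (auto simp: mirror_def)
  qed
  obtain \<alpha> where a: "fst \<alpha> \<noteq> 0" "mirror X t = {x \<in> points X. ev \<alpha> x = 0}" "mirror X t \<noteq> {}"
    using reflection_root[OF t] .
  obtain \<beta> where b: "\<And>x. x \<in> points X \<Longrightarrow> \<beta> \<bullet> hat X x = \<alpha> \<bullet> hat X (g x)"
    using isometry_functional[OF g] by blast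
  have m2: "mirror X r = {x \<in> points X. ev \<beta> x = 0}"
  proof -
    have "ev \<beta> x = 0 \<longleftrightarrow> ev \<alpha> (g x) = 0" if "x \<in> points X" for x
      using inner_hat_sign(3)[OF that, of \<beta>] inner_hat_sign(3)[OF BG_points[OF c(1) that], of \<alpha>] b[OF that]
      by simp
    then show ?thesis unfolding m a using BG_points[OF c(1)] by auto
  qed
  obtain q where q: "q \<in> mirror X t" using a by blast
  then have "q \<in> points X" by (simp add: mirror_def)
  then have z: "(inv\<^bsub>BG X\<^esub> g) q \<in> mirror X r"
    using q c unfolding m by (simp add: BG_inv BG_points)
  then have ne: "mirror X r \<noteq> {}" by blast
  \<comment> \<open>A functional without linear part that vanishes at a point of the mirror is zero;
    its pullback along the inverse of \<open>g\<close>, which is \<alpha>, would then be zero as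
    well.\<close>
  have "fst \<beta> \<noteq> 0"
  proof
    assume f0: "fst \<beta> = 0"
    then have "snd \<beta> = 0" using z unfolding m2 by (simp add: inner_lift)
    then have "\<beta> = 0" using f0 by (simp add: prod_eq_iff)
    then have z: "\<alpha> \<bullet> hat X (g x) = 0" if "x \<in> points X" for x using b[OF that] by simp
    have "\<alpha> \<bullet> hat X y = 0 \<bullet> hat X y" if "y \<in> points X" for y :: 'a
      using z[of "(inv\<^bsub>BG X\<^esub> g) y"] that c by (simp add: BG_inv BG_points)
    then have "\<alpha> = 0" by (rule functional_eqI)
    then show False using a by simp
  qed
  then show "r \<in> reflections X" using root_reflection ri m2 ne by blast
qed

lemma ev_convex: "ev \<alpha> ((1 - t) *\<^sub>R x + t *\<^sub>R y) = (1 - t) * ev \<alpha> x + t * ev \<alpha> y"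
  by (simp add: inner_lift inner_add_right algebra_simps)

text \<open>A segment between two points of \<open>K\<close> meets the zero set of each functional
  in at most one point, unless the functional vanishes at both ends; the interval
  \<open>{0..1}\<close> is not exhausted by finitely many parameters.\<close>

lemma generic_point:
  fixes K :: "'a::euclidean_space set"
  assumes "finite A" "convex K" "K \<noteq> {}" "\<And>\<gamma>. \<gamma> \<in> A \<Longrightarrow> \<exists>x\<in>K. ev \<gamma> x \<noteq> 0"
  shows "\<exists>p\<in>K. \<forall>\<gamma>\<in>A. ev \<gamma> p \<noteq> 0"
  using assms(1,4)
proof (induction A)
  case empty then show ?case using assms(3) by blast
next
  case (insert \<gamma> A)
  obtain p where p: "p \<in> K" "\<forall>\<delta>\<in>A. ev \<delta> p \<noteq> 0" using insert.IH insert.prems by blast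
  obtain q where q: "q \<in> K" "ev \<gamma> q \<noteq> 0" using insert.prems[of \<gamma>] by blast
  note pq = p q
  define f where "f t = (1 - t) *\<^sub>R p + t *\<^sub>R q" for t :: real
  define Z where "Z = (\<Union>\<delta>\<in>insert \<gamma> A. {t. ev \<delta> (f t) = 0})"
  have "finite {t. ev \<delta> (f t) = 0}" if "\<delta> \<in> insert \<gamma> A" for \<delta>
  proof -
    have n: "ev \<delta> p \<noteq> 0 \<or> ev \<delta> q \<noteq> 0" using that pq by auto
    have "t = ev \<delta> p / (ev \<delta> p - ev \<delta> q)" if "ev \<delta> (f t) = 0" for t
    proof -
      have e: "ev \<delta> p = t * (ev \<delta> p - ev \<delta> q)"
        using that unfolding f_def ev_convex by (simp add: algebra_simps)
      then have "ev \<delta> p - ev \<delta> q \<noteq> 0" using n by auto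
      then show ?thesis using e by (simp add: field_simps)
    qed
    then have "{t. ev \<delta> (f t) = 0} \<subseteq> {ev \<delta> p / (ev \<delta> p - ev \<delta> q)}" by blast
    then show ?thesis using finite_subset by blast
  qed
  then have "finite Z" unfolding Z_def using insert by auto
  moreover have "infinite {0..1::real}" by simp
  ultimately have "\<not> {0..1} \<subseteq> Z" using finite_subset by blast
  then obtain t where t: "t \<in> {0..1}" "t \<notin> Z" by blast
  have "f t \<in> K" unfolding f_def using t pq assms(2) by (intro convexD_alt) auto
  then show ?case using t unfolding Z_def by blast
qed

text \<open>The base point \<open>x0\<close> selects a chamber and orients all roots. The locale is
  used for \<open>G\<close> and for \<open>H\<close>, and local finiteness passes from one to the
  other by inclusion of their mirrors.\<close>

locale mirror_system =
  fixes X :: geometry and \<Gamma> :: "('a::euclidean_space \<Rightarrow> 'a) set" and x0 :: 'a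
  assumes \<Gamma>_subgroup: "subgroup \<Gamma> (BG X)"
    and \<Gamma>_isometries: "\<Gamma> \<subseteq> isometries X"
    and locally_finite: "compact (K :: 'a set) \<Longrightarrow> K \<subseteq> points X
      \<Longrightarrow> finite {s \<in> \<Gamma> \<inter> reflections X. mirror X s \<inter> K \<noteq> {}}"
    and x0: "x0 \<in> points X" "\<And>s. s \<in> \<Gamma> \<inter> reflections X \<Longrightarrow> x0 \<notin> mirror X s"
begin

sublocale BG: group "BG X :: ('a \<Rightarrow> 'a) monoid" by (rule group_BG)

abbreviation mul (infixl \<open>\<cdot>\<close> 70) where "g \<cdot> h \<equiv> g \<otimes>\<^bsub>BG X\<^esub> h"
abbreviation iv where "iv g \<equiv> inv\<^bsub>BG X\<^esub> g"

definition R where "R = \<Gamma> \<inter> reflections X"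

definition rt where
  "rt s = (SOME \<alpha>. fst \<alpha> \<noteq> 0 \<and> mirror X s = {x \<in> points X. ev \<alpha> x = 0} \<and> 0 < ev \<alpha> x0)"

definition U where "U = {x \<in> points X. \<forall>s\<in>R. 0 < ev (rt s) x}"

definition chamber where "chamber = {x \<in> points X. \<forall>s\<in>R. 0 \<le> ev (rt s) x}"

text \<open>A wall is recognised by a point of the chamber that lies on its mirror and on no other.
  This makes \<open>wall_cross\<close> direct; the agreement with facets is established
  afterwards.\<close>

definition walls where
  "walls = {s \<in> R. \<exists>p\<in>points X. ev (rt s) p = 0 \<and> (\<forall>t\<in>R. t \<noteq> s \<longrightarrow> 0 < ev (rt t) p)}"

lemma \<Gamma>_carrier: "g \<in> \<Gamma> \<Longrightarrow> g \<in> carrier (BG X)"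
  using \<Gamma>_isometries isometries_carrier by blast

lemma \<Gamma>_points: "g \<in> \<Gamma> \<Longrightarrow> x \<in> points X \<Longrightarrow> g x \<in> points X"
  using \<Gamma>_carrier BG_points by blast

lemma R_\<Gamma>: "s \<in> R \<Longrightarrow> s \<in> \<Gamma>" by (simp add: R_def)
lemma R_refl: "s \<in> R \<Longrightarrow> s \<in> reflections X" by (simp add: R_def)
lemma R_carrier: "s \<in> R \<Longrightarrow> s \<in> carrier (BG X)" using R_\<Gamma> \<Gamma>_carrier by blast
lemma walls_R: "s \<in> walls \<Longrightarrow> s \<in> R" by (simp add: walls_def)

lemma rt:
  assumes "s \<in> R"
  shows "fst (rt s) \<noteq> 0" "mirror X s = {x \<in> points X. ev (rt s) x = 0}" "0 < ev (rt s) x0"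
    "mirror X s \<noteq> {}"
proof -
  obtain \<alpha> where a: "fst \<alpha> \<noteq> 0" "mirror X s = {x \<in> points X. ev \<alpha> x = 0}" "mirror X s \<noteq> {}"
    using reflection_root R_refl[OF assms] by blast
  then show "mirror X s \<noteq> {}" by blast
  have "ev \<alpha> x0 \<noteq> 0" using x0 a assms unfolding R_def by blast
  then have "\<exists>\<alpha>. fst \<alpha> \<noteq> 0 \<and> mirror X s = {x \<in> points X. ev \<alpha> x = 0} \<and> 0 < ev \<alpha> x0"
  proof (cases "0 < ev \<alpha> x0")
    case True
    then show ?thesis using a by (intro exI[of _ \<alpha>]) simp
  next
    case False
    then show ?thesis using a \<open>ev \<alpha> x0 \<noteq> 0\<close> by (intro exI[of _ "- \<alpha>"]) simp
  qed
  from someI_ex[OF this] show "fst (rt s) \<noteq> 0" "mirror X s = {x \<in> points X. ev (rt s) x = 0}" "0 < ev (rt s) x0"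
    unfolding rt_def by blast+
qed

lemma x0_U: "x0 \<in> U" using x0(1) rt(3) by (simp add: U_def)

lemma root_inj:
  assumes "s \<in> R" "t \<in> R" "rt s = l *\<^sub>R rt t" shows "s = t"
proof -
  have "l \<noteq> 0" using rt(1)[OF assms(1)] assms(3) by auto
  then have "ev (rt s) x = 0 \<longleftrightarrow> ev (rt t) x = 0" for x by (simp add: assms(3))
  then have "mirror X s = mirror X t" unfolding rt(2)[OF assms(1)] rt(2)[OF assms(2)] by simp
  then show ?thesis using reflection_eqI R_refl assms by blast
qed

lemma root_norm: "s \<in> R \<Longrightarrow> 0 < rt s \<bullet> sharp X (rt s)"
  using rt[of s] root_norm_pos[of "rt s" _ X] by blast

lemma functional_act: "s \<in> R \<Longrightarrow> x \<in> points X \<Longrightarrow>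
    \<beta> \<bullet> hat X (s x) = (\<beta> - (2 * (\<beta> \<bullet> sharp X (rt s)) / (rt s \<bullet> sharp X (rt s))) *\<^sub>R rt s) \<bullet> hat X x"
  using functional_reflection[of s X "rt s"] rt R_refl reflections_isometries by blast

lemma root_flip: "s \<in> R \<Longrightarrow> x \<in> points X \<Longrightarrow> rt s \<bullet> hat X (s x) = - (rt s \<bullet> hat X x)"
  using root_reflected[of s X "rt s"] rt R_refl reflections_isometries by blast

lemma wall_fix: "s \<in> R \<Longrightarrow> p \<in> points X \<Longrightarrow> ev (rt s) p = 0 \<Longrightarrow> s p = p"
  using rt(2)[of s] by (auto simp: mirror_def)

lemma conj_R:
  assumes "g \<in> \<Gamma>" "s \<in> R"
  shows "iv g \<cdot> s \<cdot> g \<in> R" "mirror X (iv g \<cdot> s \<cdot> g) = {x \<in> points X. g x \<in> mirror X s}"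
proof -
  have "iv g \<cdot> s \<cdot> g \<in> \<Gamma>"
    using assms R_\<Gamma> \<Gamma>_subgroup by (simp add: subgroup.m_closed subgroup.m_inv_closed)
  moreover note reflection_conjugate[of g X s]
  ultimately show "iv g \<cdot> s \<cdot> g \<in> R" "mirror X (iv g \<cdot> s \<cdot> g) = {x \<in> points X. g x \<in> mirror X s}"
    using assms \<Gamma>_isometries R_refl unfolding R_def by blast+
qed

lemma conj_eq:
  fixes g s t :: "'a \<Rightarrow> 'a"
  assumes "g \<in> carrier (BG X)" "s \<in> carrier (BG X)" "iv g \<cdot> s \<cdot> g = t"
  shows "s \<cdot> g = g \<cdot> t"
proof -
  have "g \<cdot> t = g \<cdot> iv g \<cdot> (s \<cdot> g)"
    using assms(1,2) unfolding assms(3)[symmetric] by (simp only: BG.m_assoc BG.m_closed BG.inv_closed)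
  then show ?thesis using assms(1,2) by simp
qed

lemma off_mirrors:
  assumes "g \<in> \<Gamma>" "x \<in> points X" "\<And>s. s \<in> R \<Longrightarrow> ev (rt s) x \<noteq> 0" "s \<in> R"
  shows "ev (rt s) (g x) \<noteq> 0"
proof
  assume "ev (rt s) (g x) = 0"
  then have "g x \<in> mirror X s" using rt(2)[OF assms(4)] \<Gamma>_points assms by auto
  then have "x \<in> mirror X (iv g \<cdot> s \<cdot> g)" using conj_R[OF assms(1,4)] assms by auto
  then show False using assms(3) rt(2) conj_R[OF assms(1,4)] by auto
qed

lemma orbit_off: "g \<in> \<Gamma> \<Longrightarrow> s \<in> R \<Longrightarrow> ev (rt s) (g x0) \<noteq> 0"
  using off_mirrors[of g x0 s] x0 rt(3) by (metis less_irrefl)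

text \<open>The pulled back root vanishes on the mirror of the conjugate reflection, so it is a
  multiple of that root. As roots are positive at \<open>x0\<close>, the sign of \<open>l\<close>
  tells on which side of the mirror of \<open>s\<close> the point \<open>g x0\<close> lies.\<close>

lemma pullback:
  assumes "g \<in> \<Gamma>" "s \<in> R"
  obtains l where "l \<noteq> 0" "\<And>x. x \<in> points X \<Longrightarrow> rt s \<bullet> hat X (g x) = l * (rt (iv g \<cdot> s \<cdot> g) \<bullet> hat X x)"
proof -
  let ?r = "iv g \<cdot> s \<cdot> g"
  note r = conj_R[OF assms]
  obtain \<beta> where b: "\<And>x. x \<in> points X \<Longrightarrow> \<beta> \<bullet> hat X x = rt s \<bullet> hat X (g x)"
    using isometry_functional \<Gamma>_isometries assms by blast
  obtain p where p: "p \<in> points X" "ev (rt ?r) p = 0" using rt[OF r(1)] by blast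
  have "ev \<beta> x = 0" if "x \<in> points X" "ev (rt ?r) x = 0" for x
  proof -
    have "g x \<in> mirror X s" using that rt(2)[OF r(1)] r(2) by auto
    then have "rt s \<bullet> hat X (g x) = 0"
      using rt(2)[OF assms(2)] inner_hat_sign(3)[OF \<Gamma>_points[OF assms(1) that(1)], of "rt s"] by simp
    then show ?thesis using b[OF that(1)] inner_hat_sign(3)[OF that(1), of \<beta>] by simp
  qed
  then obtain l where l: "\<beta> = l *\<^sub>R rt ?r"
    using functional_vanishing_on_hyperplane[OF rt(1)[OF r(1)] open_points p] by metis
  have e: "rt s \<bullet> hat X (g x) = l * (rt ?r \<bullet> hat X x)" if "x \<in> points X" for x
    using b[OF that] l by simp
  have "rt s \<bullet> hat X (g x0) \<noteq> 0"
    using orbit_off[OF assms] inner_hat_sign(3)[OF \<Gamma>_points[OF assms(1) x0(1)]] by simp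
  then have "l \<noteq> 0" using e[OF x0(1)] by auto
  then show ?thesis using that e by blast
qed

text \<open>The point \<open>p\<close> that makes \<open>s\<close> a wall is fixed by
  \<open>s\<close>, and both roots compared by \<open>pullback\<close> are positive there; so the
  factor \<open>l\<close> is positive, and this is then used at \<open>x0\<close>.\<close>

lemma wall_cross:
  assumes "s \<in> walls" "t \<in> R" "t \<noteq> s"
  shows "0 < ev (rt t) (s x0)"
proof -
  obtain p where p: "p \<in> points X" "ev (rt s) p = 0" "\<And>t. t \<in> R \<Longrightarrow> t \<noteq> s \<Longrightarrow> 0 < ev (rt t) p"
    using assms(1) unfolding walls_def by blast
  have s: "s \<in> R" "s \<in> \<Gamma>" using assms walls_R R_\<Gamma> by auto
  let ?r = "iv s \<cdot> t \<cdot> s"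
  have r: "?r \<in> R" using conj_R s assms by blast
  have rs: "?r \<noteq> s"
  proof
    assume "?r = s"
    then have "t \<cdot> s = s \<cdot> s" by (rule conj_eq[OF R_carrier[OF s(1)] R_carrier[OF assms(2)]])
    then show False using assms(3) BG.right_cancel R_carrier[OF s(1)] R_carrier[OF assms(2)] by metis
  qed
  obtain l where l: "\<And>x. x \<in> points X \<Longrightarrow> rt t \<bullet> hat X (s x) = l * (rt ?r \<bullet> hat X x)"
    using pullback[OF s(2) assms(2)] by blast
  have "0 < rt t \<bullet> hat X p" "0 < rt ?r \<bullet> hat X p"
    using p(3)[OF assms(2,3)] p(3)[OF r rs] inner_hat_sign(2)[OF p(1)] by blast+
  then have "0 < l" using l[OF p(1)] wall_fix[OF s(1) p(1,2)] by (simp add: zero_less_mult_iff)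
  moreover have "0 < rt ?r \<bullet> hat X x0" using rt(3)[OF r] inner_hat_sign(2)[OF x0(1)] by blast
  ultimately have "0 < rt t \<bullet> hat X (s x0)" using l[OF x0(1)] by simp
  then show ?thesis using inner_hat_sign(2)[OF \<Gamma>_points[OF s(2) x0(1)]] by blast
qed

text \<open>A mirror separating \<open>x0\<close> from \<open>x\<close> meets the compact segment
  between them.\<close>

lemma finite_negative:
  assumes "x \<in> points X" shows "finite {t \<in> R. ev (rt t) x < 0}"
proof (rule finite_subset)
  show "finite {t \<in> \<Gamma> \<inter> reflections X. mirror X t \<inter> closed_segment x0 x \<noteq> {}}"
    by (intro locally_finite compact_segment closed_segment_subset x0(1) assms convex_points)
  show "{t \<in> R. ev (rt t) x < 0} \<subseteq> {t \<in> \<Gamma> \<inter> reflections X. mirror X t \<inter> closed_segment x0 x \<noteq> {}}"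
  proof clarify
    fix t assume t: "t \<in> R" "ev (rt t) x < 0"
    define a b where "a = ev (rt t) x0" and "b = ev (rt t) x"
    have ab: "a > 0" "b < 0" using t rt(3) a_def b_def by auto
    define u where "u = a / (a - b)"
    have u: "0 \<le> u" "u \<le> 1" using ab by (auto simp: u_def)
    define p where "p = (1 - u) *\<^sub>R x0 + u *\<^sub>R x"
    have ps: "p \<in> closed_segment x0 x" using u unfolding p_def in_segment by blast
    then have "p \<in> points X" using closed_segment_subset[OF x0(1) assms convex_points] by blast
    moreover have "ev (rt t) p = 0"
      unfolding p_def ev_convex a_def[symmetric] b_def[symmetric] using ab by (simp add: u_def field_simps)
    ultimately have "p \<in> mirror X t" unfolding rt(2)[OF t(1)] by simp
    then have "mirror X t \<inter> closed_segment x0 x \<noteq> {}" using ps by blast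
    then show "t \<in> \<Gamma> \<inter> reflections X \<and> mirror X t \<inter> closed_segment x0 x \<noteq> {}"
      using R_\<Gamma>[OF t(1)] R_refl[OF t(1)] by simp
  qed
qed

lemma convex_U: "convex U"
  unfolding convex_alt U_def
proof (clarify, intro conjI ballI)
  fix x y and u :: real
  assume a: "x \<in> points X" "y \<in> points X" "0 \<le> u" "u \<le> 1" "\<forall>s\<in>R. 0 < ev (rt s) x" "\<forall>s\<in>R. 0 < ev (rt s) y"
  show "(1 - u) *\<^sub>R x + u *\<^sub>R y \<in> points X"
    by (rule convexD_alt[OF convex_points a(1-4)])
  fix s assume s: "s \<in> R"
  show "0 < ev (rt s) ((1 - u) *\<^sub>R x + u *\<^sub>R y)"
  proof (cases "u = 0")
    case False
    have "0 \<le> (1 - u) * ev (rt s) x" "0 < u * ev (rt s) y" using a s False by auto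
    then show ?thesis unfolding ev_convex by linarith
  qed (use a s in simp)
qed

lemma convex_chamber: "convex chamber"
  unfolding convex_alt chamber_def
proof (clarify, intro conjI ballI)
  fix x y and u :: real
  assume a: "x \<in> points X" "y \<in> points X" "0 \<le> u" "u \<le> 1" "\<forall>s\<in>R. 0 \<le> ev (rt s) x" "\<forall>s\<in>R. 0 \<le> ev (rt s) y"
  show "(1 - u) *\<^sub>R x + u *\<^sub>R y \<in> points X"
    by (rule convexD_alt[OF convex_points a(1-4)])
  fix s assume s: "s \<in> R"
  show "0 \<le> ev (rt s) ((1 - u) *\<^sub>R x + u *\<^sub>R y)"
  proof -
    have "0 \<le> (1 - u) * ev (rt s) x" "0 \<le> u * ev (rt s) y"
      using bspec[OF a(5) s] bspec[OF a(6) s] a(3,4) by (simp_all only: mult_nonneg_nonneg diff_ge_0_iff_ge)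
    then show ?thesis unfolding ev_convex by linarith
  qed
qed

lemma continuous_ev: "continuous_on A (ev \<alpha>)"
  by (rule continuous_on_inner[OF continuous_on_const continuous_on_Pair[OF continuous_on_id continuous_on_const]])

lemma open_ev: "open {x. 0 < ev \<alpha> x}"
  by (rule open_Collect_less[OF continuous_on_const continuous_ev])

lemma closed_ev: "closed {x. 0 \<le> ev \<alpha> x}"
  by (rule closed_Collect_le[OF continuous_on_const continuous_ev])

lemma connected_positive:
  assumes "connected Y" "x \<in> Y" "y \<in> Y" "0 < ev \<alpha> x" "\<And>z. z \<in> Y \<Longrightarrow> ev \<alpha> z \<noteq> 0"
  shows "0 < ev \<alpha> y"
proof (rule ccontr)
  assume n: "\<not> 0 < ev \<alpha> y"
  have c: "connected (ev \<alpha> ` Y)"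
    using assms(1) by (rule connected_continuous_image[OF continuous_ev])
  have "0 \<in> ev \<alpha> ` Y"
  proof (rule connectedD_interval[OF c])
    show "ev \<alpha> y \<in> ev \<alpha> ` Y" by (rule imageI[OF assms(3)])
    show "ev \<alpha> x \<in> ev \<alpha> ` Y" by (rule imageI[OF assms(2)])
    show "ev \<alpha> y \<le> 0" "0 \<le> ev \<alpha> x" using n assms(4) by linarith+
  qed
  then obtain z where z: "0 = ev \<alpha> z" "z \<in> Y" by (rule imageE)
  show False using assms(5)[OF z(2)] z(1)[symmetric] by (rule notE)
qed

lemma local_ball:
  assumes "p \<in> points X"
  shows "\<exists>e>0. ball p e \<subseteq> points X \<and> finite {t \<in> R. mirror X t \<inter> ball p e \<noteq> {}}"
proof -
  obtain e where e: "e > 0" "cball p e \<subseteq> points X" using open_points assms open_contains_cball by blast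
  have "finite {t \<in> \<Gamma> \<inter> reflections X. mirror X t \<inter> cball p e \<noteq> {}}"
    by (rule locally_finite[OF compact_cball e(2)])
  moreover have "{t \<in> R. mirror X t \<inter> ball p e \<noteq> {}}
      \<subseteq> {t \<in> \<Gamma> \<inter> reflections X. mirror X t \<inter> cball p e \<noteq> {}}"
    unfolding R_def using Int_mono[OF order_refl ball_subset_cball[of p e]] by (intro Collect_mono) blast
  ultimately have f: "finite {t \<in> R. mirror X t \<inter> ball p e \<noteq> {}}" by (rule rev_finite_subset)
  have "ball p e \<subseteq> points X" using e(2) ball_subset_cball by (rule order_trans[rotated])
  then show ?thesis using e(1) f by (intro exI[of _ e] conjI)
qed

text \<open>Positivity at \<open>p\<close> of possibly infinitely many roots persists nearby: only
  finitely many of their mirrors meet a small ball, and every other root has constant sign on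
  it.\<close>

lemma positive_near:
  assumes p: "p \<in> points X" and T: "T \<subseteq> R" and pos: "\<And>t. t \<in> T \<Longrightarrow> 0 < ev (rt t) p"
  shows "\<exists>e>0. ball p e \<subseteq> points X \<and> (\<forall>t\<in>T. \<forall>x\<in>ball p e. 0 < ev (rt t) x)"
proof -
  obtain e where e: "e > 0" "ball p e \<subseteq> points X" "finite {t \<in> R. mirror X t \<inter> ball p e \<noteq> {}}"
    using local_ball[OF p] by blast
  define F where "F = {t \<in> T. mirror X t \<inter> ball p e \<noteq> {}}"
  have "F \<subseteq> {t \<in> R. mirror X t \<inter> ball p e \<noteq> {}}" unfolding F_def using T by blast
  then have "finite F" using e(3) by (rule finite_subset)
  then have "open (ball p e \<inter> (\<Inter>t\<in>F. {x. 0 < ev (rt t) x}))"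
    by (intro open_Int open_ball open_INT ballI open_ev)
  moreover have "p \<in> ball p e \<inter> (\<Inter>t\<in>F. {x. 0 < ev (rt t) x})"
    using e(1) pos unfolding F_def by simp
  ultimately obtain d where d: "d > 0" "ball p d \<subseteq> ball p e \<inter> (\<Inter>t\<in>F. {x. 0 < ev (rt t) x})"
    by (rule openE)
  have "0 < ev (rt t) x" if t: "t \<in> T" and x: "x \<in> ball p d" for t x
  proof (cases "t \<in> F")
    case False
    have tR: "t \<in> R" using t T by blast
    have nz: "ev (rt t) y \<noteq> 0" if y: "y \<in> ball p e" for y
    proof
      assume "ev (rt t) y = 0"
      then have "y \<in> mirror X t" unfolding rt(2)[OF tR] using subsetD[OF e(2) y] by simp
      then show False using False t y unfolding F_def by blast
    qed
    have xe: "x \<in> ball p e" using subsetD[OF d(2) x] by blast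
    have "p \<in> ball p e" using e(1) by simp
    then show ?thesis by (rule connected_positive[OF connected_ball _ xe pos[OF t] nz])
  next
    case True
    then show ?thesis using subsetD[OF d(2) x] by blast
  qed
  moreover have "ball p d \<subseteq> points X" using d(2) e(2) by blast
  ultimately show ?thesis using d(1) by blast
qed

lemma open_U: "open U"
  unfolding open_contains_ball
proof
  fix x assume x: "x \<in> U"
  have xp: "x \<in> points X" "\<And>t. t \<in> R \<Longrightarrow> 0 < ev (rt t) x" using x by (auto simp: U_def)
  obtain e where "e > 0" "ball x e \<subseteq> points X" "\<forall>t\<in>R. \<forall>y\<in>ball x e. 0 < ev (rt t) y"
    using positive_near[OF xp(1) order_refl xp(2)] by blast
  then show "\<exists>e>0. ball x e \<subseteq> U" unfolding U_def by blast
qed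

lemma component_U: "U = connected_component_set (points X - (\<Union>s\<in>R. mirror X s)) x0"
proof
  let ?M = "points X - (\<Union>s\<in>R. mirror X s)"
  have UM: "U \<subseteq> ?M"
  proof
    fix x assume x: "x \<in> U"
    then have "x \<notin> mirror X s" if "s \<in> R" for s using that rt(2)[OF that] by (force simp: U_def)
    then show "x \<in> ?M" using x by (auto simp: U_def)
  qed
  show "U \<subseteq> connected_component_set ?M x0"
    by (rule connected_component_maximal[OF x0_U convex_connected[OF convex_U] UM])
  show "connected_component_set ?M x0 \<subseteq> U"
  proof
    fix y assume y: "y \<in> connected_component_set ?M x0"
    let ?Y = "connected_component_set ?M x0"
    have YM: "?Y \<subseteq> ?M" by (rule connected_component_subset)
    have x0Y: "x0 \<in> ?Y"
      using connected_component_refl[OF subsetD[OF UM x0_U]] by (rule CollectI)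
    have "0 < ev (rt s) y" if s: "s \<in> R" for s
    proof (rule connected_positive[of ?Y x0 y])
      show "ev (rt s) z \<noteq> 0" if "z \<in> ?Y" for z
        using subsetD[OF YM that] rt(2)[OF s] s by auto
    qed (use x0Y y rt(3)[OF s] in auto)
    then show "y \<in> U" using y YM unfolding U_def by blast
  qed
qed

lemma segment_U:
  assumes "x \<in> chamber" "0 \<le> u" "u < 1"
  shows "(1 - u) *\<^sub>R x0 + u *\<^sub>R x \<in> U"
proof -
  have "(1 - u) *\<^sub>R x0 + u *\<^sub>R x \<in> points X"
    using assms x0 convex_points unfolding chamber_def by (intro convexD_alt) auto
  moreover have "0 < ev (rt s) ((1 - u) *\<^sub>R x0 + u *\<^sub>R x)" if s: "s \<in> R" for s
  proof -
    have "0 < (1 - u) * ev (rt s) x0" "0 \<le> u * ev (rt s) x"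
      using assms rt(3)[OF s] s unfolding chamber_def by auto
    then show ?thesis unfolding ev_convex by linarith
  qed
  ultimately show ?thesis unfolding U_def by blast
qed

lemma U_chamber: "U \<subseteq> chamber" unfolding U_def chamber_def by force

lemma closure_U: "points X \<inter> closure U = chamber"
proof
  have "closure U \<subseteq> {x. 0 \<le> ev (rt s) x}" if "s \<in> R" for s
    by (rule closure_minimal[OF _ closed_ev]) (use that in \<open>force simp: U_def\<close>)
  then show "points X \<inter> closure U \<subseteq> chamber" unfolding chamber_def by blast
  show "chamber \<subseteq> points X \<inter> closure U"
  proof
    fix x assume x: "x \<in> chamber"
    define f where "f n = (1 - (1 - inverse (real (Suc n)))) *\<^sub>R x0 + (1 - inverse (real (Suc n))) *\<^sub>R x" for n
    have "f \<longlonglongrightarrow> (1 - (1 - 0)) *\<^sub>R x0 + (1 - 0) *\<^sub>R x"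
      unfolding f_def by (intro tendsto_intros LIMSEQ_inverse_real_of_nat)
    then have "f \<longlonglongrightarrow> x" by simp
    moreover have "f n \<in> U" for n
      unfolding f_def using x by (intro segment_U) (simp_all add: inverse_le_1_iff)
    ultimately have "x \<in> closure U" unfolding closure_sequential by blast
    then show "x \<in> points X \<inter> closure U" using x unfolding chamber_def by auto
  qed
qed

end

section \<open>Walls and facets of a chamber\<close>

text \<open>One step of Gram-Schmidt. It later yields a functional with prescribed pairings against
  two roots.\<close>

lemma prescribed_inner:
  fixes u v :: "'b::real_inner"
  assumes "u \<noteq> 0" "v \<noteq> 0" "\<nexists>c. v = c *\<^sub>R u"
  shows "\<exists>f. f \<bullet> u = p \<and> f \<bullet> v = q"
proof -
  define w where "w = v - ((v \<bullet> u) / (u \<bullet> u)) *\<^sub>R u"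
  have w0: "w \<noteq> 0" using assms(3) by (auto simp: w_def)
  have wu: "w \<bullet> u = 0" using assms(1) by (simp add: w_def inner_diff_left)
  have "v = w + ((v \<bullet> u) / (u \<bullet> u)) *\<^sub>R u" by (simp add: w_def)
  then have "w \<bullet> v = w \<bullet> (w + ((v \<bullet> u) / (u \<bullet> u)) *\<^sub>R u)" by (rule arg_cong)
  then have wv: "w \<bullet> v = w \<bullet> w" using wu by (simp add: inner_add_right)
  define f where "f = (p / (u \<bullet> u)) *\<^sub>R u + ((q - p / (u \<bullet> u) * (u \<bullet> v)) / (w \<bullet> w)) *\<^sub>R w"
  have "f \<bullet> u = p" using wu assms(1) by (simp add: f_def inner_add_left)
  moreover have "f \<bullet> v = q" using wv w0 by (simp add: f_def inner_add_left)
  ultimately show ?thesis by blast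
qed

context mirror_system begin

lemma walls_generate_subset: "generate (BG X) walls \<subseteq> \<Gamma>"
  by (rule BG.generate_subgroup_incl[OF _ \<Gamma>_subgroup]) (use walls_R R_\<Gamma> in blast)

text \<open>
  The segment from a generic \<open>x1\<close> in the chamber to \<open>x\<close> meets no two mirrors at once, so the first
  mirror it crosses is a wall.
\<close>

lemma separating_wall:
  assumes x: "x \<in> points X" and s0: "s0 \<in> R" "ev (rt s0) x < 0"
  shows "\<exists>s\<in>walls. ev (rt s) x < 0"
proof -
  define A where "A = {t \<in> R. ev (rt t) x < 0}"
  have fA: "finite A" unfolding A_def by (rule finite_negative[OF x])
  have AR: "t \<in> R" "ev (rt t) x < 0" if "t \<in> A" for t using that by (simp_all add: A_def)
  have s0A: "s0 \<in> A" using s0 by (simp add: A_def)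
  \<comment> \<open>At a starting point \<open>x1\<close> in \<open>U\<close>, \<open>g t t'\<close>
    vanishes exactly when the segment to \<open>x\<close> meets the two mirrors at the same
    parameter.\<close>
  define g where "g t t' = ev (rt t) x *\<^sub>R rt t' - ev (rt t') x *\<^sub>R rt t" for t t'
  have ev_g: "ev (g t t') y = ev (rt t) x * ev (rt t') y - ev (rt t') x * ev (rt t) y" for t t' y
    by (simp add: g_def inner_diff_left)
  define P where "P = (\<lambda>(t, t'). g t t') ` ((A \<times> A) \<inter> {(t, t'). t \<noteq> t'})"
  have fP: "finite P" unfolding P_def using fA by simp
  have nz: "\<exists>y\<in>U. ev \<gamma> y \<noteq> 0" if gP: "\<gamma> \<in> P" for \<gamma>
  proof (rule ccontr)
    assume "\<not> (\<exists>y\<in>U. ev \<gamma> y \<noteq> 0)"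
    then have "\<And>y. y \<in> U \<Longrightarrow> ev \<gamma> y = 0" by blast
    then have g0: "\<gamma> = 0" by (rule affine_zero[OF open_U x0_U])
    obtain t t' where t: "t \<in> A" "t' \<in> A" "t \<noteq> t'" "\<gamma> = g t t'" using gP unfolding P_def by auto
    have "ev (rt t) x *\<^sub>R rt t' = ev (rt t') x *\<^sub>R rt t" using g0 t(4) by (simp add: g_def)
    then have "(1 / ev (rt t) x) *\<^sub>R (ev (rt t) x *\<^sub>R rt t') = (1 / ev (rt t) x) *\<^sub>R (ev (rt t') x *\<^sub>R rt t)"
      by (rule arg_cong)
    then have "rt t' = (1 / ev (rt t) x * ev (rt t') x) *\<^sub>R rt t" using AR(2)[OF t(1)] by simp
    then have "t' = t" by (rule root_inj[OF AR(1)[OF t(2)] AR(1)[OF t(1)]])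
    then show False using t(3) by simp
  qed
  have "U \<noteq> {}" using x0_U by blast
  from generic_point[OF fP convex_U this nz]
  obtain x1 where x1: "x1 \<in> U" "\<forall>\<gamma>\<in>P. ev \<gamma> x1 \<noteq> 0" by blast
  have x1p: "x1 \<in> points X" "\<And>t. t \<in> R \<Longrightarrow> 0 < ev (rt t) x1" using x1(1) by (simp_all add: U_def)
  \<comment> \<open>The parameter at which the segment from \<open>x1\<close> to \<open>x\<close>
    crosses the mirror of \<open>t\<close>.\<close>
  define u where "u t = ev (rt t) x1 / (ev (rt t) x1 - ev (rt t) x)" for t
  have "Min (u ` A) \<in> u ` A" using fA s0A by (intro Min_in) auto
  then obtain t where t: "t \<in> A" "u t = Min (u ` A)" by auto
  have tmin: "u t \<le> u r" if "r \<in> A" for r unfolding t(2) using fA that by (intro Min_le) auto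
  define p where "p = (1 - u t) *\<^sub>R x1 + u t *\<^sub>R x"
  have ab: "0 < ev (rt t) x1" "ev (rt t) x < 0" using x1p(2) AR[OF t(1)] by simp_all
  have ut: "0 < u t" "u t < 1" using ab by (simp_all add: u_def)
  have pp: "p \<in> points X" unfolding p_def using ut
    by (intro convexD_alt[OF convex_points x1p(1) x]) simp_all
  have ev_p: "ev (rt r) p = ev (rt r) x1 - u t * (ev (rt r) x1 - ev (rt r) x)" for r
    unfolding p_def ev_convex by (simp add: algebra_simps)
  have p0: "ev (rt t) p = 0" unfolding ev_p using ab by (simp add: u_def)
  have "0 < ev (rt r) p" if r: "r \<in> R" "r \<noteq> t" for r
  proof (cases "ev (rt r) x < 0")
    case False
    have "0 < (1 - u t) * ev (rt r) x1" "0 \<le> u t * ev (rt r) x" using ut False x1p(2)[OF r(1)] by simp_all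
    then show ?thesis unfolding p_def ev_convex by linarith
  next
    case True
    then have rA: "r \<in> A" using r by (simp add: A_def)
    have cd: "0 < ev (rt r) x1 - ev (rt r) x" using True x1p(2)[OF r(1)] by simp
    have "u t \<noteq> u r"
    proof
      assume e: "u t = u r"
      have "ev (rt r) x1 * (ev (rt t) x1 - ev (rt t) x) = ev (rt t) x1 * (ev (rt r) x1 - ev (rt r) x)"
        using e cd ab by (simp add: u_def field_simps)
      then have "ev (g t r) x1 = 0" unfolding ev_g by (simp add: algebra_simps)
      moreover have "g t r \<in> P" unfolding P_def using t(1) rA r(2) by (intro image_eqI[of _ _ "(t, r)"]) auto
      ultimately show False using x1(2) by blast
    qed
    then have "u t < u r" using tmin[OF rA] by simp
    then have "u t * (ev (rt r) x1 - ev (rt r) x) < u r * (ev (rt r) x1 - ev (rt r) x)" using cd by simp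
    also have "\<dots> = ev (rt r) x1" using cd by (simp add: u_def)
    finally show ?thesis unfolding ev_p by simp
  qed
  then have "t \<in> walls" unfolding walls_def using AR(1)[OF t(1)] pp p0 by blast
  then show ?thesis using AR(2)[OF t(1)] by blast
qed

text \<open>Reflecting \<open>x\<close> in a separating wall \<open>s\<close> lowers the number of
  separating mirrors: conjugation by \<open>s\<close> embeds those of \<open>s x\<close> into those
  of \<open>x\<close>, and by \<open>wall_cross\<close> it misses \<open>s\<close> itself.\<close>

lemma to_chamber:
  "\<lbrakk>x \<in> points X; \<And>s. s \<in> R \<Longrightarrow> ev (rt s) x \<noteq> 0\<rbrakk> \<Longrightarrow> \<exists>w\<in>generate (BG X) walls. w x \<in> U"
proof (induction "card {t \<in> R. ev (rt t) x < 0}" arbitrary: x rule: less_induct)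
  case less
  show ?case
  proof (cases "\<exists>t\<in>R. ev (rt t) x < 0")
    case False
    then have "0 < ev (rt t) x" if "t \<in> R" for t using less.prems(2)[OF that] that by force
    then have "x \<in> U" using less.prems(1) by (simp add: U_def)
    then show ?thesis using BG_one[OF less.prems(1)] generate.one by metis
  next
    case True
    then obtain s where s: "s \<in> walls" "ev (rt s) x < 0" using separating_wall less.prems(1) by blast
    have sR: "s \<in> R" and s\<Gamma>: "s \<in> \<Gamma>" and sc: "s \<in> carrier (BG X)"
      using walls_R[OF s(1)] R_\<Gamma> R_carrier by blast+
    define y where "y = s x"
    have yp: "y \<in> points X" unfolding y_def by (rule \<Gamma>_points[OF s\<Gamma> less.prems(1)])
    let ?A = "{t \<in> R. ev (rt t) x < 0}" and ?B = "{t \<in> R. ev (rt t) y < 0}"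
    let ?c = "\<lambda>t. iv s \<cdot> t \<cdot> s"
    have fin: "finite ?A" by (rule finite_negative[OF less.prems(1)])
    have sub: "?c t \<in> ?A - {s}" if t: "t \<in> ?B" for t
    proof -
      have tR: "t \<in> R" "ev (rt t) y < 0" using t by auto
      have "rt s \<bullet> hat X y > 0"
        using root_flip[OF sR less.prems(1)] s(2) inner_hat_sign(1)[OF less.prems(1), of "rt s"] unfolding y_def by simp
      then have ts: "t \<noteq> s" using tR(2) inner_hat_sign(2)[OF yp, of "rt s"] by force
      have cR: "?c t \<in> R" by (rule conj_R(1)[OF s\<Gamma> tR(1)])
      obtain l where l: "\<And>z. z \<in> points X \<Longrightarrow> rt t \<bullet> hat X (s z) = l * (rt (?c t) \<bullet> hat X z)"
        by (rule pullback[OF s\<Gamma> tR(1)]) blast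
      have "0 < rt t \<bullet> hat X (s x0)"
        using wall_cross[OF s(1) tR(1) ts] inner_hat_sign(2)[OF \<Gamma>_points[OF s\<Gamma> x0(1)]] by blast
      moreover have "0 < rt (?c t) \<bullet> hat X x0" using rt(3)[OF cR] inner_hat_sign(2)[OF x0(1)] by blast
      ultimately have lp: "0 < l" using l[OF x0(1)] by (simp add: zero_less_mult_iff)
      have "rt t \<bullet> hat X (s x) < 0" using tR(2) inner_hat_sign(1)[OF yp] unfolding y_def by blast
      then have "rt (?c t) \<bullet> hat X x < 0" using l[OF less.prems(1)] lp by (simp add: mult_less_0_iff)
      then have "ev (rt (?c t)) x < 0" using inner_hat_sign(1)[OF less.prems(1)] by blast
      moreover have "?c t \<noteq> s"
      proof
        assume "?c t = s"
        then have "t \<cdot> s = s \<cdot> s" by (rule conj_eq[OF sc R_carrier[OF tR(1)]])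
        then show False using ts BG.right_cancel[OF sc sc R_carrier[OF tR(1)]] R_carrier[OF tR(1)] sc by simp
      qed
      ultimately show ?thesis using cR by simp
    qed
    have inj: "inj_on ?c ?B"
    proof (rule inj_onI)
      fix t t' assume t: "t \<in> ?B" "t' \<in> ?B" "?c t = ?c t'"
      then have c: "t \<in> carrier (BG X)" "t' \<in> carrier (BG X)" using R_carrier by auto
      have "t \<cdot> s = s \<cdot> ?c t'" by (rule conj_eq[OF sc c(1) t(3)])
      moreover have "t' \<cdot> s = s \<cdot> ?c t'" by (rule conj_eq[OF sc c(2) refl])
      ultimately have "t \<cdot> s = t' \<cdot> s" by (simp only:)
      then show "t = t'" using c sc by simp
    qed
    have "card ?B \<le> card (?A - {s})"
      by (rule card_inj_on_le[OF inj]) (use sub fin in auto)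
    also have "\<dots> < card ?A" using fin sR s(2) by (intro card_Diff1_less) auto
    finally have lt: "card ?B < card ?A" .
    have off: "ev (rt r) y \<noteq> 0" if "r \<in> R" for r
      unfolding y_def by (rule off_mirrors[OF s\<Gamma> less.prems that])
    obtain w where w: "w \<in> generate (BG X) walls" "w y \<in> U" using less.hyps[OF lt yp off] by blast
    have "(w \<cdot> s) x = w y" unfolding y_def
      using w(1) walls_generate_subset \<Gamma>_carrier by (intro BG_mult[OF _ sc less.prems(1)]) blast
    moreover have "w \<cdot> s \<in> generate (BG X) walls" by (rule generate.eng[OF w(1) generate.incl[OF s(1)]])
    ultimately show ?thesis using w(2) by metis
  qed
qed

text \<open>Inside a small ball only finitely many mirrors occur, and distinct mirrors have
  non-proportional roots, so a generic point of the mirror of \<open>r\<close> avoids all the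
  others.\<close>

lemma only_mirror_point:
  assumes r: "r \<in> R"
  shows "\<exists>p\<in>points X. ev (rt r) p = 0 \<and> (\<forall>t\<in>R. t \<noteq> r \<longrightarrow> ev (rt t) p \<noteq> 0)"
proof -
  obtain p0 where p0: "p0 \<in> points X" "ev (rt r) p0 = 0" using rt(2,4)[OF r] by blast
  obtain e where e: "e > 0" "ball p0 e \<subseteq> points X" "finite {t \<in> R. mirror X t \<inter> ball p0 e \<noteq> {}}"
    using local_ball[OF p0(1)] by blast
  define K where "K = ball p0 e \<inter> {x. ev (rt r) x = 0}"
  define A where "A = rt ` ({t \<in> R. mirror X t \<inter> ball p0 e \<noteq> {}} - {r})"
  have fA: "finite A" unfolding A_def using e(3) by simp
  have "convex {x. fst (rt r) \<bullet> x = - snd (rt r)}" by (rule convex_hyperplane)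
  moreover have "{x. ev (rt r) x = 0} = {x. fst (rt r) \<bullet> x = - snd (rt r)}"
    by (auto simp: inner_lift eq_neg_iff_add_eq_0)
  ultimately have cK: "convex K" unfolding K_def by (simp add: convex_Int)
  have K0: "p0 \<in> K" unfolding K_def using p0 e(1) by simp
  have nz: "\<exists>x\<in>K. ev \<gamma> x \<noteq> 0" if g: "\<gamma> \<in> A" for \<gamma>
  proof (rule ccontr)
    assume n: "\<not> (\<exists>x\<in>K. ev \<gamma> x \<noteq> 0)"
    obtain t where t: "t \<in> R" "t \<noteq> r" "\<gamma> = rt t" using g unfolding A_def by auto
    have v: "ev \<gamma> x = 0" if "x \<in> ball p0 e" "ev (rt r) x = 0" for x using n that unfolding K_def by blast
    have "p0 \<in> ball p0 e" using e(1) by simp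
    from functional_vanishing_on_hyperplane[OF rt(1)[OF r] open_ball this p0(2) v]
    obtain l where "\<gamma> = l *\<^sub>R rt r" by metis
    then have "rt t = l *\<^sub>R rt r" using t(3) by simp
    then show False using root_inj[OF t(1) r] t(2) by blast
  qed
  obtain p where p: "p \<in> K" "\<forall>\<gamma>\<in>A. ev \<gamma> p \<noteq> 0" using generic_point[OF fA cK _ nz] K0 by blast
  have pb: "p \<in> ball p0 e" "ev (rt r) p = 0" using p(1) unfolding K_def by simp_all
  have "ev (rt t) p \<noteq> 0" if t: "t \<in> R" "t \<noteq> r" for t
  proof (cases "mirror X t \<inter> ball p0 e = {}")
    case True
    then have "p \<notin> mirror X t" using pb(1) by blast
    then show ?thesis unfolding rt(2)[OF t(1)] using subsetD[OF e(2) pb(1)] by simp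
  next
    case False
    then have "rt t \<in> A" unfolding A_def using t by blast
    then show ?thesis using p(2) by blast
  qed
  then show ?thesis using subsetD[OF e(2) pb(1)] pb(2) by blast
qed

text \<open>A point \<open>x\<close> just off a generic point \<open>p\<close> of the mirror is
  carried into \<open>U\<close> by some \<open>w\<close> in the group of walls. Then
  \<open>w p\<close> lies in the chamber and on the mirror of \<open>s = w r w^-1\<close> alone, so
  \<open>s\<close> is a wall and \<open>r\<close> is a conjugate of it.\<close>

lemma R_generated:
  assumes r: "r \<in> R"
  shows "r \<in> generate (BG X) walls"
proof -
  obtain p where p: "p \<in> points X" "ev (rt r) p = 0" "\<And>t. t \<in> R \<Longrightarrow> t \<noteq> r \<Longrightarrow> ev (rt t) p \<noteq> 0"
    using only_mirror_point[OF r] by blast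
  define q where "q u = (1 - u) *\<^sub>R p + u *\<^sub>R x0" for u :: real
  have ev_q: "ev \<alpha> (q u) = (1 - u) * ev \<alpha> p + u * ev \<alpha> x0" for \<alpha> u unfolding q_def by (rule ev_convex)
  define B where "B = {t \<in> R. ev (rt t) p < 0}"
  define z where "z t = - ev (rt t) p / (ev (rt t) x0 - ev (rt t) p)" for t
  have fB: "finite B" unfolding B_def by (rule finite_negative[OF p(1)])
  have zpos: "0 < z t" if "t \<in> B" for t
  proof -
    have "t \<in> R" "ev (rt t) p < 0" using that by (simp_all add: B_def)
    then show ?thesis unfolding z_def using rt(3)[of t] by (intro divide_pos_pos) simp_all
  qed
  \<comment> \<open>The inserted \<open>1\<close> keeps \<open>Min\<close> meaningful when no mirror
    separates \<open>p\<close> from \<open>x0\<close>, and bounds \<open>M\<close> by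
    \<open>1\<close>. Half of \<open>M\<close> then lies strictly before every crossing
    parameter.\<close>
  define M where "M = Min (insert 1 (z ` B))"
  have fin: "finite (insert 1 (z ` B))" using fB by simp
  have "M \<in> insert 1 (z ` B)" unfolding M_def by (intro Min_in fin) simp
  then have M0: "0 < M" using zpos by auto
  have M1: "M \<le> 1" unfolding M_def by (intro Min_le fin) simp
  have Mz: "M \<le> z t" if "t \<in> B" for t unfolding M_def by (intro Min_le fin) (use that in simp)
  define e where "e = M / 2"
  have e: "0 < e" "e < 1" unfolding e_def using M0 M1 by simp_all
  have ez: "e < z t" if "t \<in> B" for t using Mz[OF that] M0 unfolding e_def by linarith
  have nz: "ev (rt t) (q u) \<noteq> 0" if t: "t \<in> R" and u: "0 < u" "u \<le> e" for t u
  proof (cases "t \<in> B")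
    case True
    have neg: "ev (rt t) p < 0" using True by (simp add: B_def)
    have d: "0 < ev (rt t) x0 - ev (rt t) p" using neg rt(3)[OF t] by simp
    have "u < z t" using ez[OF True] u by simp
    then have "u * (ev (rt t) x0 - ev (rt t) p) < - ev (rt t) p"
      unfolding z_def by (simp only: pos_less_divide_eq[OF d])
    then show ?thesis unfolding ev_q by (simp add: algebra_simps)
  next
    case False
    then have "0 \<le> ev (rt t) p" using t by (simp add: B_def)
    then have "0 \<le> (1 - u) * ev (rt t) p" "0 < u * ev (rt t) x0" using u e(2) rt(3)[OF t] by simp_all
    then show ?thesis unfolding ev_q by linarith
  qed
  have qp: "q u \<in> points X" if "0 \<le> u" "u \<le> 1" for u
    unfolding q_def by (rule convexD_alt[OF convex_points p(1) x0(1) that])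
  define x where "x = q e"
  have xp: "x \<in> points X" unfolding x_def using e by (intro qp) auto
  have xoff: "ev (rt t) x \<noteq> 0" if "t \<in> R" for t unfolding x_def by (rule nz[OF that e(1) order_refl])
  obtain w where w: "w \<in> generate (BG X) walls" "w x \<in> U" using to_chamber[OF xp xoff] by blast
  have w\<Gamma>: "w \<in> \<Gamma>" using walls_generate_subset w(1) by blast
  have wc: "w \<in> carrier (BG X)" by (rule \<Gamma>_carrier[OF w\<Gamma>])
  have rc: "r \<in> carrier (BG X)" by (rule R_carrier[OF r])
  have iw\<Gamma>: "iv w \<in> \<Gamma>" by (rule subgroup.m_inv_closed[OF \<Gamma>_subgroup w\<Gamma>])
  define s where "s = w \<cdot> r \<cdot> iv w"
  have sR: "s \<in> R" using conj_R(1)[OF iw\<Gamma> r] wc unfolding s_def by simp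
  have sc: "s \<in> carrier (BG X)" by (rule R_carrier[OF sR])
  have sw: "s \<cdot> w = w \<cdot> r" unfolding s_def using wc rc by (simp add: BG.m_assoc)
  have "iv w \<cdot> s \<cdot> w = iv w \<cdot> (w \<cdot> r)" using wc sc by (simp add: BG.m_assoc sw)
  also have "\<dots> = r" using wc rc by (simp add: BG.m_assoc[symmetric])
  finally have bk: "iv w \<cdot> s \<cdot> w = r" .
  have wpp: "w p \<in> points X" by (rule \<Gamma>_points[OF w\<Gamma> p(1)])
  \<comment> \<open>No mirror is met between \<open>p\<close> (exclusive) and \<open>x\<close>.
    Hence a root positive at \<open>w x\<close> cannot be negative at \<open>w p\<close>, and it
    vanishes there only for the image of the mirror of \<open>r\<close>.\<close>
  have key: "0 \<le> rt t \<bullet> hat X (w p) \<and> (rt t \<bullet> hat X (w p) = 0 \<longleftrightarrow> t = s)" if t: "t \<in> R" for t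
  proof -
    let ?r' = "iv w \<cdot> t \<cdot> w"
    have r'R: "?r' \<in> R" by (rule conj_R(1)[OF w\<Gamma> t])
    obtain l where l0: "l \<noteq> 0" and l: "\<And>y. y \<in> points X \<Longrightarrow> rt t \<bullet> hat X (w y) = l * (rt ?r' \<bullet> hat X y)"
      by (rule pullback[OF w\<Gamma> t]) blast
    define \<phi> where "\<phi> y = l * ev (rt ?r') y" for y
    have \<phi>: "rt t \<bullet> hat X (w y) = om X y * \<phi> y" if "y \<in> points X" for y
      unfolding l[OF that] unfolding inner_hat \<phi>_def by simp
    have "0 < rt t \<bullet> hat X (w x)"
      using w(2) t inner_hat_sign(2)[OF \<Gamma>_points[OF w\<Gamma> xp]] unfolding U_def by blast
    then have fx: "0 < \<phi> x" unfolding \<phi>[OF xp] using om_pos[OF xp] by (simp add: zero_less_mult_iff)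
    have fp: "0 \<le> \<phi> p"
    proof (rule ccontr)
      assume n: "\<not> 0 \<le> \<phi> p"
      have fq: "\<phi> (q u) = \<phi> p + u * (\<phi> x0 - \<phi> p)" for u unfolding \<phi>_def ev_q by (simp add: algebra_simps)
      define u where "u = - \<phi> p / (\<phi> x0 - \<phi> p)"
      have "0 < e * (\<phi> x0 - \<phi> p)" using fx n unfolding x_def fq by simp
      then have d: "0 < \<phi> x0 - \<phi> p" using e(1) by (simp add: zero_less_mult_iff)
      have "0 < u" unfolding u_def by (rule divide_pos_pos) (use n d in simp_all)
      moreover have "u \<le> e" unfolding u_def pos_divide_le_eq[OF d] using fx unfolding x_def fq by simp
      moreover have "\<phi> (q u) = 0" unfolding fq using d by (simp add: u_def)
      ultimately show False using nz[OF r'R, of u] l0 unfolding \<phi>_def by simp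
    qed
    have "t = s \<longleftrightarrow> ?r' = r"
    proof
      assume "?r' = r"
      then have "t \<cdot> w = w \<cdot> r" by (rule conj_eq[OF wc R_carrier[OF t]])
      then have "t \<cdot> w = s \<cdot> w" using sw by simp
      then show "t = s" using wc sc R_carrier[OF t] by simp
    qed (simp add: bk)
    moreover have "?r' = r \<longleftrightarrow> ev (rt ?r') p = 0" using p(2) p(3)[OF r'R] by metis
    ultimately have "t = s \<longleftrightarrow> \<phi> p = 0" unfolding \<phi>_def using l0 by simp
    then show ?thesis unfolding \<phi>[OF p(1)] using om_pos[OF p(1)] fp by simp
  qed
  have "s \<in> walls" unfolding walls_def
  proof (intro CollectI conjI bexI[of _ "w p"] ballI impI)
    show "ev (rt s) (w p) = 0" using key[OF sR] inner_hat_sign(3)[OF wpp, of "rt s"] by simp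
    fix t assume "t \<in> R" "t \<noteq> s"
    then have "0 < rt t \<bullet> hat X (w p)" using key[of t] by linarith
    then show "0 < ev (rt t) (w p)" using inner_hat_sign(2)[OF wpp] by blast
  qed (use sR wpp in simp_all)
  then have "s \<in> generate (BG X) walls" by (rule generate.incl)
  moreover have "iv w \<in> generate (BG X) walls"
    using w(1) walls_R R_carrier by (intro BG.generate_m_inv_closed) auto
  ultimately show ?thesis unfolding bk[symmetric] using w(1) by (blast intro: generate.eng)
qed

text \<open>For \<open>D_cross\<close>: if the mirror of \<open>s\<close> separates
  \<open>w x0\<close> from \<open>w (t x0)\<close>, then that of \<open>w^-1 s w\<close> separates
  \<open>x0\<close> from \<open>t x0\<close>. The reflection \<open>t\<close> in a wall crosses only
  its own mirror, so \<open>w^-1 s w = t\<close>.\<close>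

lemma half_space_system: "half_space_system (BG X) walls (\<lambda>s w. ev (rt s) (w x0) < 0)"
proof (intro half_space_system.intro half_space_system_axioms.intro)
  show "group (BG X :: ('a \<Rightarrow> 'a) monoid)" by (rule group_BG)
  show "walls \<subseteq> carrier (BG X)" using walls_R R_carrier by blast
  fix s assume s: "s \<in> walls"
  have sR: "s \<in> R" and s\<Gamma>: "s \<in> \<Gamma>" and sc: "s \<in> carrier (BG X)"
    using walls_R[OF s] R_\<Gamma> R_carrier by blast+
  show "s \<cdot> s = \<one>\<^bsub>BG X\<^esub>" by (rule reflection_square[OF R_refl[OF sR]])
  show "\<not> ev (rt s) (\<one>\<^bsub>BG X\<^esub> x0) < 0" using rt(3)[OF sR] BG_one[OF x0(1)] by simp
  fix w assume "w \<in> generate (BG X) walls"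
  then have w\<Gamma>: "w \<in> \<Gamma>" using walls_generate_subset by blast
  then have wc: "w \<in> carrier (BG X)" by (rule \<Gamma>_carrier)
  note wp = \<Gamma>_points[OF w\<Gamma> x0(1)]
  show "ev (rt s) ((s \<cdot> w) x0) < 0 \<longleftrightarrow> \<not> ev (rt s) (w x0) < 0"
  proof -
    have "ev (rt s) (w x0) \<noteq> 0" by (rule orbit_off[OF w\<Gamma> sR])
    then have "rt s \<bullet> hat X (s (w x0)) < 0 \<longleftrightarrow> \<not> ev (rt s) (w x0) < 0"
      using root_flip[OF sR wp] inner_hat_sign(2)[OF wp, of "rt s"] by auto
    then show ?thesis
      unfolding BG_mult[OF sc wc x0(1)] using inner_hat_sign(1)[OF \<Gamma>_points[OF s\<Gamma> wp], of "rt s"] by simp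
  qed
  fix t assume t: "t \<in> walls" and n: "\<not> ev (rt s) (w x0) < 0" and c: "ev (rt s) ((w \<cdot> t) x0) < 0"
  have tR: "t \<in> R" and t\<Gamma>: "t \<in> \<Gamma>" and tc: "t \<in> carrier (BG X)"
    using walls_R[OF t] R_\<Gamma> R_carrier by blast+
  let ?r = "iv w \<cdot> s \<cdot> w"
  have rR: "?r \<in> R" by (rule conj_R(1)[OF w\<Gamma> sR])
  obtain l where l: "\<And>y. y \<in> points X \<Longrightarrow> rt s \<bullet> hat X (w y) = l * (rt ?r \<bullet> hat X y)"
    by (rule pullback[OF w\<Gamma> sR]) blast
  note tp = \<Gamma>_points[OF t\<Gamma> x0(1)]
  have "0 < ev (rt s) (w x0)" using n orbit_off[OF w\<Gamma> sR] by simp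
  then have "0 < rt s \<bullet> hat X (w x0)" using inner_hat_sign(2)[OF wp] by blast
  moreover have "0 < rt ?r \<bullet> hat X x0" using rt(3)[OF rR] inner_hat_sign(2)[OF x0(1)] by blast
  ultimately have lp: "0 < l" unfolding l[OF x0(1)] by (simp add: zero_less_mult_iff)
  have "rt s \<bullet> hat X (w (t x0)) < 0"
    using c inner_hat_sign(1)[OF \<Gamma>_points[OF w\<Gamma> tp]] unfolding BG_mult[OF wc tc x0(1)] by blast
  then have "rt ?r \<bullet> hat X (t x0) < 0" unfolding l[OF tp] using lp by (simp add: mult_less_0_iff)
  then have "\<not> 0 < ev (rt ?r) (t x0)" using inner_hat_sign(1)[OF tp, of "rt ?r"] by simp
  then have "?r = t" using wall_cross[OF t rR] by blast
  then show "s \<cdot> w = w \<cdot> t" by (rule conj_eq[OF wc sc])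
qed

text \<open>In the hyperbolic case \<open>sharp\<close> is injective, and distinct mirrors have
  independent roots. In the Euclidean case dependence means parallel mirrors; as both are walls, the
  chamber lies in the strip between them (\<open>c < 0 < e\<close>), and no point \<open>y\<close>
  is beyond both.\<close>

lemma walls_independent:
  assumes s: "s \<in> walls" and t: "t \<in> walls" and st: "s \<noteq> t"
    and y: "y \<in> points X" "ev (rt s) y < 0" "ev (rt t) y < 0"
  shows "\<nexists>c. sharp X (rt s) = c *\<^sub>R sharp X (rt t)"
proof
  assume "\<exists>c. sharp X (rt s) = c *\<^sub>R sharp X (rt t)"
  then obtain c where c: "sharp X (rt s) = c *\<^sub>R sharp X (rt t)" by blast
  have R: "s \<in> R" "t \<in> R" using s t walls_R by blast+
  show False
  proof (cases X)
    case Hyperbolic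
    then have "rt s = c *\<^sub>R rt t" using c by (auto simp: sharp_def prod_eq_iff)
    then show False using root_inj[OF R] st by blast
  next
    case Euclidean
    then have f: "fst (rt s) = c *\<^sub>R fst (rt t)" using c by (simp add: sharp_def prod_eq_iff)
    define e where "e = snd (rt s) - c * snd (rt t)"
    have ev: "ev (rt s) x = c * ev (rt t) x + e" for x
      unfolding inner_lift f e_def by (simp add: algebra_simps)
    obtain p where "ev (rt s) p = 0" "\<forall>r\<in>R. r \<noteq> s \<longrightarrow> 0 < ev (rt r) p" using s unfolding walls_def by blast
    then have p: "ev (rt s) p = 0" "0 < ev (rt t) p" using R(2) st by simp_all
    obtain p' where "ev (rt t) p' = 0" "\<forall>r\<in>R. r \<noteq> t \<longrightarrow> 0 < ev (rt r) p'" using t unfolding walls_def by blast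
    then have p': "ev (rt t) p' = 0" "0 < ev (rt s) p'" using R(1) st by simp_all
    have e: "0 < e" using ev[of p'] p' by simp
    have "c * ev (rt t) p < 0" using ev[of p] p(1) e by simp
    then have "c < 0" using p(2) by (simp add: mult_less_0_iff)
    then have "0 < c * ev (rt t) y" using y(3) by (rule mult_neg_neg)
    then show False using ev[of y] y(2) e by simp
  qed
qed

section \<open>Walls correspond to facets of the chamber\<close>

lemma ev_hyperplane: "{x. ev \<alpha> x = 0} = {x. fst \<alpha> \<bullet> x = - snd \<alpha>}"
  by (auto simp: inner_lift eq_neg_iff_add_eq_0)

lemma aff_dim_chamber: "aff_dim chamber = int DIM('a)"
proof -
  have "aff_dim U = int DIM('a)" using open_U x0_U by (intro aff_dim_open) auto
  then show ?thesis using aff_dim_subset[OF U_chamber] aff_dim_le_DIM[of chamber] by simp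
qed

lemma root_face:
  assumes s: "s \<in> R"
  shows "chamber \<inter> {x. ev (rt s) x = 0} face_of chamber"
    and "aff_dim (chamber \<inter> {x. ev (rt s) x = 0}) \<le> int DIM('a) - 1"
proof -
  have "- snd (rt s) \<le> fst (rt s) \<bullet> x" if "x \<in> chamber" for x
    using that s unfolding chamber_def inner_lift by force
  then show "chamber \<inter> {x. ev (rt s) x = 0} face_of chamber"
    unfolding ev_hyperplane by (intro face_of_Int_supporting_hyperplane_ge convex_chamber)
  have "aff_dim (chamber \<inter> {x. ev (rt s) x = 0}) \<le> aff_dim {x. ev (rt s) x = 0}"
    by (intro aff_dim_subset) blast
  also have "\<dots> = int DIM('a) - 1" unfolding ev_hyperplane using rt(1)[OF s] by simp
  finally show "aff_dim (chamber \<inter> {x. ev (rt s) x = 0}) \<le> int DIM('a) - 1" .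
qed

text \<open>Near the point that makes \<open>s\<close> a wall, the whole mirror belongs to the
  chamber, which gives the face its full dimension.\<close>

lemma wall_facet:
  assumes s: "s \<in> walls"
  shows "chamber \<inter> {x. ev (rt s) x = 0} facet_of chamber"
proof -
  let ?H = "{x. ev (rt s) x = 0}"
  have sR: "s \<in> R" by (rule walls_R[OF s])
  obtain p where p: "p \<in> points X" "ev (rt s) p = 0" "\<And>t. t \<in> R - {s} \<Longrightarrow> 0 < ev (rt t) p"
    using s unfolding walls_def by blast
  obtain e where e: "e > 0" "ball p e \<subseteq> points X" "\<forall>t\<in>R - {s}. \<forall>x\<in>ball p e. 0 < ev (rt t) x"
    using positive_near[OF p(1) Diff_subset p(3)] by blast
  have sub: "?H \<inter> ball p e \<subseteq> chamber \<inter> ?H"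
  proof
    fix x assume x: "x \<in> ?H \<inter> ball p e"
    have "0 \<le> ev (rt t) x" if t: "t \<in> R" for t
    proof (cases "t = s")
      case False
      then have "0 < ev (rt t) x" using t x e(3) by blast
      then show ?thesis by simp
    qed (use x in simp)
    then show "x \<in> chamber \<inter> ?H" unfolding chamber_def using x e(2) by blast
  qed
  have pin: "p \<in> ?H \<inter> ball p e" using p(2) e(1) by simp
  have "convex ?H" unfolding ev_hyperplane by (rule convex_hyperplane)
  then have "aff_dim (?H \<inter> ball p e) = aff_dim ?H" using pin by (intro aff_dim_convex_Int_open) auto
  also have "\<dots> = int DIM('a) - 1" unfolding ev_hyperplane using rt(1)[OF sR] by simp
  finally have "int DIM('a) - 1 \<le> aff_dim (chamber \<inter> ?H)" using aff_dim_subset[OF sub] by simp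
  then show ?thesis unfolding facet_of_def aff_dim_chamber using root_face[OF sR] sub pin by auto
qed

lemma wall_facet_inj:
  assumes s: "s \<in> walls" and t: "t \<in> walls"
    and eq: "chamber \<inter> {x. ev (rt s) x = 0} = chamber \<inter> {x. ev (rt t) x = 0}"
  shows "s = t"
proof (rule ccontr)
  assume n: "s \<noteq> t"
  obtain p where p: "p \<in> points X" "ev (rt s) p = 0" "\<And>t. t \<in> R \<Longrightarrow> t \<noteq> s \<Longrightarrow> 0 < ev (rt t) p"
    using s unfolding walls_def by blast
  have "0 \<le> ev (rt r) p" if "r \<in> R" for r using p(2) p(3)[OF that] by (cases "r = s") simp_all
  then have "p \<in> chamber \<inter> {x. ev (rt s) x = 0}" unfolding chamber_def using p(1,2) by blast
  then have "ev (rt t) p = 0" unfolding eq by blast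
  then show False using p(3)[OF walls_R[OF t]] n by simp
qed

text \<open>A facet misses the open chamber, so some root vanishes at a point \<open>p\<close> of
  it. If \<open>p\<close> is generic in a relatively open piece \<open>K\<close> of the facet,
  exactly one root vanishes there, and \<open>p\<close> is a witness that it belongs to a
  wall.\<close>

lemma facet_wall:
  assumes F: "F facet_of chamber"
  shows "\<exists>s\<in>walls. F = chamber \<inter> {x. ev (rt s) x = 0}"
proof -
  have Ff: "F face_of chamber" "F \<noteq> {}" "aff_dim F = int DIM('a) - 1"
    using F unfolding facet_of_def aff_dim_chamber by blast+
  have cF: "convex F" by (rule face_of_imp_convex[OF Ff(1)])
  have FC: "F \<subseteq> chamber" by (rule face_of_imp_subset[OF Ff(1)])
  have "F \<noteq> chamber" using Ff(3) aff_dim_chamber by auto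
  then have "F \<inter> interior chamber = {}" by (rule face_of_disjoint_interior[OF Ff(1)])
  then have FU: "F \<inter> U = {}" using interior_maximal[OF U_chamber open_U] by blast
  obtain x where x: "x \<in> F" using Ff(2) by blast
  then have xp: "x \<in> points X" using FC unfolding chamber_def by blast
  obtain e where e: "e > 0" "ball x e \<subseteq> points X" "finite {t \<in> R. mirror X t \<inter> ball x e \<noteq> {}}"
    using local_ball[OF xp] by blast
  define K where "K = F \<inter> ball x e"
  have xK: "x \<in> K" unfolding K_def using x e(1) by simp
  have cK: "convex K" unfolding K_def by (intro convex_Int cF convex_ball)
  have KF: "K \<subseteq> F" unfolding K_def by blast
  have dK: "aff_dim K = aff_dim F" unfolding K_def using xK by (intro aff_dim_convex_Int_open cF) (auto simp: K_def)
  then have hull: "affine hull K = affine hull F" using aff_dim_eq_full_gen[OF KF] by blast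
  define A where "A = {\<gamma> \<in> rt ` {t \<in> R. mirror X t \<inter> ball x e \<noteq> {}}. \<exists>y\<in>K. ev \<gamma> y \<noteq> 0}"
  have "finite A" unfolding A_def using e(3) by simp
  moreover have "\<And>\<gamma>. \<gamma> \<in> A \<Longrightarrow> \<exists>y\<in>K. ev \<gamma> y \<noteq> 0" unfolding A_def by blast
  moreover have "K \<noteq> {}" using xK by blast
  ultimately obtain p where p: "p \<in> K" "\<forall>\<gamma>\<in>A. ev \<gamma> p \<noteq> 0" using generic_point[OF _ cK] by metis
  have pF: "p \<in> F" "p \<in> ball x e" using p(1) unfolding K_def by blast+
  have pc: "p \<in> points X" "\<And>t. t \<in> R \<Longrightarrow> 0 \<le> ev (rt t) p"
    using FC pF(1) unfolding chamber_def by blast+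
  have "p \<notin> U" using FU pF(1) by blast
  then obtain s where s: "s \<in> R" "ev (rt s) p = 0" using pc unfolding U_def by force
  have vanish: "ev (rt t) y = 0" if t: "t \<in> R" "ev (rt t) p = 0" and y: "y \<in> K" for t y
  proof (rule ccontr)
    assume n: "ev (rt t) y \<noteq> 0"
    have "p \<in> mirror X t" unfolding rt(2)[OF t(1)] using pc(1) t(2) by simp
    then have "rt t \<in> A" unfolding A_def using t(1) pF(2) n y by blast
    then show False using p(2) t(2) by blast
  qed
  \<comment> \<open>Roots vanishing at \<open>p\<close> vanish on \<open>K\<close> by genericity. As
    \<open>K\<close> has codimension one, its affine hull is the hyperplane of each such root, and
    so there is only one.\<close>
  have span: "affine hull K = {y. ev (rt t) y = 0}" if t: "t \<in> R" "ev (rt t) p = 0" for t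
  proof (rule affine_dim_equal)
    show aff: "affine {y. ev (rt t) y = 0}" unfolding ev_hyperplane by (rule affine_hyperplane)
    show "affine hull K \<subseteq> {y. ev (rt t) y = 0}"
      using vanish[OF t] by (intro hull_minimal aff) blast
    show "aff_dim (affine hull K) = aff_dim {y. ev (rt t) y = 0}"
      using dK Ff(3) rt(1)[OF t(1)] unfolding ev_hyperplane by simp
    show "affine hull K \<noteq> {}" using xK by auto
  qed (rule affine_affine_hull)
  have uniq: "t = s" if t: "t \<in> R" "ev (rt t) p = 0" for t
  proof -
    have eq: "{y. ev (rt t) y = 0} = {y. ev (rt s) y = 0}" using span[OF t] span[OF s] by simp
    have "ev (rt t) y = 0" if "y \<in> UNIV" "ev (rt s) y = 0" for y using that eq by blast
    then obtain l where "rt t = l *\<^sub>R rt s"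
      by (rule functional_vanishing_on_hyperplane[OF rt(1)[OF s(1)] open_UNIV UNIV_I s(2)])
    then show "t = s" by (rule root_inj[OF t(1) s(1)])
  qed
  have "0 < ev (rt t) p" if "t \<in> R" "t \<noteq> s" for t using pc(2)[OF that(1)] uniq[OF that(1)] that(2) by force
  then have sw: "s \<in> walls" unfolding walls_def using s pc(1) by blast
  let ?F = "chamber \<inter> {x. ev (rt s) x = 0}"
  have "F \<subseteq> affine hull F" by (rule hull_subset)
  then have sub: "F \<subseteq> ?F" using FC hull span[OF s] by blast
  have "F face_of ?F" by (rule face_of_subset[OF Ff(1) sub]) blast
  then have "F = ?F"
    using face_of_aff_dim_lt[OF face_of_imp_convex[OF root_face(1)[OF s(1)]]] root_face(2)[OF s(1)] Ff(3) by fastforce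
  then show ?thesis using sw by blast
qed

end

section \<open>The cone over a chamber of finite volume\<close>

text \<open>Continuity from above. Both volume arguments exhibit sets escaping to infinity or to the
  sphere that retain a fixed amount of measure.\<close>

lemma no_escaping_mass:
  fixes A :: "nat \<Rightarrow> 'b set"
  assumes "\<And>k. A k \<in> sets M" "decseq A" "(\<Inter>k. A k) = {}" "emeasure M (A 0) \<noteq> \<infinity>"
    and "0 < b" "\<And>k. b \<le> emeasure M (A k)"
  shows False
proof -
  have "emeasure M (A k) \<noteq> \<infinity>" for k
    using emeasure_mono[of "A k" "A 0" M] assms(1,4) decseqD[OF assms(2), of 0 k] by (auto simp: top_unique)
  then have "(\<lambda>k. emeasure M (A k)) \<longlonglongrightarrow> emeasure M (\<Inter>k. A k)"
    using assms(1,2) by (intro Lim_emeasure_decseq) auto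
  then have "(\<lambda>k. emeasure M (A k)) \<longlonglongrightarrow> 0" using assms(3) by simp
  then have "b \<le> 0" by (rule LIMSEQ_le_const) (use assms(6) in blast)
  then show False using assms(5) by simp
qed

text \<open>
  The shells \<open>1 - \<delta> \<le> norm x < 1\<close> of a cone around \<open>p\<close> have Lebesgue measure of order \<open>\<delta>\<close>, and the
  hyperbolic density there is at least of order \<open>1 / \<delta>\<close>.
\<close>

lemma hyperbolic_cap_infinite:
  fixes p :: "'a::euclidean_space"
  assumes p: "norm p = 1" and r: "0 < r"
  shows "emeasure (volume Hyperbolic) (ball p r \<inter> ball 0 1) = \<infinity>"
proof (rule ccontr)
  assume fin: "emeasure (volume Hyperbolic) (ball p r \<inter> ball 0 1) \<noteq> \<infinity>"
  \<comment> \<open>An open cone, invariant under positive scaling, of directions close to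
    \<open>p\<close>.\<close>
  define W where "W = {x::'a. norm (x - norm x *\<^sub>R p) < r / 2 * norm x}"
  define V where "V = W \<inter> ball 0 1"
  define f where "f x = (1 - x \<bullet> x) powr (- (real DIM('a) + 1) / 2)" for x :: 'a
  have vol: "volume Hyperbolic = density lborel (\<lambda>x::'a. indicator (ball 0 1) x * ennreal (f x))"
    by (simp add: f_def)
  have oW: "open W" unfolding W_def by (intro open_Collect_less continuous_intros)
  have oV: "open V" unfolding V_def using oW by blast
  have pV: "(1/2) *\<^sub>R p \<in> V" unfolding V_def W_def using p r by simp
  define m where "m = measure lebesgue V"
  have Vf: "V \<in> lmeasurable" unfolding V_def
    by (intro bounded_set_imp_lmeasurable bounded_Int) (use oW in auto)
  have m: "0 < m"
  proof -
    obtain e where e: "0 < e" "ball ((1/2) *\<^sub>R p) e \<subseteq> V" using openE[OF oV pV] by blast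
    have "0 < measure lebesgue (ball ((1/2) *\<^sub>R p) e)" using content_ball_pos[OF e(1)] by simp
    also have "\<dots> \<le> m" unfolding m_def by (intro measure_mono_fmeasurable e(2) Vf) simp
    finally show ?thesis .
  qed
  \<comment> \<open>The widths of the shells. The bound \<open>r / 2\<close> keeps a shell in
    \<open>ball p r\<close>; the bound \<open>1 / 2\<close> keeps \<open>1 - d k\<close> positive
    and \<open>1 - x \<bullet> x\<close> at most \<open>1\<close>.\<close>
  define d where "d k = min (r / 2) (1 / 2) / real (Suc k)" for k :: nat
  have d: "0 < d k" "d k \<le> r / 2" "d k \<le> 1 / 2" for k
  proof -
    have q: "0 < min (r / 2) (1 / 2)" using r by simp
    then show "0 < d k" unfolding d_def by simp
    have "d k \<le> min (r / 2) (1 / 2) / 1" unfolding d_def using q by (intro divide_left_mono) simp_all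
    then show "d k \<le> r / 2" "d k \<le> 1 / 2" by simp_all
  qed
  define A where "A k = V \<inter> {x. 1 - d k \<le> norm x}" for k
  have A_borel: "A k \<in> sets borel" for k unfolding A_def
    by (intro sets.Int borel_open oV borel_closed closed_Collect_le continuous_intros)
  have A_cap: "A k \<subseteq> ball p r \<inter> ball 0 1" for k
  proof
    fix x assume x: "x \<in> A k"
    then have n: "norm x < 1" "1 - d k \<le> norm x" and w: "norm (x - norm x *\<^sub>R p) < r / 2 * norm x"
      unfolding A_def V_def W_def by simp_all
    have "norm (x - p) \<le> norm (x - norm x *\<^sub>R p) + norm (norm x *\<^sub>R p - p)"
      using norm_triangle_ineq[of "x - norm x *\<^sub>R p" "norm x *\<^sub>R p - p"] by simp
    also have "norm (norm x *\<^sub>R p - p) = 1 - norm x"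
    proof -
      have "norm x *\<^sub>R p - p = (norm x - 1) *\<^sub>R p" by (simp add: algebra_simps)
      then show ?thesis using p n(1) by simp
    qed
    also have "norm (x - norm x *\<^sub>R p) + (1 - norm x) < r / 2 * norm x + d k" using w n(2) by linarith
    also have "\<dots> \<le> r / 2 * 1 + r / 2" using n(1) r d(2) by (intro add_mono mult_left_mono) simp_all
    finally show "x \<in> ball p r \<inter> ball 0 1" using n(1) by (simp add: dist_norm norm_minus_commute)
  qed
  have A_measure: "m * d k \<le> measure lebesgue (A k)" for k
  proof -
    define c where "c = 1 - d k"
    have c: "0 < c" "c < 1" using d[of k] unfolding c_def by simp_all
    \<comment> \<open>Scaling \<open>V\<close> by \<open>c\<close> gives its part of norm below
      \<open>c\<close>, of measure \<open>c ^ DIM('a) * m\<close>. This is at most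
      \<open>c * m\<close>, so the shell has measure at least \<open>m * d k\<close>.\<close>
    have img: "(\<lambda>x. c *\<^sub>R x + 0) ` V = W \<inter> ball 0 c"
    proof
      show "(\<lambda>x. c *\<^sub>R x + 0) ` V \<subseteq> W \<inter> ball 0 c"
      proof
        fix y assume "y \<in> (\<lambda>x. c *\<^sub>R x + 0) ` V"
        then obtain x where x: "x \<in> V" "y = c *\<^sub>R x" by auto
        have ny: "norm y = c * norm x" using x(2) c by simp
        have "y - norm y *\<^sub>R p = c *\<^sub>R (x - norm x *\<^sub>R p)" unfolding ny unfolding x(2) by (simp add: algebra_simps)
        then have "norm (y - norm y *\<^sub>R p) = c * norm (x - norm x *\<^sub>R p)" using c by simp
        also have "\<dots> < c * (r / 2 * norm x)"
          using x(1) c unfolding V_def W_def by (intro mult_strict_left_mono) auto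
        also have "\<dots> = r / 2 * norm y" unfolding ny by simp
        finally have "y \<in> W" unfolding W_def by blast
        moreover have "norm y < c" using x(1) c unfolding ny V_def by simp
        ultimately show "y \<in> W \<inter> ball 0 c" by simp
      qed
      show "W \<inter> ball 0 c \<subseteq> (\<lambda>x. c *\<^sub>R x + 0) ` V"
      proof
        fix x assume x: "x \<in> W \<inter> ball 0 c"
        define y where "y = (1 / c) *\<^sub>R x"
        have xy: "x = c *\<^sub>R y" unfolding y_def using c by simp
        have nx: "norm x = c * norm y" unfolding xy using c by simp
        have "c *\<^sub>R y - norm x *\<^sub>R p = c *\<^sub>R (y - norm y *\<^sub>R p)" unfolding nx by (simp add: algebra_simps)
        then have "norm (x - norm x *\<^sub>R p) = c * norm (y - norm y *\<^sub>R p)" using c xy by simp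
        then have "c * norm (y - norm y *\<^sub>R p) = norm (x - norm x *\<^sub>R p)" by (rule sym)
        also have "\<dots> < r / 2 * norm x" using x unfolding W_def by blast
        also have "\<dots> = c * (r / 2 * norm y)" unfolding nx by simp
        finally have "c * norm (y - norm y *\<^sub>R p) < c * (r / 2 * norm y)" .
        then have "norm (y - norm y *\<^sub>R p) < r / 2 * norm y" using c by (simp only: mult_less_cancel_left_pos)
        moreover have "norm y < 1"
        proof -
          have "c * norm y < c * 1" using x nx by simp
          then show ?thesis using c by (simp only: mult_less_cancel_left_pos)
        qed
        ultimately have "y \<in> V" unfolding V_def W_def by simp
        then show "x \<in> (\<lambda>x. c *\<^sub>R x + 0) ` V" using xy by (intro image_eqI[of _ _ y]) simp_all
      qed
    qed
    have "measure lebesgue ((\<lambda>x. c *\<^sub>R x + 0) ` V) = \<bar>c\<bar> ^ DIM('a) * m"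
      unfolding m_def using measure_lebesgue_affine[of c 0 V] by (simp add: add.commute)
    then have s: "measure lebesgue (W \<inter> ball 0 c) = c ^ DIM('a) * m" unfolding img using c by simp
    have "c ^ DIM('a) \<le> c ^ 1" using c by (intro power_decreasing) (auto simp: Suc_leI)
    then have "c ^ DIM('a) * m \<le> c * m" using m by (intro mult_right_mono) simp_all
    moreover have "measure lebesgue (V - (W \<inter> ball 0 c)) = measure lebesgue V - measure lebesgue (W \<inter> ball 0 c)"
    proof (rule measurable_measure_Diff[OF Vf])
      show "W \<inter> ball 0 c \<in> sets lebesgue" using oW by (intro sets_completionI_sets) auto
      show "W \<inter> ball 0 c \<subseteq> V" unfolding V_def using c by auto
    qed
    moreover have "V - (W \<inter> ball 0 c) = A k" unfolding A_def V_def c_def by auto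
    ultimately show ?thesis using s unfolding m_def[symmetric] c_def by (simp add: algebra_simps)
  qed
  have A_vol: "ennreal (m / 2) \<le> emeasure (volume Hyperbolic) (A k)" for k
  proof -
    have lower: "ennreal (1 / (2 * d k)) * indicator (A k) x
        \<le> (indicator (ball 0 1) x * ennreal (f x)) * indicator (A k) x" for x
    proof (cases "x \<in> A k")
      case True
      then have n: "norm x < 1" "1 - d k \<le> norm x" unfolding A_def V_def by simp_all
      define t where "t = 1 - x \<bullet> x"
      have t: "t = (1 - norm x) * (1 + norm x)"
        unfolding t_def by (simp add: power2_norm_eq_inner[symmetric] power2_eq_square algebra_simps)
      have t0: "0 < t" unfolding t using n(1) by (intro mult_pos_pos) (simp_all add: add_pos_nonneg)
      have "t \<le> d k * 2" unfolding t using n by (intro mult_mono) simp_all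
      then have t2: "t \<le> 2 * d k" "t \<le> 1" using d(3)[of k] by simp_all
      have "1 / (2 * d k) \<le> 1 / t" using t0 t2 by (intro divide_left_mono) simp_all
      also have "\<dots> = t powr (- 1)" using t0 by (simp add: powr_minus_divide)
      \<comment> \<open>As the dimension is at least one, the exponent is at most \<open>-1\<close>,
        and \<open>t \<le> 1\<close> makes the power larger.\<close>
      also have "\<dots> \<le> t powr (- (real DIM('a) + 1) / 2)"
      proof (rule powr_mono')
        have "1 \<le> DIM('a)" by (simp add: Suc_leI)
        then show "- (real DIM('a) + 1) / 2 \<le> - 1" by simp
      qed (use t0 t2 in simp_all)
      finally have "1 / (2 * d k) \<le> f x" unfolding f_def t_def .
      then show ?thesis using True n(1) by (simp add: ennreal_leI)
    qed simp
    have "ennreal (m / 2) \<le> ennreal (1 / (2 * d k) * measure lebesgue (A k))"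
    proof (rule ennreal_leI)
      have "m / 2 = 1 / (2 * d k) * (m * d k)" using d(1)[of k] by simp
      also have "\<dots> \<le> 1 / (2 * d k) * measure lebesgue (A k)"
        using A_measure[of k] d(1)[of k] by (intro mult_left_mono) simp_all
      finally show "m / 2 \<le> 1 / (2 * d k) * measure lebesgue (A k)" .
    qed
    also have "\<dots> = ennreal (1 / (2 * d k)) * emeasure lborel (A k)"
    proof -
      have fm: "A k \<in> lmeasurable" using A_borel[of k] A_cap[of k]
        by (intro bounded_set_imp_lmeasurable) (auto intro: bounded_subset[OF bounded_ball])
      have "emeasure lborel (A k) = emeasure lebesgue (A k)" using A_borel[of k] by simp
      also have "\<dots> = ennreal (measure lebesgue (A k))" using fm by (simp add: emeasure_eq_measure2)
      finally have em: "emeasure lborel (A k) = ennreal (measure lebesgue (A k))" .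
      show ?thesis unfolding em by (rule ennreal_mult) (use d(1)[of k] in simp_all)
    qed
    also have "\<dots> = (\<integral>\<^sup>+x. ennreal (1 / (2 * d k)) * indicator (A k) x \<partial>lborel)"
      using A_borel[of k] by (simp add: nn_integral_cmult_indicator)
    also have "\<dots> \<le> (\<integral>\<^sup>+x. (indicator (ball 0 1) x * ennreal (f x)) * indicator (A k) x \<partial>lborel)"
      by (rule nn_integral_mono) (rule lower)
    also have "\<dots> = emeasure (volume Hyperbolic) (A k)"
      unfolding vol
    proof (rule emeasure_density[symmetric])
      have [measurable]: "ball (0::'a) 1 \<in> sets borel" by simp
      show "(\<lambda>x::'a. indicator (ball 0 1) x * ennreal (f x)) \<in> borel_measurable lborel"
        unfolding f_def by measurable
      show "A k \<in> sets lborel" using A_borel by simp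
    qed
    finally show ?thesis .
  qed
  show False
  proof (rule no_escaping_mass[of A "volume Hyperbolic" "ennreal (m / 2)"])
    show "A k \<in> sets (volume Hyperbolic)" for k using A_borel by simp
    show "decseq A"
    proof (rule decseq_SucI)
      fix k
      have "d (Suc k) \<le> d k" unfolding d_def using r by (intro divide_left_mono) simp_all
      then show "A (Suc k) \<subseteq> A k" unfolding A_def by auto
    qed
    show "(\<Inter>k. A k) = {}"
    proof (rule ccontr)
      assume "(\<Inter>k. A k) \<noteq> {}"
      then obtain x where x: "\<And>k. x \<in> A k" by blast
      then have n: "norm x < 1" using x[of 0] unfolding A_def V_def by simp
      obtain k where k: "inverse (real (Suc k)) < 1 - norm x" using reals_Archimedean[of "1 - norm x"] n by auto
      have "d k \<le> 1 / real (Suc k)" unfolding d_def by (intro divide_right_mono) simp_all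
      then have "d k < 1 - norm x" using k by (simp add: inverse_eq_divide)
      then show False using x[of k] unfolding A_def by simp
    qed
    have "emeasure (volume Hyperbolic) (A 0) \<le> emeasure (volume Hyperbolic) (ball p r \<inter> ball 0 1)"
      by (rule emeasure_mono[OF A_cap]) simp
    then show "emeasure (volume Hyperbolic) (A 0) \<noteq> \<infinity>" using fin by (auto simp: top_unique)
    show "0 < ennreal (m / 2)" using m by simp
  qed (rule A_vol)
qed

section \<open>Vectors pairing nonnegatively with all walls of a chamber of finite volume\<close>

context mirror_system begin

lemma chamberI:
  assumes "x \<in> points X" "\<And>s. s \<in> walls \<Longrightarrow> 0 \<le> ev (rt s) x"
  shows "x \<in> chamber"
proof (rule ccontr)
  assume "x \<notin> chamber"
  then obtain s where "s \<in> R" "ev (rt s) x < 0" using assms(1) unfolding chamber_def by force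
  then show False using separating_wall[OF assms(1)] assms(2) by force
qed

lemma chamber_borel: "chamber \<in> sets borel"
  unfolding closure_U[symmetric] by (intro sets.Int borel_open borel_closed open_points closed_closure)

text \<open>If \<open>(z, \<tau>)\<close> were outside the closed forward light cone, the ray from
  \<open>(x, 1)\<close> in its direction would leave that cone above a point \<open>p\<close> of the
  sphere. A whole neighbourhood of \<open>p\<close> in the ball would then belong to the chamber,
  and its volume is infinite.\<close>

lemma finite_volume_cone_hyperbolic:
  assumes X: "X = Hyperbolic" and fin: "emeasure (volume X) chamber \<noteq> \<infinity>"
    and cone: "\<And>s. s \<in> walls \<Longrightarrow> 0 \<le> rt s \<bullet> (z, \<tau>)"
  shows "norm z \<le> \<tau>"
proof (rule ccontr)
  assume n: "\<not> norm z \<le> \<tau>"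
  \<comment> \<open>This choice keeps the exit point of the ray away from the apex of the cone:
    \<open>c = 0\<close> below would force \<open>z = \<tau> *\<^sub>R x\<close>.\<close>
  obtain x where x: "x \<in> U" "z \<noteq> \<tau> *\<^sub>R x"
  proof (cases "z = \<tau> *\<^sub>R x0")
    case False
    then show ?thesis using that x0_U by blast
  next
    case True
    then have t: "\<tau> \<noteq> 0" using n by auto
    have "U \<noteq> {x0}" using open_U not_open_singleton by metis
    then obtain x where "x \<in> U" "x \<noteq> x0" using x0_U by blast
    then show ?thesis using that True t by simp
  qed
  have "x \<in> points X" using x(1) unfolding U_def by blast
  then have xp: "norm x < 1" using X by simp
  define h where "h t = (1 + t * \<tau>) - norm (x + t *\<^sub>R z)" for t
  \<comment> \<open>By the triangle inequality the ray has left the cone by the parameter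
    \<open>T\<close>, so the intermediate value theorem gives an exit parameter.\<close>
  define T where "T = (1 + norm x) / (norm z - \<tau>)"
  have T: "0 \<le> T" unfolding T_def using n by simp
  have "norm (T *\<^sub>R z) \<le> norm (x + T *\<^sub>R z) + norm x"
    using norm_triangle_ineq4[of "x + T *\<^sub>R z" x] by simp
  moreover have "T * (norm z - \<tau>) = 1 + norm x" unfolding T_def using n by simp
  ultimately have hT: "h T \<le> 0" unfolding h_def using T by (simp add: algebra_simps)
  have "continuous_on {0..T} h" unfolding h_def by (intro continuous_intros)
  then obtain t where t: "0 \<le> t" "h t = 0" using IVT2'[of h T 0 0] hT T xp unfolding h_def by auto
  define c where "c = 1 + t * \<tau>"
  have nc: "norm (x + t *\<^sub>R z) = c" using t(2) unfolding h_def c_def by simp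
  have c: "0 < c"
  proof (rule ccontr)
    assume "\<not> 0 < c"
    then have c0: "c = 0" using nc norm_ge_zero[of "x + t *\<^sub>R z"] by linarith
    then have e: "x = - (t *\<^sub>R z)" using nc by (simp add: eq_neg_iff_add_eq_0)
    have "\<tau> *\<^sub>R x = - ((t * \<tau>) *\<^sub>R z)" unfolding e by (simp add: mult.commute)
    also have "t * \<tau> = - 1" using c0 unfolding c_def by simp
    finally show False using x(2) by simp
  qed
  define p where "p = (1 / c) *\<^sub>R (x + t *\<^sub>R z)"
  have p: "norm p = 1" unfolding p_def using c nc by simp
  obtain e where e: "0 < e" "ball x e \<subseteq> U" using openE[OF open_U x(1)] by blast
  have "ball p (e / c) \<inter> ball 0 1 \<subseteq> chamber"
  proof
    fix q assume q: "q \<in> ball p (e / c) \<inter> ball 0 1"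
    define x' where "x' = c *\<^sub>R q - t *\<^sub>R z"
    have "x - x' = c *\<^sub>R (p - q)" unfolding x'_def p_def using c by (simp add: algebra_simps)
    then have "dist x x' = c * dist p q" using c by (simp add: dist_norm)
    also have "\<dots> < e" using q c by (simp add: pos_less_divide_eq mult.commute)
    finally have x': "x' \<in> U" using e(2) by auto
    show "q \<in> chamber"
    proof (rule chamberI)
      show "q \<in> points X" using q X by simp
      fix s assume s: "s \<in> walls"
      have "c *\<^sub>R (q, 1) = (x', 1) + t *\<^sub>R (z, \<tau>)" unfolding x'_def c_def by simp
      then have "rt s \<bullet> (c *\<^sub>R (q, 1)) = ev (rt s) x' + t * (rt s \<bullet> (z, \<tau>))"
        by (simp only: inner_add_right inner_scaleR_right)
      moreover have "0 < ev (rt s) x'" using x' walls_R[OF s] unfolding U_def by blast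
      moreover have "0 \<le> t * (rt s \<bullet> (z, \<tau>))" using t(1) cone[OF s] by simp
      ultimately have "0 \<le> c * ev (rt s) q" by (simp only: inner_scaleR_right)
      then show "0 \<le> ev (rt s) q" using c by (simp only: zero_le_mult_iff) linarith
    qed
  qed
  then have "emeasure (volume X) (ball p (e / c) \<inter> ball 0 1) \<le> emeasure (volume X) chamber"
    using chamber_borel X by (intro emeasure_mono) auto
  moreover have "emeasure (volume X) (ball p (e / c) \<inter> ball 0 1) = \<infinity>"
    unfolding X using hyperbolic_cap_infinite[OF p] e(1) c by simp
  ultimately show False using fin by (simp add: top_unique)
qed

text \<open>Such a \<open>z\<close> is a recession direction: translates along \<open>z\<close> of a
  ball inside the chamber stay in the chamber, so unless \<open>z = 0\<close> its part beyond any
  level of \<open>z\<close> keeps the volume of that ball.\<close>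

lemma finite_volume_cone_euclidean:
  assumes X: "X = Euclidean" and fin: "emeasure (volume X) chamber \<noteq> \<infinity>"
    and cone: "\<And>s. s \<in> walls \<Longrightarrow> 0 \<le> rt s \<bullet> (z, 0)"
  shows "z = 0"
proof (rule ccontr)
  assume z: "z \<noteq> 0"
  obtain e where e: "0 < e" "ball x0 e \<subseteq> U" using openE[OF open_U x0_U] by blast
  define A where "A k = chamber \<inter> {x. real k \<le> z \<bullet> x}" for k :: nat
  have M: "volume X = lborel" using X by simp
  show False
  proof (rule no_escaping_mass[of A lborel "ennreal (unit_ball_vol DIM('a) * e ^ DIM('a))"])
    show "A k \<in> sets lborel" for k unfolding A_def using chamber_borel
      by (intro sets.Int) (auto intro!: borel_closed closed_Collect_le continuous_intros)
    show "decseq A" unfolding decseq_def A_def by auto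
    show "(\<Inter>k. A k) = {}"
    proof (rule ccontr)
      assume "(\<Inter>k. A k) \<noteq> {}"
      then obtain x where x: "\<And>k. x \<in> A k" by blast
      obtain k where "z \<bullet> x < real k" using reals_Archimedean2 by blast
      then show False using x[of k] unfolding A_def by simp
    qed
    have "emeasure lborel (A 0) \<le> emeasure lborel chamber"
      unfolding A_def using chamber_borel by (intro emeasure_mono) auto
    then show "emeasure lborel (A 0) \<noteq> \<infinity>" using fin unfolding M by (auto simp: top_unique)
    show "0 < ennreal (unit_ball_vol DIM('a) * e ^ DIM('a))" using e(1) by simp
    fix k :: nat
    \<comment> \<open>Far enough that the centre passes level \<open>k\<close> by
      \<open>norm z * e\<close>, the largest variation of the functional over the ball.\<close>
    define t where "t = (\<bar>real k - z \<bullet> x0\<bar> + norm z * e) / (z \<bullet> z)"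
    have t: "0 \<le> t" unfolding t_def using e(1) by (intro divide_nonneg_nonneg add_nonneg_nonneg) simp_all
    have sub: "ball (x0 + t *\<^sub>R z) e \<subseteq> A k"
    proof
      fix q assume q: "q \<in> ball (x0 + t *\<^sub>R z) e"
      define x' where "x' = q - t *\<^sub>R z"
      have "dist x0 x' = dist (x0 + t *\<^sub>R z) q" unfolding x'_def dist_norm by (simp add: algebra_simps)
      then have d: "dist x0 x' < e" using q by simp
      then have x': "x' \<in> U" using e(2) by auto
      have qc: "q \<in> chamber"
      proof (rule chamberI)
        show "q \<in> points X" using X by simp
        fix s assume s: "s \<in> walls"
        have "(q, 1::real) = (x', 1) + t *\<^sub>R (z, 0)" unfolding x'_def by simp
        then have "ev (rt s) q = ev (rt s) x' + t * (rt s \<bullet> (z, 0))"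
          by (simp only: inner_add_right inner_scaleR_right)
        moreover have "0 < ev (rt s) x'" using x' walls_R[OF s] unfolding U_def by blast
        moreover have "0 \<le> t * (rt s \<bullet> (z, 0))" using t cone[OF s] by simp
        ultimately show "0 \<le> ev (rt s) q" by linarith
      qed
      have "\<bar>z \<bullet> (x' - x0)\<bar> \<le> norm z * norm (x' - x0)" by (rule Cauchy_Schwarz_ineq2)
      also have "\<dots> \<le> norm z * e" using d by (intro mult_left_mono) (simp_all add: dist_norm norm_minus_commute)
      finally have "- (norm z * e) \<le> z \<bullet> x' - z \<bullet> x0" by (simp add: inner_diff_right)
      moreover have "t * (z \<bullet> z) = \<bar>real k - z \<bullet> x0\<bar> + norm z * e" unfolding t_def using z by simp
      moreover have "z \<bullet> q = z \<bullet> x' + t * (z \<bullet> z)" unfolding x'_def by (simp add: inner_diff_right)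
      ultimately have "real k \<le> z \<bullet> q" by linarith
      then show "q \<in> A k" unfolding A_def using qc by simp
    qed
    have "emeasure lborel (ball (x0 + t *\<^sub>R z) e) \<le> emeasure lborel (A k)"
      unfolding A_def[of k] using sub chamber_borel unfolding A_def
      by (intro emeasure_mono) (auto intro!: sets.Int borel_closed closed_Collect_le continuous_intros)
    then show "ennreal (unit_ball_vol DIM('a) * e ^ DIM('a)) \<le> emeasure lborel (A k)"
      using e(1) by (simp add: emeasure_ball)
  qed
qed

end

section \<open>Local finiteness\<close>

lemma tendsto_pointwise:
  fixes f :: "'c \<Rightarrow> 'a \<Rightarrow> 'b::topological_space"
  assumes "\<And>x. ((\<lambda>c. f c x) \<longlongrightarrow> l x) F"
  shows "(f \<longlongrightarrow> l) F"
proof -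
  have "limitin (product_topology (\<lambda>_. euclidean) UNIV) f l F"
    unfolding limitin_componentwise using assms by simp
  then show ?thesis unfolding euclidean_product_topology by simp
qed

lemma tendsto_sharp:
  assumes "(f \<longlongrightarrow> l) F"
  shows "((\<lambda>n. sharp X (f n)) \<longlongrightarrow> sharp X l) F"
  unfolding sharp_def by (intro tendsto_intros assms)

text \<open>
  Infinitely many mirrors meeting a compact set accumulate, and then products of consecutive
  reflections converge to the identity.
\<close>

lemma discrete_locally_finite:
  fixes G :: "('a::euclidean_space \<Rightarrow> 'a) set"
  assumes sub: "subgroup G (BG X)" and iso: "G \<subseteq> isometries X" and disc: "discrete G"
    and K: "compact K" "K \<subseteq> points X"
  shows "finite {s \<in> G \<inter> reflections X. mirror X s \<inter> K \<noteq> {}}"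
proof (rule ccontr)
  interpret BG: group "BG X :: ('a \<Rightarrow> 'a) monoid" by (rule group_BG)
  assume "infinite {s \<in> G \<inter> reflections X. mirror X s \<inter> K \<noteq> {}}"
  from infinite_countable_subset[OF this]
  obtain s :: "nat \<Rightarrow> 'a \<Rightarrow> 'a" where inj: "inj s"
    and rng: "range s \<subseteq> {s \<in> G \<inter> reflections X. mirror X s \<inter> K \<noteq> {}}" by blast
  have s: "s n \<in> G" "s n \<in> reflections X" "mirror X (s n) \<inter> K \<noteq> {}" for n
    using subsetD[OF rng rangeI, of n] by simp_all
  \<comment> \<open>A mirror is encoded by a root with unit linear part and one of its points in
    \<open>K\<close>. The point bounds the constant term of the root, so the pairs range over a
    compact set.\<close>
  have "\<exists>q. norm (fst (fst q)) = 1 \<and> mirror X (s n) = {x \<in> points X. ev (fst q) x = 0}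
      \<and> snd q \<in> K \<and> snd q \<in> mirror X (s n)" for n
  proof -
    obtain \<alpha> where a: "fst \<alpha> \<noteq> 0" "mirror X (s n) = {x \<in> points X. ev \<alpha> x = 0}"
      by (rule reflection_root[OF s(2)]) blast
    obtain x where "x \<in> K" "x \<in> mirror X (s n)" using s(3)[of n] by blast
    then show ?thesis using a by (intro exI[of _ "((1 / norm (fst \<alpha>)) *\<^sub>R \<alpha>, x)"]) simp
  qed
  from choice[OF allI[OF this]]
  obtain q where qq: "\<forall>n. norm (fst (fst (q n))) = 1 \<and> mirror X (s n) = {x \<in> points X. ev (fst (q n)) x = 0}
      \<and> snd (q n) \<in> K \<and> snd (q n) \<in> mirror X (s n)" ..
  have q: "norm (fst (fst (q n))) = 1" for n using spec[OF qq, of n] by (elim conjE)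
  have q_mirror: "mirror X (s n) = {x \<in> points X. ev (fst (q n)) x = 0}" for n
    using spec[OF qq, of n] by (elim conjE)
  have q_K: "snd (q n) \<in> K" for n using spec[OF qq, of n] by (elim conjE)
  have q_fix: "snd (q n) \<in> mirror X (s n)" for n using spec[OF qq, of n] by (elim conjE)
  from compact_imp_bounded[OF K(1), unfolded bounded_iff]
  obtain b where bK: "\<forall>x\<in>K. norm x \<le> b" ..
  note b = bspec[OF bK]
  have ev0: "ev (fst (q n)) (snd (q n)) = 0" for n
    using q_fix[of n] unfolding q_mirror by simp
  have "snd (fst (q n)) \<in> cball 0 b" for n
  proof -
    have "\<bar>snd (fst (q n))\<bar> = \<bar>fst (fst (q n)) \<bullet> snd (q n)\<bar>" using ev0[of n] by (simp add: inner_lift)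
    also have "\<dots> \<le> norm (fst (fst (q n))) * norm (snd (q n))" by (rule Cauchy_Schwarz_ineq2)
    finally have "\<bar>snd (fst (q n))\<bar> \<le> norm (snd (q n))" using q[of n] by simp
    then show ?thesis using b[OF q_K[of n]] by simp
  qed
  then have qK: "q n \<in> (sphere 0 1 \<times> cball 0 b) \<times> K" for n
    using q q_K by (simp add: mem_Times_iff)
  have comp: "compact ((sphere (0::'a) 1 \<times> cball (0::real) b) \<times> K)" by (intro compact_Times K compact_sphere compact_cball)
  from comp[unfolded compact_def, rule_format, OF qK]
  obtain l where l: "l \<in> (sphere 0 1 \<times> cball 0 b) \<times> K" and ex: "\<exists>r. strict_mono r \<and> (q \<circ> r) \<longlonglongrightarrow> l"
    by (rule bexE)
  from ex obtain r where r: "strict_mono r \<and> (q \<circ> r) \<longlonglongrightarrow> l" ..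
  note r = conjunct1[OF r] conjunct2[OF r]
  define \<alpha> x where "\<alpha> = fst l" and "x = snd l"
  have lim_a: "(\<lambda>n. fst (q (r n))) \<longlonglongrightarrow> \<alpha>" and lim_x: "(\<lambda>n. snd (q (r n))) \<longlonglongrightarrow> x"
    using tendsto_fst[OF r(2)] tendsto_snd[OF r(2)] by (simp_all add: \<alpha>_def x_def comp_def)
  have "(\<lambda>n. ev (fst (q (r n))) (snd (q (r n)))) \<longlonglongrightarrow> ev \<alpha> x"
    by (intro tendsto_intros lim_a lim_x)
  then have "(\<lambda>n. 0) \<longlonglongrightarrow> ev \<alpha> x" unfolding ev0 .
  then have ax: "ev \<alpha> x = 0" using LIMSEQ_unique tendsto_const by blast
  have a0: "fst \<alpha> \<noteq> 0" using l by (auto simp: \<alpha>_def)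
  have xp: "x \<in> points X" using l K(2) by (auto simp: x_def)
  \<comment> \<open>The limiting hyperplane still passes through a point of \<open>K\<close>, so its
    root has positive norm and the reflection depends continuously on the root there.\<close>
  have Q: "0 < \<alpha> \<bullet> sharp X \<alpha>" by (rule root_norm_pos[OF a0 xp ax])
  define T where "T \<beta> u = u - (2 * (\<beta> \<bullet> u) / (\<beta> \<bullet> sharp X \<beta>)) *\<^sub>R sharp X \<beta>" for \<beta> u :: "'a \<times> real"
  have hat_s: "hat X (s n y) = T (fst (q n)) (hat X y)" if "y \<in> points X" for n y
    unfolding T_def
  proof (rule reflection_formula[OF _ _ q_mirror _ that])
    show "s n \<in> isometries X" using s(1) iso by blast
    show "fst (fst (q n)) \<noteq> 0" using q[of n] by auto
    show "mirror X (s n) \<noteq> {}" using s(3) by blast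
  qed
  have TT: "T \<alpha> (T \<alpha> u) = u" for u
  proof -
    have "\<alpha> \<bullet> T \<alpha> u = - (\<alpha> \<bullet> u)" unfolding T_def using Q by (simp add: inner_diff_right)
    then show ?thesis unfolding T_def[of \<alpha> "T \<alpha> u"] by (simp add: T_def)
  qed
  have lim_T: "(\<lambda>n. T (a n) (v n)) \<longlonglongrightarrow> T \<alpha> u" if "a \<longlonglongrightarrow> \<alpha>" "v \<longlonglongrightarrow> u" for a v u
    unfolding T_def using that Q by (intro tendsto_intros tendsto_sharp) simp_all
  define g where "g n = s (r n) \<otimes>\<^bsub>BG X\<^esub> s (r (Suc n))" for n
  have gG: "g n \<in> G" for n unfolding g_def by (intro subgroup.m_closed[OF sub] s(1))
  have sc: "s n \<in> carrier (BG X)" for n using s(2) reflections_carrier by blast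
  have gc: "g n \<in> carrier (BG X)" for n unfolding g_def using sc by simp
  have "(\<lambda>n. g n y) \<longlonglongrightarrow> (\<one>\<^bsub>BG X\<^esub> :: 'a \<Rightarrow> 'a) y" for y
  proof (cases "y \<in> points X")
    case True
    have gy: "hat X (g n y) = T (fst (q (r n))) (T (fst (q (r (Suc n)))) (hat X y))" for n
      unfolding g_def BG_mult[OF sc sc True] hat_s[OF BG_points[OF sc True]] hat_s[OF True] ..
    have "(\<lambda>n. hat X (g n y)) \<longlonglongrightarrow> T \<alpha> (T \<alpha> (hat X y))"
      unfolding gy by (intro lim_T lim_a LIMSEQ_Suc[OF lim_a] tendsto_const)
    then have h: "(\<lambda>n. hat X (g n y)) \<longlonglongrightarrow> hat X y" unfolding TT .
    have un: "(1 / snd (hat X z)) *\<^sub>R fst (hat X z) = z" if "z \<in> points X" for z :: 'a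
      using om_pos[OF that] by (simp add: hat_def)
    have "snd (hat X y) \<noteq> 0" using om_pos[OF True] by (simp add: hat_def)
    then have "(\<lambda>n. (1 / snd (hat X (g n y))) *\<^sub>R fst (hat X (g n y))) \<longlonglongrightarrow> (1 / snd (hat X y)) *\<^sub>R fst (hat X y)"
      by (intro tendsto_intros h)
    then show ?thesis unfolding un[OF True] un[OF BG_points[OF gc True]] BG_one[OF True] .
  next
    \<comment> \<open>Convergence is required at every point of the type; off
      \<open>points X\<close> all group elements take the value \<open>undefined\<close>.\<close>
    case False
    have "g n y = undefined" for n using gc[of n] False unfolding BG_carrier by (simp add: extensional_def)
    moreover have "(\<one>\<^bsub>BG X\<^esub> :: 'a \<Rightarrow> 'a) y = undefined"
      using False BG.one_closed unfolding BG_carrier by (simp add: extensional_def)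
    ultimately show ?thesis by simp
  qed
  then have gl: "g \<longlonglongrightarrow> (\<one>\<^bsub>BG X\<^esub> :: 'a \<Rightarrow> 'a)" by (rule tendsto_pointwise)
  have "(\<one>\<^bsub>BG X\<^esub> :: 'a \<Rightarrow> 'a) \<in> G" by (rule subgroup.one_closed[OF sub])
  then have "(\<one>\<^bsub>BG X\<^esub> :: 'a \<Rightarrow> 'a) isolated_in G" by (rule discreteD[OF disc])
  then obtain V where V: "open V" "V \<inter> G = {\<one>\<^bsub>BG X\<^esub> :: 'a \<Rightarrow> 'a}" unfolding isolated_in_def by blast
  then have "eventually (\<lambda>n. g n \<in> V) sequentially" by (intro topological_tendstoD[OF gl V(1)]) blast
  then obtain n where "g n \<in> V" by (auto simp: eventually_sequentially)
  then have "g n = \<one>\<^bsub>BG X\<^esub>" using V(2) gG by blast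
  then have "s (r n) \<otimes>\<^bsub>BG X\<^esub> s (r (Suc n)) = s (r n) \<otimes>\<^bsub>BG X\<^esub> s (r n)"
    unfolding g_def reflection_square[OF s(2)] .
  then have "s (r (Suc n)) = s (r n)" using sc by simp
  then have "r (Suc n) = r n" using inj by (simp add: inj_eq)
  then show False using strict_monoD[OF r(1), of n "Suc n"] by simp
qed

section \<open>Cocycles of reflection groups\<close>

text \<open>Gaussian elimination: more rows than columns are dependent. The pivot row
  \<open>a0\<close> clears column \<open>b\<close>, and its coefficient is recovered at the
  end.\<close>

lemma dependent_rows:
  fixes f :: "'i \<Rightarrow> 'j \<Rightarrow> real"
  assumes "finite B" "finite A" "card B < card A"
  shows "\<exists>\<mu>. (\<exists>a\<in>A. \<mu> a \<noteq> 0) \<and> (\<forall>b\<in>B. (\<Sum>a\<in>A. \<mu> a * f a b) = 0)"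
  using assms
proof (induction B arbitrary: A f rule: finite_induct)
  case empty
  then have "A \<noteq> {}" by auto
  then show ?case by (intro exI[of _ "\<lambda>_. 1"]) auto
next
  case (insert b B)
  show ?case
  proof (cases "\<forall>a\<in>A. f a b = 0")
    case True
    obtain \<mu> where "\<exists>a\<in>A. \<mu> a \<noteq> 0" "\<forall>b\<in>B. (\<Sum>a\<in>A. \<mu> a * f a b) = 0"
      using insert.IH[of A f] insert.prems insert.hyps by auto
    then show ?thesis using True by (intro exI[of _ \<mu>]) simp
  next
    case False
    then obtain a0 where a0: "a0 \<in> A" "f a0 b \<noteq> 0" by blast
    define f' where "f' a b' = f a b' - f a b / f a0 b * f a0 b'" for a b'
    have "card B < card (A - {a0})" using insert.prems insert.hyps a0 by simp
    then obtain \<nu> where nu: "\<exists>a\<in>A - {a0}. \<nu> a \<noteq> 0" "\<And>b'. b' \<in> B \<Longrightarrow> (\<Sum>a\<in>A - {a0}. \<nu> a * f' a b') = 0"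
      using insert.IH[of "A - {a0}" f'] insert.prems by auto
    define \<mu> where "\<mu> a = (if a = a0 then - (\<Sum>a\<in>A - {a0}. \<nu> a * f a b) / f a0 b else \<nu> a)" for a
    have sum: "(\<Sum>a\<in>A. \<mu> a * f a b') = (\<Sum>a\<in>A - {a0}. \<nu> a * f' a b')" for b'
    proof -
      have "(\<Sum>a\<in>A. \<mu> a * f a b') = \<mu> a0 * f a0 b' + (\<Sum>a\<in>A - {a0}. \<mu> a * f a b')"
        by (rule sum.remove[OF insert.prems(1) a0(1)])
      also have "(\<Sum>a\<in>A - {a0}. \<mu> a * f a b') = (\<Sum>a\<in>A - {a0}. \<nu> a * f a b')"
        by (rule sum.cong) (simp_all add: \<mu>_def)
      also have "\<mu> a0 * f a0 b' = - (\<Sum>a\<in>A - {a0}. \<nu> a * f a b / f a0 b * f a0 b')"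
        by (simp add: \<mu>_def sum_divide_distrib sum_distrib_right)
      finally show ?thesis
        by (simp add: f'_def right_diff_distrib sum_subtractf mult.assoc)
    qed
    have "f' a b = 0" for a using a0(2) by (simp add: f'_def)
    then have "(\<Sum>a\<in>A. \<mu> a * f a b) = 0" unfolding sum by simp
    moreover have "\<exists>a\<in>A. \<mu> a \<noteq> 0" using nu(1) by (auto simp: \<mu>_def)
    ultimately show ?thesis using sum nu(2) by (intro exI[of _ \<mu>]) auto
  qed
qed

text \<open>
  The functional chosen here is unique, but it exists only if \<open>g\<close> is an isometry.
\<close>

definition act :: "geometry \<Rightarrow> ('a::euclidean_space \<Rightarrow> 'a) \<Rightarrow> 'a \<times> real \<Rightarrow> 'a \<times> real" where
  "act X g \<alpha> = (SOME \<beta>. \<forall>x\<in>points X. \<beta> \<bullet> hat X (g x) = \<alpha> \<bullet> hat X x)"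

lemma act:
  fixes g :: "'a::euclidean_space \<Rightarrow> 'a"
  assumes g: "g \<in> isometries X" and x: "x \<in> points X"
  shows "act X g \<alpha> \<bullet> hat X (g x) = \<alpha> \<bullet> hat X x"
proof -
  have c: "g \<in> carrier (BG X)" using g isometries_carrier by blast
  have "inv\<^bsub>BG X\<^esub> g \<in> isometries X" by (rule subgroup.m_inv_closed[OF subgroup_isometries g])
  from isometry_functional[OF this, of \<alpha>]
  obtain \<beta> where b: "\<forall>y\<in>points X. \<beta> \<bullet> hat X y = \<alpha> \<bullet> hat X ((inv\<^bsub>BG X\<^esub> g) y)" ..
  have "\<forall>x\<in>points X. \<beta> \<bullet> hat X (g x) = \<alpha> \<bullet> hat X x"
  proof
    fix x :: 'a assume x: "x \<in> points X"
    show "\<beta> \<bullet> hat X (g x) = \<alpha> \<bullet> hat X x" using bspec[OF b BG_points[OF c x]] BG_inv(1)[OF c x] by simp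
  qed
  then have "\<forall>x\<in>points X. act X g \<alpha> \<bullet> hat X (g x) = \<alpha> \<bullet> hat X x" unfolding act_def
    by (rule someI[where P = "\<lambda>\<beta>. \<forall>x\<in>points X. \<beta> \<bullet> hat X (g x) = \<alpha> \<bullet> hat X x"])
  then show ?thesis using x by (rule bspec)
qed

lemma act_unique:
  fixes g :: "'a::euclidean_space \<Rightarrow> 'a"
  assumes g: "g \<in> isometries X" and b: "\<And>x. x \<in> points X \<Longrightarrow> \<beta> \<bullet> hat X (g x) = \<alpha> \<bullet> hat X x"
  shows "act X g \<alpha> = \<beta>"
proof (rule functional_eqI)
  fix y :: 'a assume y: "y \<in> points X"
  have c: "g \<in> carrier (BG X)" using g isometries_carrier by blast
  have i: "(inv\<^bsub>BG X\<^esub> g) y \<in> points X"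
    by (rule BG_points[OF group.inv_closed[OF group_BG c] y])
  note e = BG_inv(2)[OF c y]
  show "act X g \<alpha> \<bullet> hat X y = \<beta> \<bullet> hat X y"
    using act[OF g i, of \<alpha>, unfolded e] b[OF i, unfolded e] by (rule trans[OF _ sym])
qed

lemma act_add: "g \<in> isometries X \<Longrightarrow> act X g (\<alpha> + \<beta>) = act X g \<alpha> + act X g \<beta>"
  by (rule act_unique) (simp_all only: act inner_add_left)

lemma act_scaleR: "g \<in> isometries X \<Longrightarrow> act X g (r *\<^sub>R \<alpha>) = r *\<^sub>R act X g \<alpha>"
  by (rule act_unique) (simp_all only: act inner_scaleR_left)

lemma act_sum: "g \<in> isometries X \<Longrightarrow> act X g (\<Sum>i\<in>I. \<alpha> i) = (\<Sum>i\<in>I. act X g (\<alpha> i))"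
  by (rule act_unique) (simp_all only: act inner_sum_left)

lemma act_mult:
  fixes g h :: "'a::euclidean_space \<Rightarrow> 'a"
  assumes g: "g \<in> isometries X" and h: "h \<in> isometries X"
  shows "act X (g \<otimes>\<^bsub>BG X\<^esub> h) \<alpha> = act X g (act X h \<alpha>)"
proof (rule act_unique)
  show "g \<otimes>\<^bsub>BG X\<^esub> h \<in> isometries X" by (rule subgroup.m_closed[OF subgroup_isometries g h])
  fix x :: 'a assume x: "x \<in> points X"
  have c: "g \<in> carrier (BG X)" "h \<in> carrier (BG X)" using g h isometries_carrier by blast+
  show "act X g (act X h \<alpha>) \<bullet> hat X ((g \<otimes>\<^bsub>BG X\<^esub> h) x) = \<alpha> \<bullet> hat X x"
    unfolding BG_mult[OF c x] act[OF g BG_points[OF c(2) x]] act[OF h x] ..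
qed

lemma act_one:
  fixes \<alpha> :: "'a::euclidean_space \<times> real"
  shows "act X \<one>\<^bsub>BG X\<^esub> \<alpha> = \<alpha>"
proof (rule act_unique)
  show "(\<one>\<^bsub>BG X\<^esub> :: 'a \<Rightarrow> 'a) \<in> isometries X" by (rule subgroup.one_closed[OF subgroup_isometries])
qed (simp only: BG_one)

context mirror_system begin

lemma act_reflection:
  assumes s: "s \<in> R"
  shows "act X s \<beta> = \<beta> - (2 * (\<beta> \<bullet> sharp X (rt s)) / (rt s \<bullet> sharp X (rt s))) *\<^sub>R rt s"
proof (rule act_unique)
  show "s \<in> isometries X" using R_\<Gamma>[OF s] \<Gamma>_isometries by blast
  fix x :: 'a assume x: "x \<in> points X"
  show "(\<beta> - (2 * (\<beta> \<bullet> sharp X (rt s)) / (rt s \<bullet> sharp X (rt s))) *\<^sub>R rt s) \<bullet> hat X (s x) = \<beta> \<bullet> hat X x"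
    using functional_act[OF s x, of \<beta>] root_flip[OF s x] by (simp add: inner_diff_left)
qed

text \<open>Conjugates of walls exhaust the reflections, so the walls generate \<Gamma> and the
  abstract construction applies. Its condition \<open>v_refl\<close> holds because a reflection
  negates its root.\<close>

lemma cocycle_of_weights:
  fixes m :: "('a \<Rightarrow> 'a) \<Rightarrow> real"
  assumes gen: "\<Gamma> \<subseteq> generate (BG X) R"
  shows "\<exists>c. (\<forall>g\<in>\<Gamma>. \<forall>h\<in>\<Gamma>. c (g \<cdot> h) = c g + act X g (c h)) \<and> (\<forall>s\<in>walls. c s = m s *\<^sub>R rt s)"
proof -
  have sg: "subgroup (generate (BG X) walls) (BG X)"
    by (rule BG.generate_is_subgroup) (use walls_R R_carrier in blast)
  have "generate (BG X) R \<subseteq> generate (BG X) walls"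
    by (rule BG.generate_subgroup_incl[OF _ sg]) (use R_generated in blast)
  then have eq: "generate (BG X) walls = \<Gamma>" using gen walls_generate_subset by blast
  have ri: "s \<in> isometries X" if "s \<in> walls" for s using walls_R[OF that] R_\<Gamma> \<Gamma>_isometries by blast
  have iso: "g \<in> isometries X" if "g \<in> \<Gamma>" for g using that \<Gamma>_isometries by blast
  interpret half_space_module "BG X" walls "\<lambda>s w. ev (rt s) (w x0) < 0" "act X" "\<lambda>s. m s *\<^sub>R rt s"
  proof (intro half_space_module.intro half_space_module_axioms.intro half_space_system)
    fix s t w assume st: "s \<in> walls" "t \<in> walls" "s \<noteq> t" and w: "w \<in> generate (BG X) walls"
      and n: "ev (rt s) (w x0) < 0" "ev (rt t) (w x0) < 0"
    have R: "s \<in> R" "t \<in> R" using st walls_R by blast+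
    have Q: "0 < rt s \<bullet> sharp X (rt s)" "0 < rt t \<bullet> sharp X (rt t)" using root_norm R by blast+
    then have nz: "sharp X (rt s) \<noteq> 0" "sharp X (rt t) \<noteq> 0" by auto
    have "w \<in> \<Gamma>" using w unfolding eq .
    note wp = \<Gamma>_points[OF this x0(1)]
    \<comment> \<open>\<open>f - act X s f\<close> is twice the pairing of \<open>f\<close> with the
      root, divided by the norm of the root, times the root. The two prescribed pairings are solved
      for \<open>m s\<close> and \<open>m t\<close>.\<close>
    from prescribed_inner[OF nz(2,1) walls_independent[OF st wp n]]
    obtain f where f: "f \<bullet> sharp X (rt t) = m t * (rt t \<bullet> sharp X (rt t)) / 2"
      "f \<bullet> sharp X (rt s) = m s * (rt s \<bullet> sharp X (rt s)) / 2"
      by blast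
    have "m s *\<^sub>R rt s = f - act X s f \<and> m t *\<^sub>R rt t = f - act X t f"
      unfolding act_reflection[OF R(1)] act_reflection[OF R(2)] f using Q by simp
    then show "\<exists>f. m s *\<^sub>R rt s = f - act X s f \<and> m t *\<^sub>R rt t = f - act X t f" by blast
  next
    fix s assume "s \<in> walls"
    then have R: "s \<in> R" by (rule walls_R)
    have "m s *\<^sub>R rt s + act X s (m s *\<^sub>R rt s) = m s *\<^sub>R rt s + (m s *\<^sub>R rt s - (2 * m s) *\<^sub>R rt s)"
      unfolding act_reflection[OF R] using root_norm[OF R] by simp
    also have "\<dots> = (m s + (m s - 2 * m s)) *\<^sub>R rt s"
      by (simp only: scaleR_left_distrib scaleR_left_diff_distrib)
    finally show "m s *\<^sub>R rt s + act X s (m s *\<^sub>R rt s) = 0" by simp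
  qed (simp_all add: eq act_add act_mult act_one iso)
  show ?thesis using cocycle_exists unfolding eq .
qed

text \<open>
  Among the finitely many translates of \<open>f\<close>, one that is largest at \<open>x0\<close> pairs nonnegatively with
  all walls, hence lies in the cone over the chamber.
\<close>

lemma finite_orbit:
  assumes fin: "emeasure (volume X) chamber \<noteq> \<infinity>" and orb: "finite ((\<lambda>g. act X g f) ` \<Gamma>)"
    and x: "x \<in> points X"
  shows "(X = Hyperbolic \<longrightarrow> f \<bullet> hat X x \<le> 0) \<and> (X = Euclidean \<longrightarrow> fst f = 0)"
proof -
  let ?O = "(\<lambda>g. act X g f) ` \<Gamma>"
  have one: "\<one>\<^bsub>BG X\<^esub> \<in> \<Gamma>" by (rule subgroup.one_closed[OF \<Gamma>_subgroup])
  have ne: "?O \<noteq> {}" using one by blast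
  define M where "M = Max ((\<lambda>e. e \<bullet> hat X x0) ` ?O)"
  have "M \<in> (\<lambda>e. e \<bullet> hat X x0) ` ?O" unfolding M_def using orb ne by (intro Max_in) simp_all
  then obtain g where g: "g \<in> \<Gamma>" "M = act X g f \<bullet> hat X x0" by auto
  have le: "act X h f \<bullet> hat X x0 \<le> M" if "h \<in> \<Gamma>" for h
    unfolding M_def using orb that by (intro Max_ge) simp_all
  define e where "e = act X g f"
  have gi: "g \<in> isometries X" using g(1) \<Gamma>_isometries by blast
  have cone: "0 \<le> rt t \<bullet> sharp X e" if t: "t \<in> walls" for t
  proof -
    have tR: "t \<in> R" by (rule walls_R[OF t])
    have t\<Gamma>: "t \<in> \<Gamma>" by (rule R_\<Gamma>[OF tR])
    have ti: "t \<in> isometries X" using t\<Gamma> \<Gamma>_isometries by blast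
    \<comment> \<open>Applying \<open>t\<close> subtracts a multiple of a root that is positive at
      \<open>x0\<close>. Maximality of \<open>e\<close> makes the multiple nonnegative, which is the
      wall inequality for \<open>sharp X e\<close>.\<close>
    have "act X t e \<bullet> hat X x0 \<le> e \<bullet> hat X x0"
      using le[OF subgroup.m_closed[OF \<Gamma>_subgroup t\<Gamma> g(1)]] g(2) act_mult[OF ti gi] unfolding e_def by simp
    then have "0 \<le> (2 * (e \<bullet> sharp X (rt t)) / (rt t \<bullet> sharp X (rt t))) * (rt t \<bullet> hat X x0)"
      unfolding act_reflection[OF tR] by (simp add: inner_diff_left)
    moreover have "0 < rt t \<bullet> hat X x0" using rt(3)[OF tR] inner_hat_sign(2)[OF x0(1)] by blast
    ultimately have "0 \<le> e \<bullet> sharp X (rt t)"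
      using root_norm[OF tR] by (simp add: zero_le_mult_iff zero_le_divide_iff)
    then show ?thesis by (simp add: inner_sharp_commute)
  qed
  have pull: "f \<bullet> hat X y = e \<bullet> hat X (g y)" if "y \<in> points X" for y
    unfolding e_def using act[OF gi that] by simp
  show ?thesis
  proof (cases X)
    case Hyperbolic
    \<comment> \<open>\<open>sharp X e\<close> is \<open>(fst e, - snd e)\<close>. Its membership in
      the forward light cone makes \<open>e\<close> nonpositive on the whole ball, and hence also
      \<open>f\<close>, whose values are those of \<open>e\<close> at translated points.\<close>
    have "norm (fst e) \<le> - snd e"
      by (rule finite_volume_cone_hyperbolic[OF Hyperbolic fin]) (use cone Hyperbolic in \<open>simp add: sharp_def\<close>)
    define y where "y = g x"
    have yp: "y \<in> points X" unfolding y_def by (rule \<Gamma>_points[OF g(1) x])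
    have "fst e \<bullet> y \<le> norm (fst e) * norm y" by (rule norm_cauchy_schwarz)
    also have "\<dots> \<le> norm (fst e) * 1" using yp Hyperbolic by (intro mult_left_mono) simp_all
    finally have "ev e y \<le> 0" using \<open>norm (fst e) \<le> - snd e\<close> unfolding inner_lift by simp
    then have "e \<bullet> hat X y \<le> 0" using inner_hat_sign(2)[OF yp, of e] by linarith
    then show ?thesis using pull[OF x] Hyperbolic unfolding y_def by simp
  next
    case Euclidean
    have "fst e = 0"
      by (rule finite_volume_cone_euclidean[OF Euclidean fin]) (use cone Euclidean in \<open>simp add: sharp_def\<close>)
    then have "f \<bullet> hat X y = (0, snd e) \<bullet> hat X y" if "y \<in> points X" for y
      using pull[OF that] Euclidean unfolding inner_hat inner_lift by (simp add: om_def)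
    then have "f = (0, snd e)" by (rule functional_eqI)
    then show ?thesis using Euclidean by simp
  qed
qed

lemma finite_orbit_root:
  assumes fin: "emeasure (volume X) chamber \<noteq> \<infinity>" and s: "s \<in> R"
    and orb: "finite ((\<lambda>g. act X g (l *\<^sub>R rt s)) ` \<Gamma>)"
  shows "l = 0"
proof -
  have root: "fst (rt s) \<noteq> 0" by (rule rt(1)[OF s])
  show ?thesis
  proof (cases X)
    case Euclidean
    then show ?thesis using finite_orbit[OF fin orb x0(1)] root by simp
  next
    case Hyperbolic
    have neg: "act X g ((- l) *\<^sub>R rt s) = - act X g (l *\<^sub>R rt s)" if "g \<in> \<Gamma>" for g
      unfolding act_scaleR[OF subsetD[OF \<Gamma>_isometries that]] by simp
    have "finite ((\<lambda>g. - act X g (l *\<^sub>R rt s)) ` \<Gamma>)"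
      using finite_imageI[OF orb, of uminus] by (simp only: image_image)
    also have "(\<lambda>g. - act X g (l *\<^sub>R rt s)) ` \<Gamma> = (\<lambda>g. act X g ((- l) *\<^sub>R rt s)) ` \<Gamma>"
      by (rule image_cong[OF refl neg[symmetric]])
    finally have orb': "finite ((\<lambda>g. act X g ((- l) *\<^sub>R rt s)) ` \<Gamma>)" .
    have "l * (rt s \<bullet> hat X x0) = 0"
    proof (rule antisym)
      show "l * (rt s \<bullet> hat X x0) \<le> 0" using finite_orbit[OF fin orb x0(1)] Hyperbolic by simp
      show "0 \<le> l * (rt s \<bullet> hat X x0)" using finite_orbit[OF fin orb' x0(1)] Hyperbolic by simp
    qed
    moreover have "0 < rt s \<bullet> hat X x0" using rt(3)[OF s] inner_hat_sign(2)[OF x0(1)] by blast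
    ultimately show ?thesis by simp
  qed
qed

end

section \<open>Comparing the cocycles of the two groups\<close>

lemma fundamental_chamber_mirror_system:
  fixes \<Gamma> :: "('a::euclidean_space \<Rightarrow> 'a) set"
  assumes "subgroup \<Gamma> (BG X)" "\<Gamma> \<subseteq> isometries X"
    and "\<And>K. compact K \<Longrightarrow> K \<subseteq> points X \<Longrightarrow> finite {s \<in> \<Gamma> \<inter> reflections X. mirror X s \<inter> K \<noteq> {}}"
    and C: "C \<in> fundamental_chambers X \<Gamma>"
  obtains x0 where "mirror_system X \<Gamma> x0" "C = mirror_system.chamber X \<Gamma> x0"
proof -
  let ?M = "points X - (\<Union>s\<in>\<Gamma> \<inter> reflections X. mirror X s)"
  obtain V where V: "V \<in> components ?M" "C = points X \<inter> closure V"
    using C unfolding fundamental_chambers_def by blast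
  from V(1) obtain x0 where base: "x0 \<in> ?M" "V = connected_component_set ?M x0"
    unfolding components_def by blast
  have ms: "mirror_system X \<Gamma> x0"
  proof (rule mirror_system.intro[OF assms(1,2,3)])
    show "x0 \<in> points X" using base(1) by blast
    show "x0 \<notin> mirror X s" if "s \<in> \<Gamma> \<inter> reflections X" for s using base(1) that by blast
  qed
  interpret mirror_system X \<Gamma> x0 by (rule ms)
  have "V = U" using base(2) component_U unfolding R_def by simp
  then have "C = chamber" unfolding V(2) using closure_U by simp
  then show ?thesis by (rule that[OF ms])
qed

text \<open>\<open>t \<cdot> t = \<one>\<close> puts \<open>c t\<close> into the eigenspace of
  \<open>act X t\<close> for \<open>-1\<close>, which is spanned by the root.\<close>

lemma (in mirror_system) cocycle_on_wall:
  assumes c: "\<And>g h. g \<in> \<Gamma> \<Longrightarrow> h \<in> \<Gamma> \<Longrightarrow> c (g \<cdot> h) = c g + act X g (c h)" and t: "t \<in> R"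
  shows "\<exists>l. c t = l *\<^sub>R rt t"
proof -
  have one: "\<one>\<^bsub>BG X\<^esub> \<in> \<Gamma>" by (rule subgroup.one_closed[OF \<Gamma>_subgroup])
  have "c (\<one>\<^bsub>BG X\<^esub> \<cdot> \<one>\<^bsub>BG X\<^esub>) = c \<one>\<^bsub>BG X\<^esub> + c \<one>\<^bsub>BG X\<^esub>" using c[OF one one] by (simp add: act_one)
  then have "c \<one>\<^bsub>BG X\<^esub> = 0" by simp
  then have "c t + act X t (c t) = 0"
    using c[OF R_\<Gamma>[OF t] R_\<Gamma>[OF t]] unfolding reflection_square[OF R_refl[OF t]] by simp
  then have "c t + (c t - (2 * (c t \<bullet> sharp X (rt t)) / (rt t \<bullet> sharp X (rt t))) *\<^sub>R rt t) = 0"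
    unfolding act_reflection[OF t] .
  then have "2 *\<^sub>R c t = (2 * (c t \<bullet> sharp X (rt t)) / (rt t \<bullet> sharp X (rt t))) *\<^sub>R rt t"
    by (simp add: scaleR_2 add_diff_eq)
  then have "(1/2) *\<^sub>R (2 *\<^sub>R c t) = (1/2) *\<^sub>R ((2 * (c t \<bullet> sharp X (rt t)) / (rt t \<bullet> sharp X (rt t))) *\<^sub>R rt t)"
    by (rule arg_cong)
  then have "c t = ((1/2) * (2 * (c t \<bullet> sharp X (rt t)) / (rt t \<bullet> sharp X (rt t)))) *\<^sub>R rt t"
    unfolding scaleR_scaleR by simp
  then show ?thesis ..
qed

lemma (in mirror_system) walls_facets:
  "(\<lambda>s. chamber \<inter> {x. ev (rt s) x = 0}) ` walls = facets chamber"
  "inj_on (\<lambda>s. chamber \<inter> {x. ev (rt s) x = 0}) walls"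
proof -
  show "(\<lambda>s. chamber \<inter> {x. ev (rt s) x = 0}) ` walls = facets chamber"
  proof
    show "(\<lambda>s. chamber \<inter> {x. ev (rt s) x = 0}) ` walls \<subseteq> facets chamber"
      unfolding facets_def using wall_facet by (intro image_subsetI CollectI)
    show "facets chamber \<subseteq> (\<lambda>s. chamber \<inter> {x. ev (rt s) x = 0}) ` walls"
    proof
      fix F assume "F \<in> facets chamber"
      then have "F facet_of chamber" unfolding facets_def by (rule CollectD)
      from facet_wall[OF this] obtain s where s: "s \<in> walls" "F = chamber \<inter> {x. ev (rt s) x = 0}"
        by (rule bexE)
      show "F \<in> (\<lambda>s. chamber \<inter> {x. ev (rt s) x = 0}) ` walls" unfolding s(2) by (rule imageI[OF s(1)])
    qed
  qed
  show "inj_on (\<lambda>s. chamber \<inter> {x. ev (rt s) x = 0}) walls"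
    by (intro inj_onI wall_facet_inj)
qed

text \<open>
  A cocycle vanishing on \<open>H\<close> is constant on the left cosets of \<open>H\<close>, so it takes finitely many
  values if \<open>H\<close> has finite index.
\<close>

lemma cocycle_finite_range:
  fixes G H :: "('a::euclidean_space \<Rightarrow> 'a) set"
  assumes G: "subgroup G (BG X)" and iso: "G \<subseteq> isometries X"
    and HG: "H \<subseteq> G" and H: "subgroup H (BG X)"
    and fin: "finite (rcosets\<^bsub>group_of X G\<^esub> H)"
    and c: "\<And>g h. g \<in> G \<Longrightarrow> h \<in> G \<Longrightarrow> c (g \<otimes>\<^bsub>BG X\<^esub> h) = c g + act X g (c h)"
    and c0: "\<And>h. h \<in> H \<Longrightarrow> c h = 0"
  shows "finite (c ` G)"
proof (rule finite_subset)
  interpret BG: group "BG X :: ('a \<Rightarrow> 'a) monoid" by (rule group_BG)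
  \<comment> \<open>The cosets at hand are right cosets. Inverting a representative passes to left
    cosets, on which \<open>c\<close> is constant, so the choice of representative does not
    matter.\<close>
  define F where "F A = c (inv\<^bsub>BG X\<^esub> (SOME a. a \<in> A))" for A
  show "finite (F ` (rcosets\<^bsub>group_of X G\<^esub> H))" using fin by (rule finite_imageI)
  show "c ` G \<subseteq> F ` (rcosets\<^bsub>group_of X G\<^esub> H)"
  proof
    fix y assume "y \<in> c ` G"
    then obtain g where g: "g \<in> G" "y = c g" by blast
    have Gc: "a \<in> carrier (BG X)" if "a \<in> G" for a using that iso isometries_carrier by blast
    let ?i = "inv\<^bsub>BG X\<^esub> g"
    have iG: "?i \<in> G" by (rule subgroup.m_inv_closed[OF G g(1)])
    define A where "A = H #>\<^bsub>group_of X G\<^esub> ?i"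
    have A: "A = (\<lambda>h. h \<otimes>\<^bsub>BG X\<^esub> ?i) ` H" unfolding A_def r_coset_def group_of_def by auto
    have "A \<in> rcosets\<^bsub>group_of X G\<^esub> H"
      unfolding A_def RCOSETS_def using iG by (auto simp: group_of_def)
    moreover have "F A = c g"
    proof -
      have "A \<noteq> {}" using subgroup.one_closed[OF H] unfolding A by blast
      then have "(SOME a. a \<in> A) \<in> A" by (simp add: some_in_eq)
      then obtain h where h: "h \<in> H" "(SOME a. a \<in> A) = h \<otimes>\<^bsub>BG X\<^esub> ?i" unfolding A by blast
      have hc: "h \<in> carrier (BG X)" using h(1) HG Gc by blast
      have ih: "inv\<^bsub>BG X\<^esub> h \<in> H" by (rule subgroup.m_inv_closed[OF H h(1)])
      have "inv\<^bsub>BG X\<^esub> (h \<otimes>\<^bsub>BG X\<^esub> ?i) = g \<otimes>\<^bsub>BG X\<^esub> inv\<^bsub>BG X\<^esub> h"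
        using hc Gc[OF g(1)] by (simp add: BG.inv_mult_group)
      then have "F A = c g + act X g (c (inv\<^bsub>BG X\<^esub> h))"
        unfolding F_def h(2) using c[OF g(1)] HG ih by auto
      moreover have "act X g 0 = 0" using act_scaleR[of g X 0 0] iso g(1) by auto
      ultimately show ?thesis using c0[OF ih] by simp
    qed
    ultimately show "y \<in> F ` (rcosets\<^bsub>group_of X G\<^esub> H)" using g(2) by (intro image_eqI[of _ _ A]) simp_all
  qed
qed

lemma generated_by_reflections_subgroup:
  assumes "generated_by_reflections X G"
  shows "subgroup G (BG X)" "G \<subseteq> isometries X" "G \<subseteq> generate (BG X) (G \<inter> reflections X)"
proof -
  obtain T where T: "T \<subseteq> reflections X" "G = generate (BG X) T"
    using assms unfolding generated_by_reflections_def by blast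
  show "subgroup G (BG X)" unfolding T(2)
    by (rule group.generate_is_subgroup[OF group_BG order_trans[OF T(1) reflections_carrier]])
  show "G \<subseteq> isometries X" unfolding T(2)
    by (rule group.generate_subgroup_incl[OF group_BG order_trans[OF T(1) reflections_isometries] subgroup_isometries])
  have "T \<subseteq> G \<inter> reflections X" using T generate.incl[of _ T "BG X"] by blast
  then show "G \<subseteq> generate (BG X) (G \<inter> reflections X)"
    unfolding T(2) by (rule group.mono_generate[OF group_BG])
qed

theorem mainTheorem2:
  fixes X :: geometry
    and G H :: "(real ^ 'n \<Rightarrow> real ^ 'n) set"
    and C D :: "(real ^ 'n) set"
    and k :: nat
  assumes "discrete_reflection_group X G"
    and "subgroup H (group_of X G)"
    and "finite (rcosets\<^bsub>group_of X G\<^esub> H)"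
    and "generated_by_reflections X H"
    and "C \<in> fundamental_chambers X G"
    and "finite_volume_polytope X C"
    and "finite (facets C)" and "card (facets C) = k"
    and "D \<in> fundamental_chambers X H"
  shows "\<exists>\<F> \<subseteq> facets D. finite \<F> \<and> card \<F> = k"
proof (rule ccontr)
  assume no: "\<not> (\<exists>\<F> \<subseteq> facets D. finite \<F> \<and> card \<F> = k)"
  \<comment> \<open>The conclusion covers infinitely many facets of \<open>D\<close> as well;
    denying it leaves finitely many, fewer than \<open>k\<close>.\<close>
  have finD: "finite (facets D)"
  proof (rule ccontr)
    assume "infinite (facets D)"
    from infinite_arbitrarily_large[OF this, of k] show False using no by blast
  qed
  have lt: "card (facets D) < k"
  proof (rule ccontr)
    assume "\<not> card (facets D) < k"
    then have "k \<le> card (facets D)" by simp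
    then obtain T where "T \<subseteq> facets D" "card T = k" "finite T" by (rule obtain_subset_with_card_n)
    then show False using no by blast
  qed
  have genG: "generated_by_reflections X G" and disc: "discrete G"
    using assms(1) unfolding discrete_reflection_group_def by blast+
  note G = generated_by_reflections_subgroup[OF genG]
  note H = generated_by_reflections_subgroup[OF assms(4)]
  have HG: "H \<subseteq> G" using subgroup.subset[OF assms(2)] by (simp add: group_of_def)
  have locG: "finite {s \<in> G \<inter> reflections X. mirror X s \<inter> K \<noteq> {}}" if "compact K" "K \<subseteq> points X" for K
    by (rule discrete_locally_finite[OF G(1,2) disc that])
  have locH: "finite {s \<in> H \<inter> reflections X. mirror X s \<inter> K \<noteq> {}}" if "compact K" "K \<subseteq> points X" for K
    by (rule finite_subset[OF _ locG[OF that]]) (use HG in blast)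
  obtain x0 where x0: "mirror_system X G x0" "C = mirror_system.chamber X G x0"
    by (rule fundamental_chamber_mirror_system[OF G(1,2) locG assms(5)]) blast+
  obtain y0 where y0: "mirror_system X H y0" "D = mirror_system.chamber X H y0"
    by (rule fundamental_chamber_mirror_system[OF H(1,2) locH assms(9)]) blast+
  interpret GG: mirror_system X G x0 by (rule x0(1))
  interpret HH: mirror_system X H y0 by (rule y0(1))
  have finW: "finite GG.walls" and cardW: "card GG.walls = k"
    using finite_image_iff[OF GG.walls_facets(2)] card_image[OF GG.walls_facets(2)] assms(7,8)
    unfolding GG.walls_facets(1) x0(2) by simp_all
  have finV: "finite HH.walls" and cardV: "card HH.walls < card GG.walls"
    using finite_image_iff[OF HH.walls_facets(2)] card_image[OF HH.walls_facets(2)] finD lt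
    unfolding HH.walls_facets(1) y0(2) cardW by simp_all
  have vol: "emeasure (volume X) GG.chamber \<noteq> \<infinity>"
    using assms(6) unfolding finite_volume_polytope_def x0(2) by auto
  \<comment> \<open>Cocycles dual to the walls of \<open>C\<close>: the \<open>i\<close>-th takes
    the root at the wall \<open>i\<close> and zero at the other walls.\<close>
  have "\<exists>c. (\<forall>g\<in>G. \<forall>h\<in>G. c (g \<otimes>\<^bsub>BG X\<^esub> h) = c g + act X g (c h))
      \<and> (\<forall>s\<in>GG.walls. c s = (if s = i then 1 else 0) *\<^sub>R GG.rt s)" for i
    by (rule GG.cocycle_of_weights) (use G(3) in \<open>simp add: GG.R_def\<close>)
  from choice[OF allI[OF this]]
  obtain c where c: "\<forall>i. (\<forall>g\<in>G. \<forall>h\<in>G. c i (g \<otimes>\<^bsub>BG X\<^esub> h) = c i g + act X g (c i h))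
      \<and> (\<forall>s\<in>GG.walls. c i s = (if s = i then 1 else 0) *\<^sub>R GG.rt s)" ..
  have c_mult: "c i (g \<otimes>\<^bsub>BG X\<^esub> h) = c i g + act X g (c i h)" if "g \<in> G" "h \<in> G" for i g h
    using bspec[OF bspec[OF conjunct1[OF spec[OF c, of i]] that(1)] that(2)] .
  have c_wall: "c i s = (if s = i then 1 else 0) *\<^sub>R GG.rt s" if "s \<in> GG.walls" for i s
    using bspec[OF conjunct2[OF spec[OF c, of i]] that] .
  have exl: "\<exists>l. c i t = l *\<^sub>R HH.rt t" if t: "t \<in> HH.walls" for i t
  proof (rule HH.cocycle_on_wall[OF _ HH.walls_R[OF t]])
    show "c i (g \<otimes>\<^bsub>BG X\<^esub> h) = c i g + act X g (c i h)" if "g \<in> H" "h \<in> H" for g h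
      using that HG by (intro c_mult) auto
  qed
  define l where "l i t = (SOME x. c i t = x *\<^sub>R HH.rt t)" for i t
  have l: "c i t = l i t *\<^sub>R HH.rt t" if t: "t \<in> HH.walls" for i t
    unfolding l_def by (rule someI_ex[OF exl[OF t]])
  \<comment> \<open>There are more of these cocycles than walls of \<open>D\<close>, so a nontrivial
    combination \<open>d\<close> vanishes at every wall of \<open>D\<close>.\<close>
  from dependent_rows[OF finV finW cardV, of l]
  obtain \<mu> where mu: "(\<exists>i\<in>GG.walls. \<mu> i \<noteq> 0) \<and> (\<forall>t\<in>HH.walls. (\<Sum>i\<in>GG.walls. \<mu> i * l i t) = 0)" ..
  note mu = conjunct1[OF mu] conjunct2[OF mu]
  define d where "d g = (\<Sum>i\<in>GG.walls. \<mu> i *\<^sub>R c i g)" for g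
  have d_mult: "d (g \<otimes>\<^bsub>BG X\<^esub> h) = d g + act X g (d h)" if gh: "g \<in> G" "h \<in> G" for g h
  proof -
    have gi: "g \<in> isometries X" using gh(1) G(2) by blast
    show ?thesis unfolding d_def act_sum[OF gi] act_scaleR[OF gi] c_mult[OF gh]
      by (simp add: scaleR_add_right sum.distrib)
  qed
  have d_wall: "d s = \<mu> s *\<^sub>R GG.rt s" if s: "s \<in> GG.walls" for s
  proof -
    have "d s = (\<Sum>i\<in>GG.walls. if s = i then \<mu> i *\<^sub>R GG.rt s else 0)"
      unfolding d_def c_wall[OF s] by (rule sum.cong) simp_all
    then show ?thesis using finW s by simp
  qed
  have d_HH: "d t = 0" if t: "t \<in> HH.walls" for t
  proof -
    have "d t = (\<Sum>i\<in>GG.walls. \<mu> i * l i t) *\<^sub>R HH.rt t"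
      unfolding d_def l[OF t] by (simp add: scaleR_sum_left)
    then show ?thesis using mu(2) t by simp
  qed
  have sgW: "subgroup (generate (BG X) HH.walls) (BG X)"
    by (rule group.generate_is_subgroup[OF group_BG]) (use HH.walls_R HH.R_carrier in blast)
  have "generate (BG X) HH.R \<subseteq> generate (BG X) HH.walls"
    by (rule group.generate_subgroup_incl[OF group_BG _ sgW]) (use HH.R_generated in blast)
  then have H_gen: "H \<subseteq> generate (BG X) HH.walls" using H(3) unfolding HH.R_def by blast
  have act0: "act X g 0 = 0" if "g \<in> G" for g
    using act_scaleR[of g X 0 0] that G(2) by auto
  have oneG: "\<one>\<^bsub>BG X\<^esub> \<in> G" by (rule subgroup.one_closed[OF G(1)])
  have d_one: "d \<one>\<^bsub>BG X\<^esub> = 0"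
  proof -
    have "\<one>\<^bsub>BG X\<^esub> \<otimes>\<^bsub>BG X\<^esub> \<one>\<^bsub>BG X\<^esub> = (\<one>\<^bsub>BG X\<^esub> :: real ^ 'n \<Rightarrow> real ^ 'n)"
      by (rule monoid.l_one[OF group.is_monoid[OF group_BG] monoid.one_closed[OF group.is_monoid[OF group_BG]]])
    then have "d \<one>\<^bsub>BG X\<^esub> = d \<one>\<^bsub>BG X\<^esub> + d \<one>\<^bsub>BG X\<^esub>"
      using d_mult[OF oneG oneG] by (simp only: act_one)
    then show ?thesis by simp
  qed
  \<comment> \<open>The walls of \<open>D\<close> generate \<open>H\<close>, so vanishing there
    propagates to all of \<open>H\<close> by the cocycle identity.\<close>
  have "d h = 0 \<and> h \<in> G" if "h \<in> generate (BG X) HH.walls" for h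
    using that
  proof (induction rule: generate.induct)
    case one
    show ?case using d_one oneG by (rule conjI)
  next
    case (incl h)
    then show ?case using d_HH[OF incl] subsetD[OF HG HH.R_\<Gamma>[OF HH.walls_R[OF incl]]] by blast
  next
    case (inv h)
    have "inv\<^bsub>BG X\<^esub> h = h"
      by (rule group.inv_equality[OF group_BG])
        (use reflection_square[OF HH.R_refl[OF HH.walls_R[OF inv]]] HH.R_carrier[OF HH.walls_R[OF inv]] in simp_all)
    then show ?case using d_HH[OF inv] subsetD[OF HG HH.R_\<Gamma>[OF HH.walls_R[OF inv]]] by simp
  next
    case (eng h1 h2)
    have h: "h1 \<in> G" "h2 \<in> G" "d h1 = 0" "d h2 = 0" using eng.IH by simp_all
    show ?case unfolding d_mult[OF h(1,2)] h(3,4) act0[OF h(1)]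
      using subgroup.m_closed[OF G(1) h(1,2)] by simp
  qed
  then have d0: "d h = 0" if "h \<in> H" for h using that H_gen by blast
  have fin: "finite (d ` G)"
    by (rule cocycle_finite_range[OF G(1,2) HG H(1) assms(3) d_mult d0])
  have "\<mu> s = 0" if s: "s \<in> GG.walls" for s
  proof (rule GG.finite_orbit_root[OF vol GG.walls_R[OF s]])
    have sG: "s \<in> G" by (rule GG.R_\<Gamma>[OF GG.walls_R[OF s]])
    \<comment> \<open>The cocycle identity writes a translate of \<open>d s\<close> as a difference
      of two values of \<open>d\<close>, and \<open>d\<close> has finite range.\<close>
    have "(\<lambda>g. act X g (\<mu> s *\<^sub>R GG.rt s)) ` G \<subseteq> (\<lambda>(a, b). a - b) ` (d ` G \<times> d ` G)"
    proof
      fix y assume "y \<in> (\<lambda>g. act X g (\<mu> s *\<^sub>R GG.rt s)) ` G"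
      then obtain g where g: "g \<in> G" "y = act X g (d s)" unfolding d_wall[OF s] by blast
      have "y = d (g \<otimes>\<^bsub>BG X\<^esub> s) - d g" unfolding g(2) d_mult[OF g(1) sG] by simp
      then have "y = (\<lambda>(a, b). a - b) (d (g \<otimes>\<^bsub>BG X\<^esub> s), d g)" by simp
      then show "y \<in> (\<lambda>(a, b). a - b) ` (d ` G \<times> d ` G)"
        by (rule image_eqI) (intro SigmaI imageI g(1) subgroup.m_closed[OF G(1) g(1) sG])
    qed
    then show "finite ((\<lambda>g. act X g (\<mu> s *\<^sub>R GG.rt s)) ` G)"
      by (rule finite_subset) (use fin in simp)
  qed
  then show False using mu(1) by blast
qed

end
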